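(* Let $\delta\in\{1,2\}$, let $\Gamma$ and $\Lambda[\delta]$ be fixed, and let $\phi\in\Sigma_{\Gamma,\Lambda[\delta]}$ have multiplicity $(m_1,m_2)$. Then $\phi$ is $\mathcal A$-equivalent to a bigerm of one of the following forms, where $j_1,k,j_2$ denote integers with $m_1<j_1<k$, $m_2<j_2$, the coefficients $a_{ij}$ are complex numbers, the sums over terms in $t_1$ run over exponents $j>k$ and the sums over terms in $t_2$ run over exponents $j>m_2$, subject to the conditions written under them. Distinct tangents case ($\delta=1$): a) $\left[\left(t_1^{m_1},\ t_1^{j_1}+t_1^k+\sum_{\underline{j}\notin M,\ F_1(\underline{j})=\emptyset}a_{1j}t_1^j\right),\ \left(\sum_{F_2(\underline{j})=\emptyset}a_{2j}t_2^j,\ t_2^{m_2}\right)\right]$; b) $\left[(t_1^{m_1},t_1^{j_1}),\ (t_2^{j_2},t_2^{m_2})\right]$; c) $\left[(t_1^{m_1},t_1^{j_1}),\ (0,t_2)\right]$; d) $\left[(t_1,0),\ (0,t_2)\right]$. Same tangents case ($\delta=2$): a$'$) $\left[\left(t_1^{m_1},\ t_1^{j_1}+t_1^k+\sum_{\underline{j}\notin M,\ F_1(\underline{j})=\emptyset}a_{1j}t_1^j\right),\ \left(t_2^{m_2},\ \sum_{F_2(\underline{j})=\emptyset}a_{2j}t_2^j\right)\right]$; b$'$) $\left[(t_1^{m_1},t_1^{j_1}),\ (t_2^{m_2},t_2^{j_2})\right]$ with $m_1\neq m_2$ or $j_1\neq j_2$; c$'$) $\left[(t_1^{m_1},t_1^{j_1}),\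 (t_2^{m_1},a t_2^{j_1})\right]$ with $a\in\mathbb C\setminus\{0,1\}$; d$'$) $\left[(t_1^{m_1},t_1^{j_1}),\ (t_2,0)\right]$.
   Context: A bigerm $\phi=[\phi_1,\phi_2]$ is a pair of parametrizations $\phi_i=(\phi_{i1},\phi_{i2}):(\mathbb C,0)\to(\mathbb C^2,0)$, with parameter $t_i$, of the two (distinct) branches of a reduced germ of plane analytic curve with exactly two irreducible components; $m_i$ is the multiplicity of the $i$-th branch and $m=(m_1,m_2)$ is the multiplicity of $\phi$. The group $\mathcal A=\mathrm{Aut}(\mathbb C\{t_1\})\times\mathrm{Aut}(\mathbb C\{t_2\})\times\mathrm{Aut}(\mathbb C\{x,y\})$ (analytic coordinate changes) acts on bigerms by $(\rho_1,\rho_2,\sigma)\cdot\phi=[\sigma\circ\phi_1\circ\rho_1^{-1},\ \sigma\circ\phi_2\circ\rho_2^{-1}]$; two bigerms in the same orbit are called $\mathcal A$-equivalent. Puiseux form. The index $\delta=1$ refers to distinct tangents and $\delta=2$ to equal tangents of the two branches. A bigerm is in Puiseux form if $\phi_1=(t_1^{m_1},\sum_{i>m_1}a_{1i}t_1^i)$ and $\phi_2=(\sum_{i>m_2}a_{2i}t_2^i,\ t_2^{m_2})$ when $\delta=1$, respectively $\phi_2=(t_2^{m_2},\sum_{i>m_2}a_{2i}t_2^i)$ when $\delta=2$. Invariants. With $\mathrm{ord}\,0=\infty$: for $\eta\in\mathbb C\{x,y\}$, $\nu_i(\eta)=\mathrm{ord}_{t_i}(\eta\circ\phi_i)$, and the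 semigroup of values is $\Gamma=\{(\nu_1(\eta),\nu_2(\eta));\ \eta\in\mathbb C\{x,y\}\}$. Let $(c_1,c_2)$ be the conductor of $\Gamma$ and $c=\max\{c_1,c_2\}$. For a differential $\omega=\eta_1dx+\eta_2dy$ put $\omega\circ\phi_i=\eta_1(\phi_i)\phi_{i1}'+\eta_2(\phi_i)\phi_{i2}'$, $\nu_i(\omega)=\mathrm{ord}_{t_i}(\omega\circ\phi_i)+1$ and $\nu(\omega)=(\nu_1(\omega),\nu_2(\omega))$. Let $$\Omega[\delta]=\{\eta_1dx+(\beta(\delta-1)y+\eta_2)dy;\ \eta_1,\eta_2\in(x,y)^2\mathbb C\{x,y\},\ \beta\in\mathbb C\},\qquad \Lambda[\delta]=\{\nu(\omega)-m;\ \omega\in\Omega[\delta]\}.$$ $\Sigma_{\Gamma,\Lambda[\delta]}$ is the (finite dimensional) set of bigerms in Puiseux form of case $\delta$, with all terms of order at most $c$, having the given $\Gamma$ and the given $\Lambda[\delta]$. Fibers and maximal points. For $(a_1,a_2)\in\mathbb N^2$ and $\{i,l\}=\{1,2\}$, $F_i(a_1,a_2)=\{(b_1,b_2)\in\Lambda[\delta];\ b_i=a_i,\ b_l>a_l\}$. $M$ is the set of maximal points of $\Lambda[\delta]$, i.e. of points $(k_1,k_2)\in\Lambda[\delta]$ with $F_1(k_1,k_2)=F_2(k_1,k_2)=\emptyset$. For $j\in\mathbb N$, $\underline{j}=(j,j)$. *)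

theory Defs
  imports "HOL-Analysis.Analysis"
begin

unbundle no vec_syntax and fps_syntax

section \<open>Convergent power series\<close>

definition conv1 :: "complex fps set" where
  "conv1 = {f. fps_conv_radius f > 0}"

text \<open>A series in \<open>x, y\<close> is an iterated series: \<open>\<eta> $ i $ j\<close> is the coefficient of
  \<open>x ^ i * y ^ j\<close>.\<close>

type_synonym series2 = "complex fps fps"

definition conv2 :: "series2 set" where
  "conv2 = {\<eta>. \<exists>r::real. r > 0 \<and> (\<lambda>(i, j). norm (\<eta> $ i $ j) * r ^ (i + j)) summable_on UNIV}"

definition var_x :: series2 where "var_x = fps_X"

definition var_y :: series2 where "var_y = fps_const fps_X"

definition scalar2 :: "complex \<Rightarrow> series2" where "scalar2 c = fps_const (fps_const c)"

definition fps_ord :: "complex fps \<Rightarrow> enat" where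
  "fps_ord f = (if f = 0 then \<infinity> else enat (subdegree f))"

type_synonym param = "complex fps \<times> complex fps"
type_synonym bigerm = "param \<times> param"

text \<open>The composite \<open>\<eta> (f, g)\<close>, meaningful when \<open>f $ 0 = 0\<close> and \<open>g $ 0 = 0\<close>: then \<open>f ^ i * g ^ j\<close>
  has order at least \<open>i + j\<close>, so that the finite sum contains all contributions to the
  coefficient of \<open>t ^ n\<close>.\<close>

definition subst2 :: "series2 \<Rightarrow> param \<Rightarrow> complex fps" where
  "subst2 \<eta> p = Abs_fps (\<lambda>n. \<Sum>i\<le>n. \<Sum>j\<le>n. \<eta> $ i $ j * (fst p ^ i * snd p ^ j) $ n)"

section \<open>Bigerms\<close>

definition map_germ :: "param \<Rightarrow> bool" where
  "map_germ p \<longleftrightarrow> fst p \<in> conv1 \<and> snd p \<in> conv1 \<and> fst p $ 0 = 0 \<and> snd p $ 0 = 0"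

text \<open>A parametrization of a branch is primitive: it does not factor through a map germ
  \<open>(\<complex>, 0) \<rightarrow> (\<complex>, 0)\<close> of order at least 2. The zero map factors in this way, so it is excluded.\<close>

definition branch_param :: "param \<Rightarrow> bool" where
  "branch_param p \<longleftrightarrow> map_germ p \<and>
     \<not> (\<exists>q \<tau>. map_germ q \<and> \<tau> \<in> conv1 \<and> fps_ord \<tau> \<ge> 2 \<and>
           p = (fst q oo \<tau>, snd q oo \<tau>))"

text \<open>The ideal of the curve germ parametrized by \<open>p\<close>; it determines the branch.\<close>

definition branch_ideal :: "param \<Rightarrow> series2 set" where
  "branch_ideal p = {\<eta> \<in> conv2. subst2 \<eta> p = 0}"

definition is_bigerm :: "bigerm \<Rightarrow> bool" where
  "is_bigerm \<phi> \<longleftrightarrow> branch_param (fst \<phi>) \<and> branch_param (snd \<phi>) \<and>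
     branch_ideal (fst \<phi>) \<noteq> branch_ideal (snd \<phi>)"

text \<open>For a primitive parametrization the multiplicity of the branch is the order of the
  parametrization.\<close>

definition branch_mult :: "param \<Rightarrow> nat" where
  "branch_mult p = the_enat (min (fps_ord (fst p)) (fps_ord (snd p)))"

definition bigerm_mult :: "bigerm \<Rightarrow> nat \<times> nat" where
  "bigerm_mult \<phi> = (branch_mult (fst \<phi>), branch_mult (snd \<phi>))"

section \<open>Coordinate changes\<close>

text \<open>Automorphisms of \<open>\<complex>{t}\<close> and \<open>\<complex>{x,y}\<close> are given by the images of the variables.\<close>

definition aut1 :: "complex fps set" where
  "aut1 = {\<rho> \<in> conv1. \<rho> $ 0 = 0 \<and> \<rho> $ 1 \<noteq> 0}"

definition aut2 :: "(series2 \<times> series2) set" where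
  "aut2 = {(\<sigma>1, \<sigma>2). \<sigma>1 \<in> conv2 \<and> \<sigma>2 \<in> conv2 \<and> \<sigma>1 $ 0 $ 0 = 0 \<and> \<sigma>2 $ 0 $ 0 = 0 \<and>
     \<sigma>1 $ 1 $ 0 * \<sigma>2 $ 0 $ 1 - \<sigma>1 $ 0 $ 1 * \<sigma>2 $ 1 $ 0 \<noteq> 0}"

definition act_param :: "complex fps \<Rightarrow> series2 \<times> series2 \<Rightarrow> param \<Rightarrow> param" where
  "act_param \<rho> \<sigma> p = (subst2 (fst \<sigma>) p oo fps_inv \<rho>, subst2 (snd \<sigma>) p oo fps_inv \<rho>)"

definition act_bigerm ::
    "complex fps \<times> complex fps \<times> (series2 \<times> series2) \<Rightarrow> bigerm \<Rightarrow> bigerm" where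
  "act_bigerm = (\<lambda>(\<rho>1, \<rho>2, \<sigma>) \<phi>. (act_param \<rho>1 \<sigma> (fst \<phi>), act_param \<rho>2 \<sigma> (snd \<phi>)))"

definition A_equivalent :: "bigerm \<Rightarrow> bigerm \<Rightarrow> bool" where
  "A_equivalent \<phi> \<psi> \<longleftrightarrow> is_bigerm \<phi> \<and> is_bigerm \<psi> \<and>
     (\<exists>g \<in> aut1 \<times> aut1 \<times> aut2. \<psi> = act_bigerm g \<phi>)"

section \<open>Puiseux form\<close>

definition terms_in :: "nat set \<Rightarrow> (nat \<Rightarrow> complex) \<Rightarrow> complex fps" where
  "terms_in J a = Abs_fps (\<lambda>j. if j \<in> J then a j else 0)"

definition puiseux_form :: "nat \<Rightarrow> bigerm \<Rightarrow> bool" where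
  "puiseux_form \<delta> \<phi> \<longleftrightarrow> (\<exists>m1 m2 a1 a2. bigerm_mult \<phi> = (m1, m2) \<and>
     fst \<phi> = (fps_X ^ m1, terms_in {m1<..} a1) \<and>
     (\<delta> = 1 \<and> snd \<phi> = (terms_in {m2<..} a2, fps_X ^ m2) \<or>
      \<delta> = 2 \<and> snd \<phi> = (fps_X ^ m2, terms_in {m2<..} a2)))"

section \<open>Values of functions and differentials\<close>

definition value_semigroup :: "bigerm \<Rightarrow> (enat \<times> enat) set" where
  "value_semigroup \<phi> =
     {(fps_ord (subst2 \<eta> (fst \<phi>)), fps_ord (subst2 \<eta> (snd \<phi>))) | \<eta>. \<eta> \<in> conv2}"

text \<open>The conductor is the smallest \<open>(c\<^sub>1, c\<^sub>2)\<close>, for the product order, such that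
  \<open>(c\<^sub>1, c\<^sub>2) + \<nat>\<^sup>2 \<subseteq> \<Gamma>\<close>.\<close>

definition conductor :: "(enat \<times> enat) set \<Rightarrow> nat \<times> nat" where
  "conductor \<Gamma> =
     (let C = {(c1, c2). \<forall>a b. a \<ge> c1 \<longrightarrow> b \<ge> c2 \<longrightarrow> (enat a, enat b) \<in> \<Gamma>}
      in THE c. c \<in> C \<and> (\<forall>d \<in> C. fst c \<le> fst d \<and> snd c \<le> snd d))"

definition conductor_max :: "(enat \<times> enat) set \<Rightarrow> nat" where
  "conductor_max \<Gamma> = max (fst (conductor \<Gamma>)) (snd (conductor \<Gamma>))"

text \<open>The pair \<open>(P, Q)\<close> stands for the differential \<open>P dx + Q dy\<close>.\<close>

type_synonym form1 = "series2 \<times> series2"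

definition pullback :: "form1 \<Rightarrow> param \<Rightarrow> complex fps" where
  "pullback \<omega> p =
     subst2 (fst \<omega>) p * fps_deriv (fst p) + subst2 (snd \<omega>) p * fps_deriv (snd p)"

definition form_value :: "form1 \<Rightarrow> param \<Rightarrow> enat" where
  "form_value \<omega> p = fps_ord (pullback \<omega> p) + 1"

definition max_ideal_sq :: "series2 set" where
  "max_ideal_sq = {a * var_x ^ 2 + b * (var_x * var_y) + c * var_y ^ 2 | a b c.
     a \<in> conv2 \<and> b \<in> conv2 \<and> c \<in> conv2}"

definition Omega :: "nat \<Rightarrow> form1 set" where
  "Omega \<delta> = {(\<eta>1, scalar2 (\<beta> * (of_nat \<delta> - 1)) * var_y + \<eta>2) | \<eta>1 \<eta>2 \<beta>.
     \<eta>1 \<in> max_ideal_sq \<and> \<eta>2 \<in> max_ideal_sq}"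

text \<open>For bigerms every element of \<open>Omega \<delta>\<close> has \<open>i\<close>-th value at least \<open>m\<^sub>i\<close>, so the subtraction
  does not truncate; moreover \<open>\<infinity> - m = \<infinity>\<close> in \<^typ>\<open>enat\<close>.\<close>

definition Lambda_set :: "nat \<Rightarrow> bigerm \<Rightarrow> (enat \<times> enat) set" where
  "Lambda_set \<delta> \<phi> =
     {(form_value \<omega> (fst \<phi>) - enat (branch_mult (fst \<phi>)),
       form_value \<omega> (snd \<phi>) - enat (branch_mult (snd \<phi>))) | \<omega>. \<omega> \<in> Omega \<delta>}"

definition terms_upto :: "nat \<Rightarrow> param \<Rightarrow> bool" where
  "terms_upto c p \<longleftrightarrow> (\<forall>i>c. fst p $ i = 0 \<and> snd p $ i = 0)"

definition Sigma_set ::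
    "nat \<Rightarrow> (enat \<times> enat) set \<Rightarrow> (enat \<times> enat) set \<Rightarrow> bigerm set" where
  "Sigma_set \<delta> \<Gamma> \<Lambda> = {\<phi>. is_bigerm \<phi> \<and> puiseux_form \<delta> \<phi> \<and>
     terms_upto (conductor_max \<Gamma>) (fst \<phi>) \<and> terms_upto (conductor_max \<Gamma>) (snd \<phi>) \<and>
     value_semigroup \<phi> = \<Gamma> \<and> Lambda_set \<delta> \<phi> = \<Lambda>}"

section \<open>Fibers and maximal points\<close>

definition fiber1 :: "(enat \<times> enat) set \<Rightarrow> nat \<times> nat \<Rightarrow> (enat \<times> enat) set" where
  "fiber1 \<Lambda> a = {(b1, b2). (b1, b2) \<in> \<Lambda> \<and> b1 = enat (fst a) \<and> b2 > enat (snd a)}"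

definition fiber2 :: "(enat \<times> enat) set \<Rightarrow> nat \<times> nat \<Rightarrow> (enat \<times> enat) set" where
  "fiber2 \<Lambda> a = {(b1, b2). (b1, b2) \<in> \<Lambda> \<and> b2 = enat (snd a) \<and> b1 > enat (fst a)}"

definition maximal_points :: "(enat \<times> enat) set \<Rightarrow> (nat \<times> nat) set" where
  "maximal_points \<Lambda> = {k. (enat (fst k), enat (snd k)) \<in> \<Lambda> \<and> fiber1 \<Lambda> k = {} \<and> fiber2 \<Lambda> k = {}}"

end

theory Submission
  imports Defs
begin

text \<open>A form \<open>\<omega> = P dx + Q dy\<close> in \<open>Omega \<delta>\<close> corresponds to the vector field
  \<open>V = - Q \<partial>\<^sub>x + P \<partial>\<^sub>y\<close>. Along a branch in Puiseux form, \<open>V\<close> is the image of a field on the parameter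
  line plus a vertical defect whose order is the value of \<open>\<omega>\<close> minus the multiplicity. Hence the
  exponential of \<open>V\<close> changes the Puiseux series of the branch exactly by this defect, up to higher
  order, and remains harmless after any unipotent coordinate change applied before. A point
  \<open>(j, v)\<close> of \<open>\<Lambda>\<close> with \<open>v > j\<close> therefore allows an arbitrary choice of the coefficient of
  \<open>t\<^sub>1 ^ j\<close> without altering the terms of order at most \<open>j\<close> of the second branch, and similarly for
  the other fiber and for maximal points. Since only finitely many orders matter, finite partial sums
  of the exponential suffice.

  The remaining terms of high order are removed in one step: by Lagrange interpolation over the
  conjugates of each branch, every pair of convergent series of sufficiently high order is the
  restriction of one convergent \<open>g\<close> to the two branches. In particular all large orders are
  eliminable, so that the two leading terms of the first branch, if missing, can be created there.
  Thus the first of the listed forms is always reached.\<close>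

section \<open>Congruences between power series\<close>

text \<open>The set \<open>Lambda_set\<close> belongs to the given bigerm. To keep using it, the
  elimination never restarts from a partially normalized bigerm: it carries one accumulated
  coordinate change of the original branches, and each new flow acts on the original curve, inside
  the changes already made. That the Puiseux series of the image still moves by the same defect
  rests on a balance of orders: taking an \<open>m\<close>-th root to recover the parameter loses
  \<open>m - 1\<close> orders, whereas substituting the result into a series of order above
  \<open>m\<close> gains \<open>m\<close>. The second obstacle is convergence. The parameters and
  Puiseux series met on the way are treated as formal; only the coordinate changes are kept
  convergent. At the end everything formal is cut off to polynomials, and the discrepancy is
  absorbed by convergent corrections from the square of the maximal ideal. That the truncated pair
  is again a bigerm is then read off from orders of functions, transported by a coordinate change
  inverted up to finite order.\<close>

lemma fps_X_power_dvd_iff: "fps_X ^ N dvd (f :: complex fps) \<longleftrightarrow> (\<forall>n<N. f $ n = 0)"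
proof
  assume "fps_X ^ N dvd f"
  then show "\<forall>n<N. f $ n = 0"
    by (auto simp: dvd_def fps_X_power_mult_nth)
next
  assume *: "\<forall>n<N. f $ n = 0"
  have "f = fps_X ^ N * fps_shift N f"
    by (rule fps_ext) (use * in \<open>auto simp: fps_X_power_mult_nth\<close>)
  then show "fps_X ^ N dvd f"
    by (metis dvd_triv_left)
qed

lemma fps_X_dvd_iff: "fps_X dvd (f :: complex fps) \<longleftrightarrow> f $ 0 = 0"
  using fps_X_power_dvd_iff[of 1 f] by simp

lemma fps_ord_dvd_iff: "fps_X ^ N dvd f \<longleftrightarrow> enat N \<le> fps_ord f"
proof (cases "f = 0")
  case False
  then have "(\<forall>n<N. f $ n = 0) \<longleftrightarrow> N \<le> subdegree f"
    by (metis nth_less_subdegree_zero order_less_le_trans subdegree_geI)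
  with False show ?thesis by (simp add: fps_ord_def fps_X_power_dvd_iff)
qed (simp add: fps_ord_def)

text \<open>Telescoping leaves, besides \<open>f - g\<close>, a factor homogeneous of degree
  \<open>i\<close> in two series without constant term, whence the \<open>i\<close> extra
  orders.\<close>

lemma power_dvd_power_diff:
  fixes f g :: "complex fps"
  assumes "fps_X ^ a dvd f - g" and "fps_X dvd f" and "fps_X dvd g"
  shows "fps_X ^ (a + i) dvd f ^ Suc i - g ^ Suc i"
proof (induction i)
  case 0
  then show ?case using assms by simp
next
  case (Suc i)
  have eq: "f ^ Suc (Suc i) - g ^ Suc (Suc i) = f * (f ^ Suc i - g ^ Suc i) + (f - g) * g ^ Suc i"
    by (simp add: algebra_simps)
  have "fps_X * fps_X ^ (a + i) dvd f * (f ^ Suc i - g ^ Suc i)"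
    by (intro mult_dvd_mono assms Suc)
  moreover have "fps_X ^ a * fps_X ^ Suc i dvd (f - g) * g ^ Suc i"
    by (intro mult_dvd_mono assms dvd_power_same)
  ultimately show ?case unfolding eq
    by (intro dvd_add) (simp_all add: power_add mult_ac)
qed

lemma compose_dvd_compose:
  fixes f c :: "complex fps"
  assumes "fps_X ^ N dvd f" and "c $ 0 = 0"
  shows "fps_X ^ N dvd f oo c"
proof -
  obtain k where k: "f = fps_X ^ N * k" using assms(1) by (auto simp: dvd_def)
  have "f oo c = c ^ N * (k oo c)"
    unfolding k using assms(2) by (simp add: fps_compose_mult_distrib fps_X_power_compose)
  moreover have "fps_X ^ N dvd c ^ N"
    using assms(2) by (simp add: dvd_power_same fps_X_dvd_iff)
  ultimately show ?thesis by simp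
qed

text \<open>Powers up to the \<open>m\<close>-th are absent from \<open>y\<close>, and a difference
  of \<open>i\<close>-th powers gains \<open>i - 1\<close> orders. For a branch of multiplicity
  \<open>m\<close> this gain of \<open>m\<close> exceeds by one the loss in extracting an
  \<open>m\<close>-th root.\<close>

lemma compose_diff_dvd:
  fixes y f g :: "complex fps"
  assumes "fps_X ^ a dvd f - g" and "f $ 0 = 0" and "g $ 0 = 0" and "fps_X ^ Suc m dvd y"
  shows "fps_X ^ (a + m) dvd (y oo f) - (y oo g)"
  unfolding fps_X_power_dvd_iff
proof (intro allI impI)
  fix n assume n: "n < a + m"
  have eq: "y $ i * (f ^ i $ n) = y $ i * (g ^ i $ n)" for i
  proof (cases "i \<le> m")
    case True
    then show ?thesis using assms(4) by (simp add: fps_X_power_dvd_iff del: power_Suc)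
  next
    case False
    have "fps_X ^ (a + (i - 1)) dvd f ^ Suc (i - 1) - g ^ Suc (i - 1)"
      by (rule power_dvd_power_diff) (use assms in \<open>auto simp: fps_X_dvd_iff\<close>)
    then have "(f ^ i - g ^ i) $ n = 0" 
      unfolding fps_X_power_dvd_iff using n False by auto
    then show ?thesis by simp
  qed
  then show "((y oo f) - (y oo g)) $ n = 0"
    unfolding fps_sub_nth fps_compose_nth eq by simp
qed

lemma compose_cong_right:
  fixes y f g :: "complex fps"
  assumes "fps_X ^ a dvd f - g" and "f $ 0 = 0" and "g $ 0 = 0"
  shows "fps_X ^ a dvd (y oo f) - (y oo g)"
proof -
  define z where "z = y - fps_const (y $ 0)"
  have "fps_X ^ Suc 0 dvd z" by (simp add: z_def fps_X_dvd_iff)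
  from compose_diff_dvd[OF assms this] show ?thesis by (simp add: z_def fps_compose_sub_distrib)
qed

lemma compose_cong_left:
  fixes f g c :: "complex fps"
  assumes "fps_X ^ N dvd f - g" and "c $ 0 = 0"
  shows "fps_X ^ N dvd (f oo c) - (g oo c)"
  using compose_dvd_compose[OF assms] by (simp add: fps_compose_sub_distrib)

text \<open>After division by \<open>fps_X ^ m\<close> the cofactor of \<open>f - g\<close> has
  constant term \<open>Suc m\<close>, a unit in characteristic zero; so passing from
  \<open>Suc m\<close>-th powers to their bases costs only \<open>m\<close> orders.\<close>

lemma power_diff_dvd_cancel:
  fixes f g :: "complex fps"
  assumes f: "f $ 0 = 0" "f $ 1 = 1" and g: "g $ 0 = 0" "g $ 1 = 1"
    and dvd: "fps_X ^ (a + m) dvd f ^ Suc m - g ^ Suc m"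
  shows "fps_X ^ a dvd f - g"
proof -
  define F where "F = fps_shift 1 f"
  define G where "G = fps_shift 1 g"
  have F: "f = fps_X * F" and G: "g = fps_X * G"
    unfolding F_def G_def by (rule fps_ext; use f g in \<open>auto simp: fps_X_mult_nth\<close>)+
  have F0: "F $ 0 = 1" "G $ 0 = 1" using f g by (auto simp: F_def G_def)
  define S where "S = (\<Sum>i<Suc m. F ^ i * G ^ (m - i))"
  have "F ^ Suc m - G ^ Suc m = (F - G) * S"
    unfolding S_def power_diff_sumr2 by (simp add: mult_ac)
  have eq: "f ^ Suc m - g ^ Suc m = fps_X ^ m * ((f - g) * S)"
  proof -
    have "f ^ Suc m - g ^ Suc m = fps_X * fps_X ^ m * (F ^ Suc m - G ^ Suc m)"
      unfolding F G power_mult_distrib by (simp add: algebra_simps)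
    also have "\<dots> = fps_X ^ m * ((fps_X * F - fps_X * G) * S)"
      unfolding \<open>F ^ Suc m - G ^ Suc m = (F - G) * S\<close> by (simp add: algebra_simps)
    finally show ?thesis unfolding F G .
  qed
  have "S $ 0 = (\<Sum>i<Suc m. 1)"
    unfolding S_def fps_sum_nth by (intro sum.cong) (auto simp: fps_power_zeroth F0)
  then have "S $ 0 \<noteq> 0" by (simp del: of_nat_Suc)
  then have "is_unit S" by (simp add: fps_is_unit_iff)
  moreover have "fps_X ^ a dvd (f - g) * S"
    using dvd unfolding eq by (simp add: power_add mult.commute[of "fps_X ^ a"])
  ultimately show ?thesis by (simp add: dvd_mult_unit_iff)
qed

lemma dvd_diff_trans:
  fixes a b c d :: "'a :: comm_ring_1"
  assumes "d dvd a - b" and "d dvd b - c"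
  shows "d dvd a - c"
  using dvd_add[OF assms] by simp

section \<open>Substitution into series in two variables\<close>

lemma param_monomial_nth:
  fixes f g :: "complex fps"
  assumes "f $ 0 = 0" and "g $ 0 = 0" and "n < i + j"
  shows "(f ^ i * g ^ j) $ n = 0"
proof -
  have "fps_X ^ i * fps_X ^ j dvd f ^ i * g ^ j"
    using assms by (intro mult_dvd_mono dvd_power_same) (auto simp: fps_X_dvd_iff)
  then show ?thesis using assms(3) by (simp add: fps_X_power_dvd_iff flip: power_add)
qed

definition centred :: "param \<Rightarrow> bool" where
  "centred p \<longleftrightarrow> fst p $ 0 = 0 \<and> snd p $ 0 = 0"

definition partial_subst :: "nat \<Rightarrow> series2 \<Rightarrow> param \<Rightarrow> complex fps" where
  "partial_subst M \<eta> p = (\<Sum>i\<le>M. \<Sum>j\<le>M. fps_const (\<eta> $ i $ j) * (fst p ^ i * snd p ^ j))"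

text \<open>Monomials of degree above \<open>n\<close> do not reach order \<open>n\<close>. The two
  bounds are independent because \<open>subst2_contract\<close> stretches the exponents of the first
  variable only.\<close>

lemma subst2_nth_eq:
  assumes "centred p" and "n \<le> M" and "n \<le> M'"
  shows "subst2 \<eta> p $ n = (\<Sum>i\<le>M. \<Sum>j\<le>M'. \<eta> $ i $ j * (fst p ^ i * snd p ^ j) $ n)"
proof -
  note z = param_monomial_nth[of "fst p" "snd p"]
  have "(\<Sum>i\<le>M. \<Sum>j\<le>M'. \<eta> $ i $ j * (fst p ^ i * snd p ^ j) $ n) =
      (\<Sum>(i, j)\<in>{..M} \<times> {..M'}. \<eta> $ i $ j * (fst p ^ i * snd p ^ j) $ n)"
    by (simp add: sum.cartesian_product)
  also have "\<dots> = (\<Sum>(i, j)\<in>{..n} \<times> {..n}. \<eta> $ i $ j * (fst p ^ i * snd p ^ j) $ n)"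
    using assms by (intro sum.mono_neutral_right) (auto simp: centred_def intro!: z)
  also have "\<dots> = subst2 \<eta> p $ n"
    by (simp add: subst2_def sum.cartesian_product)
  finally show ?thesis ..
qed

lemma subst2_nth_partial:
  assumes "centred p" and "n \<le> M"
  shows "subst2 \<eta> p $ n = partial_subst M \<eta> p $ n"
  by (simp add: subst2_nth_eq[OF assms(1,2,2)] partial_subst_def fps_sum_nth)

lemma subst2_cong_partial:
  assumes "centred p"
  shows "fps_X ^ Suc M dvd subst2 \<eta> p - partial_subst M \<eta> p"
  unfolding fps_X_power_dvd_iff using subst2_nth_partial[OF assms] by (auto simp: less_Suc_eq_le)

lemma subst2_eqI:
  assumes "centred p" and "\<And>M. fps_X ^ Suc M dvd partial_subst M \<eta> p - f"
  shows "subst2 \<eta> p = f"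
proof (rule fps_ext)
  fix n
  have "fps_X ^ Suc n dvd subst2 \<eta> p - f"
    using dvd_diff_trans[OF subst2_cong_partial assms(2)] assms(1) .
  then show "subst2 \<eta> p $ n = f $ n" by (simp add: fps_X_power_dvd_iff del: power_Suc)
qed

lemma subst2_nth_0 [simp]: "subst2 \<eta> p $ 0 = \<eta> $ 0 $ 0"
  by (simp add: subst2_def)

lemma subst2_add: "subst2 (\<eta> + \<zeta>) p = subst2 \<eta> p + subst2 \<zeta> p"
  by (rule fps_ext) (simp add: subst2_def algebra_simps sum.distrib)

lemma subst2_diff: "subst2 (\<eta> - \<zeta>) p = subst2 \<eta> p - subst2 \<zeta> p"
  by (rule fps_ext) (simp add: subst2_def algebra_simps sum_subtractf)

lemma subst2_0 [simp]: "subst2 0 p = 0"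
  by (rule fps_ext) (simp add: subst2_def)

lemma subst2_uminus: "subst2 (- \<eta>) p = - subst2 \<eta> p"
  using subst2_diff[of 0 \<eta> p] by simp

lemma subst2_sum: "subst2 (sum f A) p = (\<Sum>a\<in>A. subst2 (f a) p)"
  by (induction A rule: infinite_finite_induct) (auto simp: subst2_add)

lemma scalar2_mult_nth [simp]: "(scalar2 c * \<eta>) $ i $ j = c * \<eta> $ i $ j"
  by (simp add: scalar2_def)

lemma subst2_scalar_mult: "subst2 (scalar2 c * \<eta>) p = fps_const c * subst2 \<eta> p"
  by (rule fps_ext) (simp add: subst2_def sum_distrib_left mult.assoc)

lemma subst2_mult:
  assumes "centred p"
  shows "subst2 (\<eta> * \<zeta>) p = subst2 \<eta> p * subst2 \<zeta> p"
proof (rule fps_ext)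
  fix n
  define m where "m i j = (fst p ^ i * snd p ^ j) $ n" for i j
  have z: "m i j = 0" if "i > n \<or> j > n" for i j
    unfolding m_def using assms that by (intro param_monomial_nth) (auto simp: centred_def)
  have tri: "(\<Sum>a\<le>n. \<Sum>i\<le>a. h i (a - i)) = (\<Sum>i\<le>n. \<Sum>k\<le>n. if i + k \<le> n then h i k else 0)"
    for h :: "nat \<Rightarrow> nat \<Rightarrow> complex"
  proof -
    have "(\<Sum>a\<le>n. \<Sum>i\<le>a. h i (a - i)) = (\<Sum>(i, k)\<in>{(i, k). i + k \<le> n}. h i k)"
      by (rule sum.triangle_reindex_eq[symmetric])
    also have "\<dots> = (\<Sum>(i, k)\<in>{..n} \<times> {..n}. if i + k \<le> n then h i k else 0)"
      by (intro sum.mono_neutral_cong_left) (auto split: if_splits)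
    finally show ?thesis by (simp add: sum.cartesian_product)
  qed
  have "subst2 (\<eta> * \<zeta>) p $ n = (\<Sum>a\<le>n. \<Sum>b\<le>n. (\<eta> * \<zeta>) $ a $ b * m a b)"
    by (simp add: subst2_def m_def)
  also have "\<dots> = (\<Sum>a\<le>n. \<Sum>i\<le>a. \<Sum>b\<le>n. \<Sum>j\<le>b. \<eta> $ i $ j * \<zeta> $ (a - i) $ (b - j) * m (i + (a - i)) (j + (b - j)))"
  proof (rule sum.cong[OF refl])
    fix a
    have "(\<Sum>b\<le>n. (\<eta> * \<zeta>) $ a $ b * m a b) =
       (\<Sum>b\<le>n. \<Sum>i\<le>a. \<Sum>j\<le>b. \<eta> $ i $ j * \<zeta> $ (a - i) $ (b - j) * m a b)"
      by (simp add: fps_mult_nth fps_sum_nth atLeast0AtMost sum_distrib_right)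
    also have "\<dots> = (\<Sum>i\<le>a. \<Sum>b\<le>n. \<Sum>j\<le>b. \<eta> $ i $ j * \<zeta> $ (a - i) $ (b - j) * m a b)"
      by (rule sum.swap)
    finally show "(\<Sum>b\<le>n. (\<eta> * \<zeta>) $ a $ b * m a b) = (\<Sum>i\<le>a. \<Sum>b\<le>n. \<Sum>j\<le>b. 
       \<eta> $ i $ j * \<zeta> $ (a - i) $ (b - j) * m (i + (a - i)) (j + (b - j)))"
      by simp
  qed
  also have "\<dots> = (\<Sum>i\<le>n. \<Sum>k\<le>n. if i + k \<le> n then
      (\<Sum>b\<le>n. \<Sum>j\<le>b. \<eta> $ i $ j * \<zeta> $ k $ (b - j) * m (i + k) (j + (b - j))) else 0)"
    by (rule tri)
  also have "\<dots> = (\<Sum>i\<le>n. \<Sum>k\<le>n. \<Sum>j\<le>n. \<Sum>l\<le>n. \<eta> $ i $ j * \<zeta> $ k $ l * m (i + k) (j + l))"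
  proof (intro sum.cong refl)
    fix i k
    have "(\<Sum>b\<le>n. \<Sum>j\<le>b. \<eta> $ i $ j * \<zeta> $ k $ (b - j) * m (i + k) (j + (b - j))) =
       (\<Sum>j\<le>n. \<Sum>l\<le>n. if j + l \<le> n then \<eta> $ i $ j * \<zeta> $ k $ l * m (i + k) (j + l) else 0)"
      by (rule tri)
    also have "\<dots> = (\<Sum>j\<le>n. \<Sum>l\<le>n. \<eta> $ i $ j * \<zeta> $ k $ l * m (i + k) (j + l))"
      by (intro sum.cong refl) (auto simp: z)
    finally show "(if i + k \<le> n then
      (\<Sum>b\<le>n. \<Sum>j\<le>b. \<eta> $ i $ j * \<zeta> $ k $ (b - j) * m (i + k) (j + (b - j))) else 0) =
      (\<Sum>j\<le>n. \<Sum>l\<le>n. \<eta> $ i $ j * \<zeta> $ k $ l * m (i + k) (j + l))"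
      by (auto simp: z)
  qed
  also have "\<dots> = (partial_subst n \<eta> p * partial_subst n \<zeta> p) $ n"
  proof -
    have mm: "(fst p ^ i * snd p ^ j) * (fst p ^ k * snd p ^ l) = fst p ^ (i + k) * snd p ^ (j + l)"
      for i j k l by (simp add: power_add mult_ac)
    have "partial_subst n \<eta> p * partial_subst n \<zeta> p =
      (\<Sum>i\<le>n. \<Sum>k\<le>n. \<Sum>j\<le>n. \<Sum>l\<le>n. fps_const (\<eta> $ i $ j * \<zeta> $ k $ l) * 
         (fst p ^ (i + k) * snd p ^ (j + l)))"
      unfolding partial_subst_def sum_product
      by (intro sum.cong refl) (simp add: mult_ac flip: mm fps_const_mult)
    then show ?thesis by (simp add: fps_sum_nth m_def)
  qed
  also have "\<dots> = (subst2 \<eta> p * subst2 \<zeta> p) $ n"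
    unfolding fps_mult_nth using assms
    by (intro sum.cong refl) (simp add: subst2_nth_partial[where M = n])
  finally show "subst2 (\<eta> * \<zeta>) p $ n = (subst2 \<eta> p * subst2 \<zeta> p) $ n" .
qed

lemma var_x_nth: "var_x $ i $ j = (if i = 1 \<and> j = 0 then 1 else 0)"
  by (simp add: var_x_def fps_X_def)

lemma var_y_nth: "var_y $ i $ j = (if i = 0 \<and> j = 1 then 1 else 0)"
  by (simp add: var_y_def fps_X_def)

lemma one_nth2: "(1 :: series2) $ i $ j = (if i = 0 \<and> j = 0 then 1 else 0)"
  by (simp add: fps_one_def)

lemma subst2_var_x [simp]:
  assumes "centred p"
  shows "subst2 var_x p = fst p"
proof (rule fps_ext)
  fix n
  have "subst2 var_x p $ n = (\<Sum>i\<le>Suc n. \<Sum>j\<le>Suc n. var_x $ i $ j * (fst p ^ i * snd p ^ j) $ n)"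
    by (rule subst2_nth_eq[OF assms]) auto
  also have "\<dots> = (\<Sum>i\<in>{1}. \<Sum>j\<in>{0}. (fst p ^ i * snd p ^ j) $ n)"
    unfolding sum.cartesian_product
    by (intro sum.mono_neutral_cong_right) (auto simp: var_x_nth split: if_splits)
  finally show "subst2 var_x p $ n = fst p $ n" by simp
qed

lemma subst2_var_y [simp]:
  assumes "centred p"
  shows "subst2 var_y p = snd p"
proof (rule fps_ext)
  fix n
  have "subst2 var_y p $ n = (\<Sum>i\<le>Suc n. \<Sum>j\<le>Suc n. var_y $ i $ j * (fst p ^ i * snd p ^ j) $ n)"
    by (rule subst2_nth_eq[OF assms]) auto
  also have "\<dots> = (\<Sum>i\<in>{0}. \<Sum>j\<in>{1}. (fst p ^ i * snd p ^ j) $ n)"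
    unfolding sum.cartesian_product
    by (intro sum.mono_neutral_cong_right) (auto simp: var_y_nth split: if_splits)
  finally show "subst2 var_y p $ n = snd p $ n" by simp
qed

lemma subst2_1 [simp]: "subst2 1 p = 1"
proof (rule fps_ext)
  fix n
  have "subst2 1 p $ n = (\<Sum>i\<in>{0}. \<Sum>j\<in>{0}. (fst p ^ i * snd p ^ j) $ n)"
    unfolding subst2_def sum.cartesian_product fps_nth_Abs_fps
    by (intro sum.mono_neutral_cong_right) (auto simp: one_nth2 split: if_splits)
  then show "subst2 1 p $ n = 1 $ n" by simp
qed

lemma subst2_power: "centred p \<Longrightarrow> subst2 (\<eta> ^ n) p = subst2 \<eta> p ^ n"
  by (induction n) (auto simp: subst2_mult)

lemma subst2_prod: "centred p \<Longrightarrow> subst2 (prod f A) p = (\<Prod>a\<in>A. subst2 (f a) p)"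
  by (induction A rule: infinite_finite_induct) (auto simp: subst2_mult)

lemma subst2_compose:
  assumes "centred p" and "c $ 0 = 0"
  shows "subst2 \<eta> (fst p oo c, snd p oo c) = subst2 \<eta> p oo c"
proof (rule subst2_eqI)
  show "centred (fst p oo c, snd p oo c)" using assms by (simp add: centred_def)
  fix M
  have "partial_subst M \<eta> (fst p oo c, snd p oo c) = partial_subst M \<eta> p oo c"
    unfolding partial_subst_def using assms(2)
    by (simp add: fps_compose_sum_distrib fps_compose_mult_distrib fps_compose_power)
  moreover have "fps_X ^ Suc M dvd (subst2 \<eta> p oo c) - (partial_subst M \<eta> p oo c)"
    by (intro compose_cong_left subst2_cong_partial assms)
  ultimately show "fps_X ^ Suc M dvd partial_subst M \<eta> (fst p oo c, snd p oo c) - (subst2 \<eta> p oo c)"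
    by (metis dvd_minus_iff minus_diff_eq)
qed

section \<open>Partial derivatives and the chain rule along a branch\<close>

definition deriv_x :: "series2 \<Rightarrow> series2" where
  "deriv_x \<eta> = fps_deriv \<eta>"

definition deriv_y :: "series2 \<Rightarrow> series2" where
  "deriv_y \<eta> = Abs_fps (\<lambda>i. fps_deriv (\<eta> $ i))"

lemma deriv_x_nth: "deriv_x \<eta> $ i $ j = of_nat (Suc i) * \<eta> $ Suc i $ j"
  by (simp add: deriv_x_def fps_of_nat[symmetric] del: fps_of_nat of_nat_Suc)

lemma deriv_y_nth: "deriv_y \<eta> $ i $ j = of_nat (Suc j) * \<eta> $ i $ Suc j"
  by (simp add: deriv_y_def)

lemma fps_deriv_subst2:
  assumes "centred p"
  shows "fps_deriv (subst2 \<eta> p) =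
    subst2 (deriv_x \<eta>) p * fps_deriv (fst p) + subst2 (deriv_y \<eta>) p * fps_deriv (snd p)"
proof (rule fps_ext)
  fix n
  define f g where "f = fst p" and "g = snd p"
  \<comment> \<open>Order \<open>n\<close> of a derivative reads order \<open>Suc n\<close> of the
    series; the index shift in each partial derivative brings one range back to \<open>n\<close>,
    and \<open>nz\<close> removes the excess in the other.\<close>
  define M where "M = Suc n"
  have f0: "f $ 0 = 0" "g $ 0 = 0" using assms by (auto simp: f_def g_def centred_def)
  have nz: "(f ^ i * g ^ j * h) $ n = 0" if "n < i + j" for i j h
  proof -
    have "fps_X ^ (i + j) dvd f ^ i * g ^ j"
      using param_monomial_nth[of f g] f0 by (simp add: fps_X_power_dvd_iff)
    then have "fps_X ^ (i + j) dvd f ^ i * g ^ j * h" by simp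
    then show ?thesis using that by (simp add: fps_X_power_dvd_iff)
  qed
  have S: "(subst2 \<zeta> p * h) $ n = (\<Sum>i\<le>n. \<Sum>j\<le>n. \<zeta> $ i $ j * (f ^ i * g ^ j * h) $ n)" for \<zeta> h
  proof -
    have "(subst2 \<zeta> p * h) $ n = (partial_subst n \<zeta> p * h) $ n"
      unfolding fps_mult_nth using assms
      by (intro sum.cong refl) (simp add: subst2_nth_partial[where M = n])
    then show ?thesis 
      by (simp add: partial_subst_def sum_distrib_right fps_sum_nth f_def g_def mult.assoc)
  qed
  have "fps_deriv (subst2 \<eta> p) $ n = fps_deriv (partial_subst M \<eta> p) $ n"
    using subst2_nth_partial[OF assms, of "Suc n" M] by (simp add: M_def)
  also have "\<dots> = (\<Sum>i\<le>M. \<Sum>j\<le>M. \<eta> $ i $ j *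
       (of_nat i * (f ^ (i - 1) * g ^ j * fps_deriv f) $ n + of_nat j * (f ^ i * g ^ (j - 1) * fps_deriv g) $ n))"
  proof -
    have "fps_deriv (f ^ i * g ^ j) $ n = of_nat i * (f ^ (i - 1) * g ^ j * fps_deriv f) $ n
        + of_nat j * (f ^ i * g ^ (j - 1) * fps_deriv g) $ n" for i j
    proof -
      have "fps_deriv (f ^ i * g ^ j) = fps_const (of_nat i) * (f ^ (i - 1) * g ^ j * fps_deriv f)
        + fps_const (of_nat j) * (f ^ i * g ^ (j - 1) * fps_deriv g)"
        by (simp add: fps_deriv_power' mult_ac fps_of_nat)
      then show ?thesis by (simp only: fps_add_nth fps_mult_left_const_nth)
    qed
    then show ?thesis
      by (simp add: partial_subst_def fps_deriv_sum fps_sum_nth f_def g_def del: fps_deriv_nth)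
  qed
  also have "\<dots> = (\<Sum>i\<le>M. \<Sum>j\<le>M. of_nat i * \<eta> $ i $ j * (f ^ (i - 1) * g ^ j * fps_deriv f) $ n) +
      (\<Sum>i\<le>M. \<Sum>j\<le>M. of_nat j * \<eta> $ i $ j * (f ^ i * g ^ (j - 1) * fps_deriv g) $ n)"
    by (simp add: algebra_simps sum.distrib)
  also have "(\<Sum>i\<le>M. \<Sum>j\<le>M. of_nat i * \<eta> $ i $ j * (f ^ (i - 1) * g ^ j * fps_deriv f) $ n) =
      (\<Sum>i\<le>n. \<Sum>j\<le>M. deriv_x \<eta> $ i $ j * (f ^ i * g ^ j * fps_deriv f) $ n)"
    unfolding M_def by (subst sum.atMost_Suc_shift) (simp add: deriv_x_nth)
  also have "\<dots> = (subst2 (deriv_x \<eta>) p * fps_deriv f) $ n"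
    unfolding S M_def by (simp add: nz del: power_Suc)
  also have "(\<Sum>i\<le>M. \<Sum>j\<le>M. of_nat j * \<eta> $ i $ j * (f ^ i * g ^ (j - 1) * fps_deriv g) $ n) =
      (\<Sum>i\<le>M. \<Sum>j\<le>n. deriv_y \<eta> $ i $ j * (f ^ i * g ^ j * fps_deriv g) $ n)"
    unfolding M_def by (subst sum.atMost_Suc_shift) (simp add: deriv_y_nth)
  also have "\<dots> = (subst2 (deriv_y \<eta>) p * fps_deriv g) $ n"
    unfolding S M_def by (simp add: nz del: power_Suc)
  finally show "fps_deriv (subst2 \<eta> p) $ n = (subst2 (deriv_x \<eta>) p * fps_deriv (fst p) +
      subst2 (deriv_y \<eta>) p * fps_deriv (snd p)) $ n"
    by (simp add: f_def g_def)
qed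

section \<open>Exponentials of vector fields\<close>

definition der :: "complex fps \<Rightarrow> complex fps \<Rightarrow> complex fps" where
  "der w f = w * fps_deriv f"

definition divided_der :: "nat \<Rightarrow> complex fps \<Rightarrow> complex fps \<Rightarrow> complex fps" where
  "divided_der n w f = fps_const (1 / fact n) * (der w ^^ n) f"

definition exp_der :: "nat \<Rightarrow> complex fps \<Rightarrow> complex fps \<Rightarrow> complex fps" where
  "exp_der K w f = (\<Sum>n\<le>K. divided_der n w f)"

lemma der_add: "der w (f + g) = der w f + der w g"
  by (simp add: der_def algebra_simps)

lemma der_diff: "der w (f - g) = der w f - der w g"
  by (simp add: der_def algebra_simps)

lemma der_cmult: "der w (fps_const c * f) = fps_const c * der w f"
  by (simp add: der_def algebra_simps)

lemma der_mult: "der w (f * g) = der w f * g + f * der w g"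
  by (simp add: der_def algebra_simps)

lemma der_sum: "der w (sum f A) = (\<Sum>a\<in>A. der w (f a))"
  by (simp add: der_def fps_deriv_sum sum_distrib_left)

text \<open>A field of order at least 2 raises orders by at least one; this makes the truncated
  exponential behave like an automorphism modulo \<open>fps_X ^ Suc K\<close>.\<close>

lemma der_dvd:
  assumes "fps_X ^ 2 dvd w" and "fps_X ^ N dvd f"
  shows "fps_X ^ Suc N dvd der w f"
proof -
  have "fps_X ^ (N - 1) dvd fps_deriv f"
    using assms(2) by (simp add: fps_X_power_dvd_iff)
  then have "fps_X ^ 2 * fps_X ^ (N - 1) dvd der w f"
    unfolding der_def by (intro mult_dvd_mono assms)
  then have "fps_X ^ (2 + (N - 1)) dvd der w f" by (simp only: power_add)
  then show ?thesis by (rule power_le_dvd) simp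
qed

lemma divided_der_0 [simp]: "divided_der 0 w f = f"
  by (simp add: divided_der_def)

lemma divided_der_Suc: "of_nat (Suc n) * divided_der (Suc n) w f = der w (divided_der n w f)"
  by (simp add: divided_der_def der_cmult fps_of_nat[symmetric] mult.assoc[symmetric] field_simps
      del: of_nat_Suc)

lemma divided_der_dvd:
  assumes "fps_X ^ 2 dvd w" and "fps_X ^ N dvd f"
  shows "fps_X ^ (N + n) dvd divided_der n w f"
proof -
  have "fps_X ^ (N + n) dvd (der w ^^ n) f"
    using assms by (induction n) (auto simp del: power_Suc intro: der_dvd)
  then show ?thesis by (simp add: divided_der_def)
qed

text \<open>Leibniz rule: division by factorials turns its binomial form into a Cauchy product. The
  induction works with the multiple by \<open>Suc n\<close>, split as
  \<open>i + (Suc n - i)\<close>, and cancels it at the end.\<close>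

lemma divided_der_mult:
  "divided_der n w (f * g) = (\<Sum>i\<le>n. divided_der i w f * divided_der (n - i) w g)"
proof (induction n)
  case 0
  then show ?case by simp
next
  case (Suc n)
  define a b where "a i = divided_der i w f" and "b i = divided_der i w g" for i
  have "of_nat (Suc n) * divided_der (Suc n) w (f * g) = der w (\<Sum>i\<le>n. a i * b (n - i))"
    by (simp only: divided_der_Suc Suc a_def b_def)
  also have "\<dots> = (\<Sum>i\<le>n. of_nat (Suc i) * (a (Suc i) * b (Suc n - Suc i))) +
      (\<Sum>i\<le>n. of_nat (Suc n - i) * (a i * b (Suc n - i)))"
    unfolding der_sum der_mult sum.distrib[symmetric]
  proof (intro sum.cong refl)
    fix i assume "i \<in> {..n}"
    then have "Suc n - i = Suc (n - i)" by auto
    then show "der w (a i) * b (n - i) + a i * der w (b (n - i)) =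
      of_nat (Suc i) * (a (Suc i) * b (Suc n - Suc i)) + of_nat (Suc n - i) * (a i * b (Suc n - i))"
      unfolding a_def b_def by (simp only: diff_Suc_Suc divided_der_Suc[symmetric] mult_ac)
  qed
  also have "(\<Sum>i\<le>n. of_nat (Suc i) * (a (Suc i) * b (Suc n - Suc i))) =
      (\<Sum>i\<le>Suc n. of_nat i * (a i * b (Suc n - i)))"
    by (simp add: sum.atMost_Suc_shift del: of_nat_Suc sum.atMost_Suc)
  also have "(\<Sum>i\<le>n. of_nat (Suc n - i) * (a i * b (Suc n - i))) =
      (\<Sum>i\<le>Suc n. of_nat (Suc n - i) * (a i * b (Suc n - i)))"
    by simp
  also have "(\<Sum>i\<le>Suc n. of_nat i * (a i * b (Suc n - i))) +
      (\<Sum>i\<le>Suc n. of_nat (Suc n - i) * (a i * b (Suc n - i))) =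
      (\<Sum>i\<le>Suc n. of_nat (Suc n) * (a i * b (Suc n - i)))"
    unfolding sum.distrib[symmetric]
    by (intro sum.cong refl) (metis atMost_iff distrib_right le_add_diff_inverse of_nat_add)
  also have "\<dots> = of_nat (Suc n) * (\<Sum>i\<le>Suc n. a i * b (Suc n - i))"
    by (simp only: sum_distrib_left)
  finally have "divided_der (Suc n) w (f * g) = (\<Sum>i\<le>Suc n. a i * b (Suc n - i))"
    unfolding mult_cancel_left by (simp only: of_nat_neq_0 simp_thms)
  then show ?case unfolding a_def b_def .
qed

lemma exp_der_add: "exp_der K w (f + g) = exp_der K w f + exp_der K w g"
proof -
  have "(der w ^^ n) (f + g) = (der w ^^ n) f + (der w ^^ n) g" for n
    by (induction n) (auto simp: der_add)
  then show ?thesis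
    by (simp add: exp_der_def divided_der_def algebra_simps sum.distrib)
qed

lemma exp_der_cmult: "exp_der K w (fps_const c * f) = fps_const c * exp_der K w f"
proof -
  have "(der w ^^ n) (fps_const c * f) = fps_const c * (der w ^^ n) f" for n
    by (induction n) (auto simp: der_cmult)
  then show ?thesis
    by (simp add: exp_der_def divided_der_def sum_distrib_left mult_ac)
qed

lemma exp_der_0 [simp]: "exp_der K w 0 = 0"
  using exp_der_cmult[of K w 0 0] by simp

lemma exp_der_sum: "exp_der K w (sum f A) = (\<Sum>a\<in>A. exp_der K w (f a))"
  by (induction A rule: infinite_finite_induct) (auto simp: exp_der_add)

lemma exp_der_diff: "exp_der K w (f - g) = exp_der K w f - exp_der K w g"
  using exp_der_add[of K w "f - g" g] by simp

lemma exp_der_1 [simp]: "exp_der K w 1 = 1"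
proof -
  have "(der w ^^ n) 1 = 0" if "n > 0" for n
  proof -
    have "(der w ^^ m) (der w 1) = 0" for m by (induction m) (auto simp: der_def)
    with that show ?thesis by (cases n) (auto simp: funpow_Suc_right simp del: funpow.simps)
  qed
  then have "exp_der K w 1 = (\<Sum>n\<in>{0}. divided_der n w 1)"
    unfolding exp_der_def by (intro sum.mono_neutral_right) (auto simp: divided_der_def)
  then show ?thesis by simp
qed

lemma exp_der_dvd:
  assumes "fps_X ^ 2 dvd w" and "fps_X ^ N dvd f"
  shows "fps_X ^ N dvd exp_der K w f"
  unfolding exp_der_def
  by (intro dvd_sum power_le_dvd[OF divided_der_dvd[OF assms]]) simp

lemma exp_der_cong_id:
  assumes "fps_X ^ 2 dvd w" and "fps_X ^ N dvd f"
  shows "fps_X ^ Suc N dvd exp_der K w f - f"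
proof -
  have "exp_der K w f - f = (\<Sum>n\<in>{..K} - {0}. divided_der n w f)"
    unfolding exp_der_def by (subst sum.remove[of _ 0]) auto
  also have "fps_X ^ Suc N dvd \<dots>"
    by (intro dvd_sum power_le_dvd[OF divided_der_dvd[OF assms]]) auto
  finally show ?thesis .
qed

text \<open>The products outside the triangle \<open>i + j \<le> K\<close> carry at least
  \<open>Suc K\<close> derivations in total and hence vanish to order \<open>Suc K\<close>.\<close>

lemma exp_der_mult:
  assumes w: "fps_X ^ 2 dvd w"
  shows "fps_X ^ Suc K dvd exp_der K w (f * g) - exp_der K w f * exp_der K w g"
proof -
  define h where "h i j = divided_der i w f * divided_der j w g" for i j
  have "exp_der K w (f * g) = (\<Sum>n\<le>K. \<Sum>i\<le>n. h i (n - i))"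
    by (simp add: exp_der_def divided_der_mult h_def)
  also have "\<dots> = (\<Sum>(i, j)\<in>{(i, j). i + j \<le> K}. h i j)"
    by (rule sum.triangle_reindex_eq[symmetric])
  also have "\<dots> = (\<Sum>(i, j)\<in>{..K} \<times> {..K}. if i + j \<le> K then h i j else 0)"
    by (intro sum.mono_neutral_cong_left) (auto split: if_splits)
  finally have eq1: "exp_der K w (f * g) = (\<Sum>(i, j)\<in>{..K} \<times> {..K}. if i + j \<le> K then h i j else 0)" .
  have eq2: "exp_der K w f * exp_der K w g = (\<Sum>(i, j)\<in>{..K} \<times> {..K}. h i j)"
    by (simp add: exp_der_def sum_product sum.cartesian_product h_def)
  have "fps_X ^ Suc K dvd (if i + j \<le> K then h i j else 0) - h i j" for i j
  proof (cases "i + j \<le> K")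
    case False
    have "fps_X ^ (0 + i) * fps_X ^ (0 + j) dvd h i j"
      unfolding h_def by (intro mult_dvd_mono divided_der_dvd w) auto
    then have "fps_X ^ (i + j) dvd h i j" by (simp add: power_add)
    then have "fps_X ^ Suc K dvd h i j" by (rule power_le_dvd) (use False in auto)
    with False show ?thesis by (simp del: power_Suc)
  qed simp
  then show ?thesis
    unfolding eq1 eq2 sum_subtractf[symmetric] by (intro dvd_sum) (auto simp del: power_Suc)
qed

lemma exp_der_power:
  assumes w: "fps_X ^ 2 dvd w"
  shows "fps_X ^ Suc K dvd exp_der K w (f ^ n) - exp_der K w f ^ n"
proof (induction n)
  case (Suc n)
  have "fps_X ^ Suc K dvd exp_der K w f * exp_der K w (f ^ n) - exp_der K w f * exp_der K w f ^ n"
    using Suc unfolding right_diff_distrib[symmetric] by (rule dvd_mult)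
  then show ?case
    using dvd_diff_trans[OF exp_der_mult[OF w, of K f "f ^ n"]] by simp
qed simp

text \<open>The outer series is replaced by its polynomial cutoff \<open>z\<close>, to which
  approximate multiplicativity applies term by term. Thus the flow acts on
  \<open>y oo \<rho>\<close> by moving \<open>\<rho>\<close> alone.\<close>

lemma exp_der_compose:
  assumes w: "fps_X ^ 2 dvd w" and "\<rho> $ 0 = 0"
  shows "fps_X ^ Suc K dvd exp_der K w (y oo \<rho>) - (y oo exp_der K w \<rho>)"
proof -
  define z where "z = (\<Sum>i\<le>K. fps_const (y $ i) * fps_X ^ i)"
  have z: "fps_X ^ Suc K dvd y - z"
    unfolding fps_X_power_dvd_iff by (auto simp: z_def fps_sum_nth mult_delta_right)
  have zc: "z oo \<rho>' = (\<Sum>i\<le>K. fps_const (y $ i) * \<rho>' ^ i)" if "\<rho>' $ 0 = 0" for \<rho>' :: "complex fps"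
    using that
    by (simp add: z_def fps_compose_sum_distrib fps_compose_mult_distrib fps_X_power_compose)
  have "fps_X ^ 1 dvd exp_der K w \<rho>"
    using assms by (intro exp_der_dvd) (auto simp: fps_X_dvd_iff)
  then have E0: "exp_der K w \<rho> $ 0 = 0" by (simp add: fps_X_dvd_iff)
  have "fps_X ^ Suc K dvd exp_der K w ((y oo \<rho>) - (z oo \<rho>))"
    by (intro exp_der_dvd w compose_cong_left z assms)
  then have 1: "fps_X ^ Suc K dvd exp_der K w (y oo \<rho>) - exp_der K w (z oo \<rho>)"
    by (simp only: exp_der_diff)
  have 2: "fps_X ^ Suc K dvd exp_der K w (z oo \<rho>) - (z oo exp_der K w \<rho>)"
    unfolding zc[OF E0] zc[OF assms(2)] exp_der_sum exp_der_cmult sum_subtractf[symmetric]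
      right_diff_distrib[symmetric]
    by (intro dvd_sum dvd_mult exp_der_power w)
  have 3: "fps_X ^ Suc K dvd (z oo exp_der K w \<rho>) - (y oo exp_der K w \<rho>)"
    using compose_cong_left[OF z E0] by (simp only: dvd_diff_commute)
  show ?thesis by (rule dvd_diff_trans[OF dvd_diff_trans[OF 1 2] 3])
qed

text \<open>The form \<open>P dx + Q dy\<close> is the contraction of the area form with the field
  \<open>- Q \<partial>\<^sub>x + P \<partial>\<^sub>y\<close>, up to sign.\<close>

definition vfield :: "form1 \<Rightarrow> series2 \<Rightarrow> series2" where
  "vfield \<omega> \<eta> = fst \<omega> * deriv_y \<eta> - snd \<omega> * deriv_x \<eta>"

definition exp_vfield :: "nat \<Rightarrow> form1 \<Rightarrow> series2 \<Rightarrow> series2" where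
  "exp_vfield K \<omega> \<eta> = (\<Sum>n\<le>K. scalar2 (1 / fact n) * (vfield \<omega> ^^ n) \<eta>)"

section \<open>One-jets of truncated exponentials of fields\<close>

lemma mult_nth_00: "(\<eta> * \<zeta> :: series2) $ 0 $ 0 = \<eta> $ 0 $ 0 * \<zeta> $ 0 $ 0"
  by (simp add: fps_mult_nth)

lemma mult_nth_10: "(\<eta> * \<zeta> :: series2) $ 1 $ 0 = \<eta> $ 0 $ 0 * \<zeta> $ 1 $ 0 + \<eta> $ 1 $ 0 * \<zeta> $ 0 $ 0"
  by (simp add: fps_mult_nth)

lemma mult_nth_01: "(\<eta> * \<zeta> :: series2) $ 0 $ 1 = \<eta> $ 0 $ 0 * \<zeta> $ 0 $ 1 + \<eta> $ 0 $ 1 * \<zeta> $ 0 $ 0"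
  by (simp add: fps_mult_nth)

text \<open>The common linear shape of the elements of \<open>Omega \<delta>\<close>: \<open>\<kappa>\<close> is the coefficient of \<open>y dy\<close>.\<close>

definition unipotent_form :: "complex \<Rightarrow> form1 \<Rightarrow> bool" where
  "unipotent_form \<kappa> \<omega> \<longleftrightarrow> fst \<omega> $ 0 $ 0 = 0 \<and> fst \<omega> $ 1 $ 0 = 0 \<and> fst \<omega> $ 0 $ 1 = 0 \<and>
     snd \<omega> $ 0 $ 0 = 0 \<and> snd \<omega> $ 1 $ 0 = 0 \<and> snd \<omega> $ 0 $ 1 = \<kappa>"

lemma vfield_jet:
  assumes "unipotent_form \<kappa> \<omega>"
  shows "vfield \<omega> \<eta> $ 0 $ 0 = 0" and "vfield \<omega> \<eta> $ 1 $ 0 = 0"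
    and "vfield \<omega> \<eta> $ 0 $ 1 = - \<kappa> * \<eta> $ 1 $ 0"
  using assms unfolding unipotent_form_def vfield_def fps_sub_nth mult_nth_00 mult_nth_01 mult_nth_10
  by (simp_all add: deriv_x_nth deriv_y_nth)

text \<open>The linear part of the field sends \<open>x\<close> to \<open>- \<kappa> y\<close> and
  \<open>y\<close> to 0. Its square is zero, so from the second iterate on all 1-jets
  vanish.\<close>

lemma vfield_funpow_jet:
  assumes "unipotent_form \<kappa> \<omega>"
  shows "(vfield \<omega> ^^ Suc n) \<eta> $ 0 $ 0 = 0" and "(vfield \<omega> ^^ Suc n) \<eta> $ 1 $ 0 = 0"
    and "(vfield \<omega> ^^ Suc n) \<eta> $ 0 $ 1 = (if n = 0 then - \<kappa> * \<eta> $ 1 $ 0 else 0)"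
proof -
  show *: "(vfield \<omega> ^^ Suc n) \<eta> $ 1 $ 0 = 0" for n by (simp add: vfield_jet[OF assms, simplified])
  show "(vfield \<omega> ^^ Suc n) \<eta> $ 0 $ 0 = 0" by (simp add: vfield_jet[OF assms, simplified])
  show "(vfield \<omega> ^^ Suc n) \<eta> $ 0 $ 1 = (if n = 0 then - \<kappa> * \<eta> $ 1 $ 0 else 0)"
    using * by (cases n) (simp_all add: vfield_jet[OF assms, simplified])
qed

lemma exp_vfield_jet:
  assumes "unipotent_form \<kappa> \<omega>" and "K \<ge> 1"
  shows "exp_vfield K \<omega> \<eta> $ 0 $ 0 = \<eta> $ 0 $ 0" and "exp_vfield K \<omega> \<eta> $ 1 $ 0 = \<eta> $ 1 $ 0"
    and "exp_vfield K \<omega> \<eta> $ 0 $ 1 = \<eta> $ 0 $ 1 - \<kappa> * \<eta> $ 1 $ 0"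
proof -
  obtain K' where K: "K = Suc K'" using assms(2) by (cases K) auto
  note j = vfield_funpow_jet[OF assms(1)]
  have *: "exp_vfield K \<omega> \<eta> $ a $ b =
      \<eta> $ a $ b + (\<Sum>n\<le>K'. 1 / fact (Suc n) * (vfield \<omega> ^^ Suc n) \<eta> $ a $ b)" for a b
    unfolding exp_vfield_def fps_sum_nth scalar2_mult_nth K sum.atMost_Suc_shift
    by (simp add: fps_sum_nth)
  show "exp_vfield K \<omega> \<eta> $ 0 $ 0 = \<eta> $ 0 $ 0" and "exp_vfield K \<omega> \<eta> $ 1 $ 0 = \<eta> $ 1 $ 0"
    unfolding * j by simp_all
  have "exp_vfield K \<omega> \<eta> $ 0 $ 1 = \<eta> $ 0 $ 1 + (\<Sum>n\<le>K'. 1 / fact (Suc n) * (if n = 0 then - \<kappa> * \<eta> $ 1 $ 0 else 0))"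
    unfolding * j ..
  also have "(\<Sum>n\<le>K'. 1 / fact (Suc n) * (if n = 0 then - \<kappa> * \<eta> $ 1 $ 0 else 0)) = - \<kappa> * \<eta> $ 1 $ 0"
    by (subst sum.mono_neutral_right[of _ "{0}"]) auto
  finally show "exp_vfield K \<omega> \<eta> $ 0 $ 1 = \<eta> $ 0 $ 1 - \<kappa> * \<eta> $ 1 $ 0" by simp
qed

text \<open>Along the curve the field splits into the image of the field \<open>w \<partial>\<^sub>t\<close> and a defect
  \<open>(e\<^sub>1, e\<^sub>2)\<close>; the field \<open>w \<partial>\<^sub>t\<close> only reparametrizes, and of the defect only the first-order
  contribution survives modulo one more power of \<open>t\<close>.\<close>

lemma subst2_exp_vfield:
  assumes p: "centred p" and u: "unipotent_form \<kappa> \<omega>" and w: "fps_X ^ 2 dvd w"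
    and e1: "subst2 (- snd \<omega>) p = w * fps_deriv (fst p) + e1"
    and e2: "subst2 (fst \<omega>) p = w * fps_deriv (snd p) + e2"
    and J: "fps_X ^ J dvd e1" "fps_X ^ J dvd e2" and K: "K \<ge> 2"
  shows "fps_X ^ Suc J dvd subst2 (exp_vfield K \<omega> \<eta>) p -
    (exp_der K w (subst2 \<eta> p) +
      (fps_const (\<eta> $ 1 $ 0) * e1 + fps_const (\<eta> $ 0 $ 1 - \<kappa> / 2 * \<eta> $ 1 $ 0) * e2))"
proof -
  define c where "c \<zeta> = fps_const (\<zeta> $ 1 $ 0) * e1 + fps_const (\<zeta> $ 0 $ 1) * e2" for \<zeta> :: series2
  have cJ: "fps_X ^ J dvd c \<zeta>" for \<zeta> unfolding c_def using J by simp
  have step: "fps_X ^ Suc J dvd subst2 (vfield \<omega> \<zeta>) p - (der w (subst2 \<zeta> p) + c \<zeta>)" for \<zeta>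
  proof -
    have "subst2 (vfield \<omega> \<zeta>) p = der w (subst2 \<zeta> p) + subst2 (deriv_x \<zeta>) p * e1 + subst2 (deriv_y \<zeta>) p * e2"
    proof -
      have "subst2 (vfield \<omega> \<zeta>) p = subst2 (fst \<omega>) p * subst2 (deriv_y \<zeta>) p + subst2 (- snd \<omega>) p * subst2 (deriv_x \<zeta>) p"
        by (simp add: vfield_def subst2_diff subst2_mult[OF p] subst2_uminus)
      then show ?thesis
        unfolding e1 e2 der_def fps_deriv_subst2[OF p] by (simp add: algebra_simps)
    qed
    then have eq: "subst2 (vfield \<omega> \<zeta>) p - (der w (subst2 \<zeta> p) + c \<zeta>) =
        (subst2 (deriv_x \<zeta>) p - fps_const (\<zeta> $ 1 $ 0)) * e1 +
        (subst2 (deriv_y \<zeta>) p - fps_const (\<zeta> $ 0 $ 1)) * e2"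
      by (simp add: c_def algebra_simps)
    have "fps_X * fps_X ^ J dvd (subst2 (deriv_x \<zeta>) p - fps_const (\<zeta> $ 1 $ 0)) * e1"
      by (intro mult_dvd_mono J) (simp add: fps_X_dvd_iff deriv_x_nth)
    moreover have "fps_X * fps_X ^ J dvd (subst2 (deriv_y \<zeta>) p - fps_const (\<zeta> $ 0 $ 1)) * e2"
      by (intro mult_dvd_mono J) (simp add: fps_X_dvd_iff deriv_y_nth)
    ultimately show ?thesis unfolding eq by simp
  qed
  \<comment> \<open>The defect contributed by the outermost application of the field in the
    \<open>n\<close>-th iterate; defects of the inner applications are differentiated along
    \<open>w\<close> and thereby pushed beyond order \<open>J\<close>.\<close>
  define C where "C n = (case n of 0 \<Rightarrow> 0 | Suc n \<Rightarrow> c ((vfield \<omega> ^^ n) \<eta>))" for n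
  have CJ: "fps_X ^ J dvd C n" for n unfolding C_def by (cases n) (auto simp: cJ)
  have pow: "fps_X ^ Suc J dvd subst2 ((vfield \<omega> ^^ n) \<eta>) p - ((der w ^^ n) (subst2 \<eta> p) + C n)" for n
  proof (induction n)
    case 0
    then show ?case by (simp add: C_def)
  next
    case (Suc n)
    define A where "A = subst2 ((vfield \<omega> ^^ n) \<eta>) p"
    define B where "B = (der w ^^ n) (subst2 \<eta> p)"
    have "fps_X ^ Suc J dvd A - (B + C n)" using Suc by (simp only: A_def B_def)
    then have "fps_X ^ Suc (Suc J) dvd der w (A - (B + C n))" by (intro der_dvd w)
    then have "fps_X ^ Suc J dvd der w (A - (B + C n))" by (rule power_le_dvd) simp
    moreover have "fps_X ^ Suc J dvd der w (C n)" by (intro der_dvd w CJ)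
    ultimately have "fps_X ^ Suc J dvd der w (A - (B + C n)) + der w (C n)" by (rule dvd_add)
    then have 1: "fps_X ^ Suc J dvd der w A - der w B"
      by (simp add: der_diff der_add)
    have "fps_X ^ Suc J dvd subst2 (vfield \<omega> ((vfield \<omega> ^^ n) \<eta>)) p - (der w A + C (Suc n))"
      unfolding A_def C_def nat.case by (rule step)
    moreover have "subst2 (vfield \<omega> ((vfield \<omega> ^^ n) \<eta>)) p - (der w A + C (Suc n)) + (der w A - der w B) =
        subst2 ((vfield \<omega> ^^ Suc n) \<eta>) p - ((der w ^^ Suc n) (subst2 \<eta> p) + C (Suc n))"
      by (simp add: B_def)
    ultimately show ?case using 1 by (metis dvd_add)
  qed
  define T where "T = (\<Sum>n\<le>K. fps_const (1 / fact n) * C n)"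
  have "subst2 (exp_vfield K \<omega> \<eta>) p - (exp_der K w (subst2 \<eta> p) + T) = (\<Sum>n\<le>K. fps_const (1 / fact n) *
     (subst2 ((vfield \<omega> ^^ n) \<eta>) p - ((der w ^^ n) (subst2 \<eta> p) + C n)))"
    unfolding exp_vfield_def exp_der_def T_def divided_der_def subst2_sum subst2_scalar_mult
    by (simp add: sum_subtractf sum.distrib algebra_simps)
  moreover have "fps_X ^ Suc J dvd \<dots>"
    by (intro dvd_sum dvd_mult pow)
  moreover have "T = fps_const (\<eta> $ 1 $ 0) * e1 + fps_const (\<eta> $ 0 $ 1 - \<kappa> / 2 * \<eta> $ 1 $ 0) * e2"
  proof -
    note j = vfield_funpow_jet[OF u]
    \<comment> \<open>By nilpotency only \<open>C 1\<close> and \<open>C 2\<close> survive;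
      \<open>C 2\<close> enters with the weight 1/2 of the exponential series, which is the origin
      of \<open>\<kappa> / 2\<close>.\<close>
    have "C n = 0" if n: "n > 2" for n
    proof -
      obtain k where "n = Suc (Suc (Suc k))" using n by (auto simp: less_iff_Suc_add numeral_2_eq_2)
      then show ?thesis unfolding C_def c_def nat.case \<open>n = _\<close> j by simp
    qed
    then have "T = (\<Sum>n\<in>{0, 1, 2}. fps_const (1 / fact n) * C n)"
      unfolding T_def using K by (intro sum.mono_neutral_right) (auto simp: not_less)
    also have "\<dots> = C 1 + fps_const (1 / 2) * C 2"
      by (simp add: C_def)
    also have "C 1 = c \<eta>" by (simp add: C_def)
    also have "C 2 = fps_const (- \<kappa> * \<eta> $ 1 $ 0) * e2"
      unfolding C_def numeral_2_eq_2 nat.case c_def j by simp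
    finally show ?thesis
      by (simp add: c_def algebra_simps flip: fps_const_mult fps_const_sub fps_const_neg)
         (simp add: algebra_simps flip: mult.assoc)
  qed
  ultimately show ?thesis by simp
qed

section \<open>Puiseux series of transformed branches\<close>

definition vanishes_to :: "nat \<Rightarrow> series2 \<Rightarrow> bool" where
  "vanishes_to k \<eta> \<longleftrightarrow> (\<forall>i j. i + j < k \<longrightarrow> \<eta> $ i $ j = 0)"

lemma subst2_dvd:
  assumes "centred p" and "fps_X ^ m dvd fst p" and "fps_X ^ m dvd snd p" and "vanishes_to k \<eta>"
  shows "fps_X ^ (m * k) dvd subst2 \<eta> p"
  unfolding fps_X_power_dvd_iff
proof (intro allI impI)
  fix n assume n: "n < m * k"
  have z: "\<eta> $ i $ j * (fst p ^ i * snd p ^ j) $ n = 0" for i j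
  proof (cases "i + j < k")
    case True
    then show ?thesis using assms(4) by (simp add: vanishes_to_def)
  next
    case False
    have "(fps_X ^ m) ^ i * (fps_X ^ m) ^ j dvd fst p ^ i * snd p ^ j"
      by (intro mult_dvd_mono dvd_power_same assms)
    then have "fps_X ^ (m * (i + j)) dvd fst p ^ i * snd p ^ j"
      by (simp add: power_mult power_add)
    moreover have "n < m * (i + j)"
      using n False by (meson less_le_trans mult_le_mono2 not_less)
    ultimately have "(fst p ^ i * snd p ^ j) $ n = 0"
      by (simp add: fps_X_power_dvd_iff)
    then show ?thesis by simp
  qed
  then show "subst2 \<eta> p $ n = 0" unfolding subst2_def fps_nth_Abs_fps z by simp
qed

lemma subst2_linear_part:
  assumes p: "centred p" and m: "fps_X ^ m dvd fst p" "fps_X ^ m dvd snd p" and "\<eta> $ 0 $ 0 = 0"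
  shows "fps_X ^ (m * 2) dvd
    subst2 \<eta> p - (fps_const (\<eta> $ 1 $ 0) * fst p + fps_const (\<eta> $ 0 $ 1) * snd p)"
proof -
  define \<zeta> where "\<zeta> = \<eta> - (scalar2 (\<eta> $ 1 $ 0) * var_x + scalar2 (\<eta> $ 0 $ 1) * var_y)"
  have "vanishes_to 2 \<zeta>"
    unfolding vanishes_to_def
  proof (intro allI impI)
    fix i j :: nat assume "i + j < 2"
    then consider "i = 0" "j = 0" | "i = 1" "j = 0" | "i = 0" "j = 1" by linarith
    then show "\<zeta> $ i $ j = 0"
      using assms(4) by cases (auto simp: \<zeta>_def var_x_nth var_y_nth scalar2_def)
  qed
  from subst2_dvd[OF p m this] show ?thesis
    using p by (simp add: \<zeta>_def subst2_diff subst2_add subst2_scalar_mult)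
qed

definition param_compose :: "param \<Rightarrow> complex fps \<Rightarrow> param" where
  "param_compose p c = (fst p oo c, snd p oo c)"

definition push :: "series2 \<times> series2 \<Rightarrow> param \<Rightarrow> param" where
  "push \<sigma> p = (subst2 (fst \<sigma>) p, subst2 (snd \<sigma>) p)"

text \<open>The flag \<open>s\<close> tells whether the parameter power sits in the second coordinate.\<close>

definition puiseux :: "bool \<Rightarrow> nat \<Rightarrow> complex fps \<Rightarrow> param" where
  "puiseux s m y = (if s then (y, fps_X ^ m) else (fps_X ^ m, y))"

definition tangent_id :: "complex fps \<Rightarrow> bool" where
  "tangent_id \<rho> \<longleftrightarrow> \<rho> $ 0 = 0 \<and> \<rho> $ 1 = 1"

lemma tangent_id_X [simp]: "tangent_id fps_X"
  by (simp add: tangent_id_def)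

lemma tangent_id_iff: "tangent_id \<rho> \<longleftrightarrow> fps_X ^ 2 dvd \<rho> - fps_X"
  by (auto simp: tangent_id_def fps_X_power_dvd_iff less_2_cases_iff)

definition unipotent :: "bool \<Rightarrow> series2 \<times> series2 \<Rightarrow> bool" where
  "unipotent s \<sigma> \<longleftrightarrow> fst \<sigma> $ 0 $ 0 = 0 \<and> fst \<sigma> $ 1 $ 0 = 1 \<and> (s \<longrightarrow> fst \<sigma> $ 0 $ 1 = 0) \<and>
     snd \<sigma> $ 0 $ 0 = 0 \<and> snd \<sigma> $ 1 $ 0 = 0 \<and> snd \<sigma> $ 0 $ 1 = 1"

lemma centred_puiseux [simp]:
  assumes "m \<ge> 1" and "fps_X ^ Suc m dvd y"
  shows "centred (puiseux s m y)"
  using assms by (auto simp: centred_def puiseux_def fps_X_power_dvd_iff simp del: power_Suc)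

lemma fps_root_exists:
  fixes u :: "complex fps"
  assumes "u $ 0 \<noteq> 0" and "m \<ge> 1" and "c ^ m = u $ 0"
  shows "\<exists>r. r ^ m = u \<and> r $ 0 = c"
proof -
  obtain k where m: "m = Suc k" using assms(2) by (cases m) auto
  define r where "r = fps_radical (\<lambda>_ _. c) (Suc k) u"
  have "r ^ Suc k = u"
    unfolding r_def using power_radical[OF assms(1), of "\<lambda>_ _. c" k] assms(3) m by simp
  then show ?thesis using m by (intro exI[of _ r]) (simp add: r_def)
qed

lemma tangent_root_exists:
  assumes "m \<ge> 1" and "fps_X ^ m dvd u" and "u $ m = 1"
  shows "\<exists>\<rho>. tangent_id \<rho> \<and> \<rho> ^ m = u"
proof -
  obtain k where k: "u = fps_X ^ m * k" using assms(2) by (auto simp: dvd_def)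
  have k0: "k $ 0 = 1" using assms(3) unfolding k by (simp add: fps_X_power_mult_nth)
  obtain r where r: "r ^ m = k" "r $ 0 = 1"
    using fps_root_exists[of k m 1] k0 assms(1) by auto
  have "(fps_X * r) ^ m = u" by (simp add: power_mult_distrib r k)
  moreover have "tangent_id (fps_X * r)" by (simp add: tangent_id_def fps_X_mult_nth r)
  ultimately show ?thesis by blast
qed

lemma tangent_id_nonzero: "tangent_id \<rho> \<Longrightarrow> \<rho> $ 0 = 0 \<and> \<rho> $ 1 \<noteq> 0"
  by (simp add: tangent_id_def)

lemma compose_inv_cancel:
  fixes v \<rho> :: "complex fps"
  assumes "\<rho> $ 0 = 0" and "\<rho> $ 1 \<noteq> 0"
  shows "v oo fps_inv \<rho> oo \<rho> = v" and "v oo \<rho> oo fps_inv \<rho> = v"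
proof -
  have 0: "fps_inv \<rho> $ 0 = 0" by (simp add: fps_inv_def)
  show "v oo fps_inv \<rho> oo \<rho> = v"
    using fps_compose_assoc[OF assms(1) 0, of v] fps_inv[OF assms] by simp
  show "v oo \<rho> oo fps_inv \<rho> = v"
    using fps_compose_assoc[OF 0 assms(1), of v] fps_inv_right[OF assms] by simp
qed

lemma fps_inv_nth_0 [simp]: "fps_inv \<rho> $ 0 = 0"
  by (simp add: fps_inv_def)

text \<open>The main coordinate keeps the leading term \<open>t ^ m\<close>, so it has an
  \<open>m\<close>-th root tangent to the identity, which serves as the new parameter. Root and
  series are obtained as formal series.\<close>

lemma push_unipotent_puiseux:
  assumes m: "m \<ge> 1" and y: "fps_X ^ Suc m dvd y" and \<sigma>: "unipotent s \<sigma>"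
  shows "\<exists>z \<rho>. tangent_id \<rho> \<and> fps_X ^ Suc m dvd z \<and>
    push \<sigma> (puiseux s m y) = param_compose (puiseux s m z) \<rho>"
proof -
  define p where "p = puiseux s m y"
  have pc: "centred p" unfolding p_def using m y by (rule centred_puiseux)
  have y': "fps_X ^ m dvd y" using y by (rule power_le_dvd) simp
  have pm: "fps_X ^ m dvd fst p" "fps_X ^ m dvd snd p" using y' by (auto simp: p_def puiseux_def)
  have lin: "fps_X ^ Suc m dvd subst2 \<eta> p - (fps_const (\<eta> $ 1 $ 0) * fst p + fps_const (\<eta> $ 0 $ 1) * snd p)"
    if "\<eta> $ 0 $ 0 = 0" for \<eta>
    by (rule power_le_dvd[OF subst2_linear_part[OF pc pm that]]) (use m in simp)
  define u v where "u = (if s then subst2 (snd \<sigma>) p else subst2 (fst \<sigma>) p)"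
    and "v = (if s then subst2 (fst \<sigma>) p else subst2 (snd \<sigma>) p)"
  define c where "c = (if s then 0 else fst \<sigma> $ 0 $ 1)"
  have "fps_X ^ Suc m dvd u - (fps_X ^ m + fps_const c * y)"
  proof (cases s)
    case True
    then show ?thesis using lin[of "snd \<sigma>"] \<sigma> by (simp add: u_def c_def p_def puiseux_def unipotent_def)
  next
    case False
    then show ?thesis using lin[of "fst \<sigma>"] \<sigma> by (simp add: u_def c_def p_def puiseux_def unipotent_def)
  qed
  moreover have "fps_X ^ Suc m dvd (fps_X ^ m + fps_const c * y) - fps_X ^ m"
    using y by simp
  ultimately have "fps_X ^ Suc m dvd u - fps_X ^ m" by (rule dvd_diff_trans)
  then have u: "fps_X ^ m dvd u" "u $ m = 1"
    by (simp_all add: fps_X_power_dvd_iff del: power_Suc)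
  have "fps_X ^ Suc m dvd v - y"
  proof (cases s)
    case True
    then show ?thesis using lin[of "fst \<sigma>"] \<sigma> by (simp add: v_def p_def puiseux_def unipotent_def)
  next
    case False
    then show ?thesis using lin[of "snd \<sigma>"] \<sigma> by (simp add: v_def p_def puiseux_def unipotent_def)
  qed
  from dvd_add[OF this y] have v: "fps_X ^ Suc m dvd v" by (simp only: diff_add_cancel)
  obtain \<rho> where \<rho>: "tangent_id \<rho>" "\<rho> ^ m = u" using tangent_root_exists[OF m u] by blast
  note \<rho>0 = tangent_id_nonzero[OF \<rho>(1)]
  define z where "z = v oo fps_inv \<rho>"
  have "fps_X ^ Suc m dvd z" unfolding z_def by (intro compose_dvd_compose v) simp
  moreover have "z oo \<rho> = v" unfolding z_def using \<rho>0 by (simp add: compose_inv_cancel)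
  moreover have "fps_X ^ m oo \<rho> = u" using \<rho>0 \<rho>(2) by (simp add: fps_X_power_compose)
  ultimately have "push \<sigma> p = param_compose (puiseux s m z) \<rho>"
    by (auto simp: push_def param_compose_def puiseux_def u_def v_def)
  with \<open>fps_X ^ Suc m dvd z\<close> \<rho> show ?thesis unfolding p_def by blast
qed

text \<open>The flow alone would turn the parameter into \<open>exp_der K w \<rho>\<close> and leave
  the Puiseux series unchanged. The defect in the main coordinate alters the true parameter
  \<open>\<rho>1\<close> only from order \<open>J - m + 1\<close> on, which is felt in
  \<open>y oo \<rho>1\<close> only beyond order \<open>J\<close>. So just the defect
  \<open>e\<close> in the other coordinate remains.\<close>

lemma puiseux_perturbation:
  assumes m: "m \<ge> 1" and w: "fps_X ^ 2 dvd w" and JK: "J \<le> K"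
    and \<rho>: "tangent_id \<rho>" and \<rho>1: "tangent_id \<rho>1"
    and y: "fps_X ^ Suc m dvd y" and y1: "fps_X ^ Suc m dvd y1"
    and e: "fps_X ^ Suc m dvd e" "fps_X ^ J dvd e"
    and main: "fps_X ^ Suc J dvd \<rho>1 ^ m - (exp_der K w (\<rho> ^ m) + fps_const r * e)"
    and other: "fps_X ^ Suc J dvd (y1 oo \<rho>1) - (exp_der K w (y oo \<rho>) + e)"
  shows "fps_X ^ Suc J dvd y1 - (y + e)"
proof (cases "J \<le> m")
  case True
  have "fps_X ^ Suc m dvd y1 - (y + e)" by (intro dvd_diff dvd_add y y1 e)
  then show ?thesis by (rule power_le_dvd) (use True in simp)
next
  case False
  define \<rho>0 where "\<rho>0 = exp_der K w \<rho>"
  have "fps_X ^ Suc 1 dvd \<rho>0 - \<rho>"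
    unfolding \<rho>0_def using \<rho> by (intro exp_der_cong_id w) (simp add: fps_X_dvd_iff tangent_id_def)
  then have "fps_X ^ 2 dvd \<rho>0 - \<rho>" by (simp add: numeral_2_eq_2)
  then have \<rho>0: "tangent_id \<rho>0"
    using \<rho> dvd_diff_trans[of "fps_X ^ 2" \<rho>0 \<rho> fps_X] by (simp add: tangent_id_iff)
  have pw: "fps_X ^ Suc J dvd exp_der K w (\<rho> ^ m) - \<rho>0 ^ m"
    unfolding \<rho>0_def by (rule power_le_dvd[OF exp_der_power[OF w]]) (use JK in simp)
  have "fps_X ^ J dvd \<rho>1 ^ m - (exp_der K w (\<rho> ^ m) + fps_const r * e)"
    using main by (rule power_le_dvd) simp
  moreover have "fps_X ^ J dvd exp_der K w (\<rho> ^ m) - \<rho>0 ^ m"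
    using pw by (rule power_le_dvd) simp
  moreover have "fps_X ^ J dvd fps_const r * e" using e by simp
  ultimately have "fps_X ^ J dvd (\<rho>1 ^ m - (exp_der K w (\<rho> ^ m) + fps_const r * e)) +
      ((exp_der K w (\<rho> ^ m) - \<rho>0 ^ m) + fps_const r * e)"
    by (intro dvd_add)
  then have "fps_X ^ J dvd \<rho>1 ^ m - \<rho>0 ^ m" by simp
  then have "fps_X ^ ((J - m + 1) + (m - 1)) dvd \<rho>1 ^ Suc (m - 1) - \<rho>0 ^ Suc (m - 1)"
    using m False by simp
  from power_diff_dvd_cancel[OF _ _ _ _ this] have "fps_X ^ (J - m + 1) dvd \<rho>1 - \<rho>0"
    using \<rho>1 \<rho>0 unfolding tangent_id_def by blast
  from compose_diff_dvd[OF this _ _ y] have "fps_X ^ (J - m + 1 + m) dvd (y oo \<rho>1) - (y oo \<rho>0)"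
    using \<rho>1 \<rho>0 unfolding tangent_id_def by blast
  then have A: "fps_X ^ Suc J dvd (y oo \<rho>1) - (y oo \<rho>0)" using False by simp
  have B: "fps_X ^ Suc J dvd exp_der K w (y oo \<rho>) - (y oo \<rho>0)"
    unfolding \<rho>0_def using \<rho> JK
    by (intro power_le_dvd[OF exp_der_compose[OF w]]) (auto simp: tangent_id_def)
  \<comment> \<open>A reparametrization tangent to the identity changes a series of order
    \<open>J\<close> only beyond order \<open>J\<close>, so \<open>e\<close> may replace
    \<open>e oo \<rho>1\<close>.\<close>
  have "fps_X ^ (2 + (J - 1)) dvd (e oo \<rho>1) - (e oo fps_X)"
    by (rule compose_diff_dvd) (use \<rho>1 e False in \<open>simp_all add: tangent_id_iff[symmetric] tangent_id_nonzero del: power_Suc\<close>)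
  then have C: "fps_X ^ Suc J dvd (e oo \<rho>1) - e" using False by simp
  have "(y1 - (y + e)) oo \<rho>1 = ((y1 oo \<rho>1) - (exp_der K w (y oo \<rho>) + e)) +
      (exp_der K w (y oo \<rho>) - (y oo \<rho>0)) - ((y oo \<rho>1) - (y oo \<rho>0)) - ((e oo \<rho>1) - e)"
    by (simp add: fps_compose_sub_distrib fps_compose_add_distrib)
  then have "fps_X ^ Suc J dvd (y1 - (y + e)) oo \<rho>1"
    by (simp only:) (intro dvd_diff dvd_add other A B C)
  then have "fps_X ^ Suc J dvd ((y1 - (y + e)) oo \<rho>1) oo fps_inv \<rho>1"
    by (rule compose_dvd_compose) simp
  then show ?thesis using tangent_id_nonzero[OF \<rho>1] by (simp add: compose_inv_cancel)
qed

text \<open>Applying the operator to the components of \<open>\<sigma>\<close> composes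
  \<open>\<sigma>\<close> with the flow on the inside: the flow meets the original curve first, and
  \<open>\<sigma>\<close> acts afterwards.\<close>

definition exp_map :: "nat \<Rightarrow> form1 \<Rightarrow> series2 \<times> series2 \<Rightarrow> series2 \<times> series2" where
  "exp_map K \<omega> \<sigma> = (exp_vfield K \<omega> (fst \<sigma>), exp_vfield K \<omega> (snd \<sigma>))"

lemma unipotent_exp_map:
  assumes "unipotent s \<sigma>" and "unipotent_form \<kappa> \<omega>" and "s \<longrightarrow> \<kappa> = 0" and "K \<ge> 1"
  shows "unipotent s (exp_map K \<omega> \<sigma>)"
  using assms(1,3) unfolding unipotent_def exp_map_def fst_conv snd_conv exp_vfield_jet[OF assms(2,4)]
  by simp

text \<open>\<open>w\<close> is chosen so that moving the parameter accounts for the whole main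
  coordinate of the field; what is left in the other coordinate is \<open>e\<close>. Contraction
  with the tangent of the branch kills the moving part, so the pullback is, up to sign,
  \<open>e\<close> times the derivative of the main coordinate.\<close>

lemma pullback_defect:
  assumes m: "m \<ge> 1" and y: "fps_X ^ Suc m dvd y" and u: "unipotent_form \<kappa> \<omega>"
    and s: "s \<longrightarrow> \<kappa> = 0"
  obtains w e where "fps_X ^ 2 dvd w" and "fps_X ^ Suc m dvd e"
    and "pullback \<omega> (puiseux s m y) = fps_const (if s then - of_nat m else of_nat m) * (fps_X ^ (m - 1) * e)"
    and "subst2 (- snd \<omega>) (puiseux s m y) = w * fps_deriv (fst (puiseux s m y)) + (if s then e else 0)"
    and "subst2 (fst \<omega>) (puiseux s m y) = w * fps_deriv (snd (puiseux s m y)) + (if s then 0 else e)"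
proof -
  define p where "p = puiseux s m y"
  have pc: "centred p" unfolding p_def using m y by (rule centred_puiseux)
  have y': "fps_X ^ m dvd y" using y by (rule power_le_dvd) simp
  have pm: "fps_X ^ m dvd fst p" "fps_X ^ m dvd snd p" using y' by (auto simp: p_def puiseux_def)
  have lin: "fps_X ^ Suc m dvd subst2 \<eta> p - (fps_const (\<eta> $ 1 $ 0) * fst p + fps_const (\<eta> $ 0 $ 1) * snd p)"
    if "\<eta> $ 0 $ 0 = 0" for \<eta>
    by (rule power_le_dvd[OF subst2_linear_part[OF pc pm that]]) (use m in simp)
  have P: "fps_X ^ Suc m dvd subst2 (fst \<omega>) p"
    using lin[of "fst \<omega>"] u by (simp add: unipotent_form_def)
  have Q: "fps_X ^ Suc m dvd subst2 (snd \<omega>) p"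
  proof (cases s)
    case True
    then show ?thesis using lin[of "snd \<omega>"] u s by (simp add: unipotent_form_def)
  next
    case False
    then have "fps_X ^ Suc m dvd subst2 (snd \<omega>) p - fps_const \<kappa> * y"
      using lin[of "snd \<omega>"] u by (simp add: unipotent_form_def p_def puiseux_def)
    moreover have "fps_X ^ Suc m dvd fps_const \<kappa> * y" using y by (rule dvd_mult)
    ultimately show ?thesis by (metis dvd_add diff_add_cancel)
  qed
  obtain A where A: "subst2 (fst \<omega>) p = fps_X ^ Suc m * A" using P by (auto simp: dvd_def)
  obtain B where B: "subst2 (snd \<omega>) p = fps_X ^ Suc m * B" using Q by (auto simp: dvd_def)
  define c where "c = fps_const (1 / of_nat m :: complex)"
  have dX: "fps_deriv (fps_X ^ m :: complex fps) = fps_const (of_nat m) * fps_X ^ (m - 1)"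
    using fps_deriv_power'[of "fps_X :: complex fps" m] by (simp add: fps_of_nat)
  have Xm: "fps_X ^ Suc m = (fps_X ^ 2 :: complex fps) * fps_X ^ (m - 1)"
    using m by (cases m) (simp_all add: numeral_2_eq_2 mult.assoc)
  have c: "c * fps_const (of_nat m) = 1" using m by (simp add: c_def)
  have dy: "fps_X ^ m dvd fps_deriv y"
    using y by (simp add: fps_X_power_dvd_iff del: power_Suc)
  define w where "w = fps_X ^ 2 * (c * (if s then A else - B))"
  have w: "fps_X ^ 2 dvd w" by (simp add: w_def)
  have wdy: "fps_X ^ Suc m dvd w * fps_deriv y"
  proof -
    have "fps_X ^ 2 * fps_X ^ m dvd w * fps_deriv y" by (intro mult_dvd_mono w dy)
    then show ?thesis by (auto simp flip: power_add intro: power_le_dvd)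
  qed
  define e where "e = (if s then - subst2 (snd \<omega>) p else subst2 (fst \<omega>) p) - w * fps_deriv y"
  have e: "fps_X ^ Suc m dvd e"
    unfolding e_def using P Q wdy by (auto intro!: dvd_diff simp del: power_Suc)
  have wX: "w * fps_deriv (fps_X ^ m) = fps_X ^ Suc m * (if s then A else - B)"
  proof -
    have "w * fps_deriv (fps_X ^ m) = fps_X ^ Suc m * (if s then A else - B) * (c * fps_const (of_nat m))"
      unfolding w_def dX Xm by (simp only: mult_ac)
    then show ?thesis by (simp only: c mult_1_right)
  qed
  have 1: "subst2 (- snd \<omega>) p = w * fps_deriv (fst p) + (if s then e else 0)"
    by (cases s) (simp_all add: subst2_uminus e_def p_def[symmetric] wX B del: power_Suc fps_deriv_power,
      simp_all add: p_def puiseux_def wX del: power_Suc)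
  have 2: "subst2 (fst \<omega>) p = w * fps_deriv (snd p) + (if s then 0 else e)"
    by (cases s) (simp_all add: e_def p_def[symmetric] wX A del: power_Suc,
      simp_all add: p_def puiseux_def wX del: power_Suc)
  have 3: "pullback \<omega> p = fps_const (if s then - of_nat m else of_nat m) * (fps_X ^ (m - 1) * e)"
  proof -
    have Q': "subst2 (snd \<omega>) p = - (w * fps_deriv (fst p) + (if s then e else 0))"
      using 1 by (simp add: subst2_uminus minus_equation_iff[of "subst2 (snd \<omega>) p"])
    have "pullback \<omega> p = (if s then - fps_deriv (fps_X ^ m) * e else fps_deriv (fps_X ^ m) * e)"
      unfolding pullback_def Q' 2
      by (simp add: p_def puiseux_def algebra_simps del: fps_deriv_power)
    then show ?thesis unfolding dX by (simp add: mult.assoc flip: fps_const_neg)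
  qed
  from that[OF w e] 1 2 3 show ?thesis by (simp only: p_def)
qed

lemma exp_map_puiseux:
  assumes m: "m \<ge> 1" and y0: "fps_X ^ Suc m dvd y0" and \<omega>: "unipotent_form \<kappa> \<omega>"
    and s: "s \<longrightarrow> \<kappa> = 0" and \<sigma>: "unipotent s \<sigma>" and K: "K \<ge> 2"
    and \<rho>: "tangent_id \<rho>" and y: "fps_X ^ Suc m dvd y"
    and push: "push \<sigma> (puiseux s m y0) = param_compose (puiseux s m y) \<rho>"
    and e: "pullback \<omega> (puiseux s m y0) = fps_const (if s then - of_nat m else of_nat m) * (fps_X ^ (m - 1) * e)"
  shows "\<exists>y1 \<rho>1. tangent_id \<rho>1 \<and> fps_X ^ Suc m dvd y1 \<and>
    push (exp_map K \<omega> \<sigma>) (puiseux s m y0) = param_compose (puiseux s m y1) \<rho>1 \<and>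
    (\<forall>J\<le>K. fps_X ^ J dvd e \<longrightarrow> fps_X ^ Suc J dvd y1 - (y + e))"
proof -
  define p where "p = puiseux s m y0"
  have pc: "centred p" unfolding p_def using m y0 by (rule centred_puiseux)
  obtain w e' where w: "fps_X ^ 2 dvd w" and e'm: "fps_X ^ Suc m dvd e'"
    and e': "pullback \<omega> p = fps_const (if s then - of_nat m else of_nat m) * (fps_X ^ (m - 1) * e')"
    and e1: "subst2 (- snd \<omega>) p = w * fps_deriv (fst p) + (if s then e' else 0)"
    and e2: "subst2 (fst \<omega>) p = w * fps_deriv (snd p) + (if s then 0 else e')"
    unfolding p_def by (rule pullback_defect[OF m y0 \<omega> s])
  have "e' = e"
    using e e' m unfolding p_def by (auto split: if_splits)
  note e1 = e1[unfolded this] and e2 = e2[unfolded this] and em = e'm[unfolded this]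
  have "unipotent s (exp_map K \<omega> \<sigma>)" using unipotent_exp_map[OF \<sigma> \<omega> s] K by simp
  from push_unipotent_puiseux[OF m y0 this] obtain y1 \<rho>1 where
    \<rho>1: "tangent_id \<rho>1" and y1: "fps_X ^ Suc m dvd y1"
    and push1: "push (exp_map K \<omega> \<sigma>) p = param_compose (puiseux s m y1) \<rho>1" 
    unfolding p_def by blast
  have \<rho>0: "\<rho> $ 0 = 0" "\<rho>1 $ 0 = 0" using \<rho> \<rho>1 by (auto simp: tangent_id_def)
  have "fps_X ^ Suc J dvd y1 - (y + e)" if J: "J \<le> K" "fps_X ^ J dvd e" for J
  proof -
    \<comment> \<open>The weight of the defect in the main coordinate. With \<open>s\<close> that
      coordinate comes from \<open>snd \<sigma>\<close>, which has no \<open>x\<close> term, so it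
      feels nothing; otherwise it feels the shear coefficient of \<open>fst \<sigma>\<close>,
      corrected by the second-order term of the exponential.\<close>
    define r where "r = (if s then 0 else fst \<sigma> $ 0 $ 1 - \<kappa> / 2)"
    have J': "fps_X ^ J dvd (if s then e else 0)" "fps_X ^ J dvd (if s then 0 else e)"
      using J by auto
    note main = subst2_exp_vfield[OF pc \<omega> w e1 e2 J' K]
    have "fps_X ^ Suc J dvd \<rho>1 ^ m - (exp_der K w (\<rho> ^ m) + fps_const r * e) \<and>
          fps_X ^ Suc J dvd (y1 oo \<rho>1) - (exp_der K w (y oo \<rho>) + e)"
      using main[of "fst \<sigma>"] main[of "snd \<sigma>"] push[folded p_def] push1 \<sigma> s \<rho>0
      by (cases s) (simp_all add: push_def param_compose_def puiseux_def exp_map_def p_def[symmetric]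
        fps_X_power_compose unipotent_def r_def del: power_Suc)
    then show ?thesis
      using puiseux_perturbation[OF m w J(1) \<rho> \<rho>1 y y1 em J(2)] by blast
  qed
  with \<rho>1 y1 push1 show ?thesis unfolding p_def by blast
qed

section \<open>Convergence\<close>

text \<open>Geometric bounds on coefficients are easier to propagate through powers and
  substitutions than radii of convergence: it is enough to count terms.\<close>

lemma conv1_iff_bound:
  "f \<in> conv1 \<longleftrightarrow> (\<exists>C K. C \<ge> 1 \<and> K \<ge> 1 \<and> (\<forall>n. norm (f $ n) \<le> C * K ^ n))"
proof
  assume "f \<in> conv1"
  then obtain r where r: "ereal r > 0" "ereal r < fps_conv_radius f"
    using ereal_dense2[of 0 "fps_conv_radius f"] by (auto simp: conv1_def)
  then have r0: "r > 0" by simp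
  have "summable (\<lambda>n. norm (f $ n * of_real r ^ n))"
    using norm_summable_fps[of "of_real r" f] r r0 by simp
  then have "Bseq (\<lambda>n. norm (f $ n * of_real r ^ n))"
    by (intro convergent_imp_Bseq convergentI[of _ 0] summable_LIMSEQ_zero)
  then obtain C where C: "\<And>n. norm (f $ n * of_real r ^ n) \<le> C"
    by (auto simp: Bseq_def)
  have "norm (f $ n) \<le> max 1 C * (max 1 (1 / r)) ^ n" for n
  proof -
    have "norm (f $ n) * r ^ n \<le> C" using C[of n] r0 by (simp add: norm_mult norm_power)
    then have "norm (f $ n) \<le> C * (1 / r) ^ n"
      using r0 by (simp add: field_simps)
    also have "\<dots> \<le> max 1 C * (max 1 (1 / r)) ^ n"
      using r0 by (intro mult_mono power_mono) auto
    finally show ?thesis .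
  qed
  then show "\<exists>C K. C \<ge> 1 \<and> K \<ge> 1 \<and> (\<forall>n. norm (f $ n) \<le> C * K ^ n)"
    by (intro exI[of _ "max 1 C"] exI[of _ "max 1 (1 / r)"]) auto
next
  assume "\<exists>C K. C \<ge> 1 \<and> K \<ge> 1 \<and> (\<forall>n. norm (f $ n) \<le> C * K ^ n)"
  then obtain C K where C: "C \<ge> 1" "K \<ge> 1" "\<And>n. norm (f $ n) \<le> C * K ^ n" by blast
  define z where "z = (of_real (1 / (2 * K)) :: complex)"
  have nz: "norm z = 1 / (2 * K)" using C unfolding z_def by (subst norm_of_real) simp
  have "summable (\<lambda>n. f $ n * z ^ n)"
  proof (rule summable_comparison_test)
    have "norm (f $ n * z ^ n) \<le> C * (1 / 2) ^ n" for n
    proof -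
      have "norm (f $ n * z ^ n) \<le> C * K ^ n * (1 / (2 * K)) ^ n"
        unfolding norm_mult norm_power nz using C by (intro mult_right_mono) auto
      also have "\<dots> = C * (1 / 2) ^ n" using C by (simp add: field_simps)
      finally show ?thesis .
    qed
    then show "\<exists>N. \<forall>n\<ge>N. norm (f $ n * z ^ n) \<le> C * (1 / 2) ^ n" by blast
    show "summable (\<lambda>n. C * (1 / 2) ^ n :: real)" by (intro summable_mult summable_geometric) simp
  qed
  then have "fps_conv_radius f \<ge> norm z" unfolding fps_conv_radius_def by (rule conv_radius_geI)
  moreover have "ereal (norm z) > 0" using nz C by simp
  ultimately show "f \<in> conv1" unfolding conv1_def by (metis less_le_trans mem_Collect_eq)
qed

lemma conv1_add [intro]: "f \<in> conv1 \<Longrightarrow> g \<in> conv1 \<Longrightarrow> f + g \<in> conv1"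
  unfolding conv1_def using fps_conv_radius_add[of f g] by (auto simp: min_def split: if_splits)

lemma conv1_diff [intro]: "f \<in> conv1 \<Longrightarrow> g \<in> conv1 \<Longrightarrow> f - g \<in> conv1"
  unfolding conv1_def using fps_conv_radius_diff[of f g] by (auto simp: min_def split: if_splits)

lemma conv1_mult [intro]: "f \<in> conv1 \<Longrightarrow> g \<in> conv1 \<Longrightarrow> f * g \<in> conv1"
  unfolding conv1_def using fps_conv_radius_mult[of f g] by (auto simp: min_def split: if_splits)

lemma conv1_power [intro]: "f \<in> conv1 \<Longrightarrow> f ^ n \<in> conv1"
  unfolding conv1_def using fps_conv_radius_power[of f n] by (auto simp: min_def split: if_splits)

lemma conv1_basic [intro, simp]: "0 \<in> conv1" "1 \<in> conv1" "fps_const c \<in> conv1" "fps_X \<in> conv1"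
  by (simp_all add: conv1_def)

lemma conv1_sum [intro]: "(\<And>a. a \<in> A \<Longrightarrow> f a \<in> conv1) \<Longrightarrow> sum f A \<in> conv1"
  by (induction A rule: infinite_finite_induct) auto

lemma conv1_prod [intro]: "(\<And>a. a \<in> A \<Longrightarrow> f a \<in> conv1) \<Longrightarrow> prod f A \<in> conv1"
  by (induction A rule: infinite_finite_induct) auto

text \<open>A finite combination of powers of a convergent series. This covers the composites of
  truncated series with truncated parameters in \<open>truncated_correction\<close>.\<close>

lemma conv1_compose_polynomial:
  assumes "\<And>n. n > N \<Longrightarrow> f $ n = 0" and "g \<in> conv1" and "g $ 0 = 0"
  shows "f oo g \<in> conv1"
proof -
  have "f = (\<Sum>n\<le>N. fps_const (f $ n) * fps_X ^ n)"
    by (rule fps_ext) (use assms(1) in \<open>auto simp: fps_sum_nth mult_delta_right not_le[symmetric]\<close>)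
  then have "f oo g = (\<Sum>n\<le>N. fps_const (f $ n) * fps_X ^ n) oo g" by simp
  also have "\<dots> = (\<Sum>n\<le>N. fps_const (f $ n) * g ^ n)"
    using assms(3) by (simp add: fps_compose_sum_distrib fps_compose_mult_distrib fps_X_power_compose)
  also have "\<dots> \<in> conv1" using assms(2) by auto
  finally show ?thesis .
qed

lemma conv1_polynomial:
  assumes "\<And>n. n > N \<Longrightarrow> f $ n = 0"
  shows "f \<in> conv1"
  using conv1_compose_polynomial[of N f fps_X] assms by simp

text \<open>Splitting off the power of the variable leaves a unit, whose inverse converges. It
  serves to divide a prescribed restriction by the fixed factor that interpolation
  introduces.\<close>

lemma conv1_quotient:
  assumes "E \<in> conv1" and "E \<noteq> 0" and "h \<in> conv1" and "fps_X ^ subdegree E dvd h"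
  shows "\<exists>q\<in>conv1. h = q * E"
proof -
  define d where "d = subdegree E"
  define U where "U = fps_shift d E"
  have U: "E = fps_X ^ d * U" unfolding U_def d_def
    by (metis subdegree_decompose mult.commute)
  have U0: "U $ 0 \<noteq> 0" using assms(2) by (simp add: U_def d_def)
  have h: "h = fps_X ^ d * fps_shift d h"
    by (rule fps_ext) (use assms(4) in \<open>auto simp: fps_X_power_mult_nth fps_X_power_dvd_iff d_def\<close>)
  have "fps_conv_radius (inverse U) > 0"
    using assms(1) U0 by (intro fps_conv_radius_inverse_pos) (auto simp: U_def conv1_def)
  then have "fps_shift d h * inverse U \<in> conv1"
    using assms(3) by (intro conv1_mult) (auto simp: conv1_def)
  moreover have "h = fps_shift d h * inverse U * E"
  proof -
    have "fps_shift d h * inverse U * E = fps_X ^ d * fps_shift d h * (inverse U * U)"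
      unfolding U by (simp only: mult_ac)
    also have "\<dots> = h" using h by (simp add: inverse_mult_eq_1[OF U0])
    finally show ?thesis ..
  qed
  ultimately show ?thesis by blast
qed

lemma conv2_iff_bound:
  "\<eta> \<in> conv2 \<longleftrightarrow> (\<exists>C K. C \<ge> 1 \<and> K \<ge> 1 \<and> (\<forall>i j. norm (\<eta> $ i $ j) \<le> C * K ^ (i + j)))"
proof
  assume "\<eta> \<in> conv2"
  then obtain r where r: "r > 0" and sm: "(\<lambda>(i, j). norm (\<eta> $ i $ j) * r ^ (i + j)) summable_on UNIV"
    by (auto simp: conv2_def)
  define C where "C = (\<Sum>\<^sub>\<infinity>(i, j). norm (\<eta> $ i $ j) * r ^ (i + j))"
  have C: "norm (\<eta> $ i $ j) * r ^ (i + j) \<le> C" for i j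
    using finite_sum_le_infsum[OF sm, of "{(i, j)}"] r by (auto simp: C_def)
  have "norm (\<eta> $ i $ j) \<le> max 1 C * max 1 (1 / r) ^ (i + j)" for i j
  proof -
    have "norm (\<eta> $ i $ j) \<le> C * (1 / r) ^ (i + j)"
      using C[of i j] r by (simp add: field_simps)
    also have "\<dots> \<le> max 1 C * (max 1 (1 / r)) ^ (i + j)"
      using r by (intro mult_mono power_mono) auto
    finally show ?thesis .
  qed
  then show "\<exists>C K. C \<ge> 1 \<and> K \<ge> 1 \<and> (\<forall>i j. norm (\<eta> $ i $ j) \<le> C * K ^ (i + j))"
    by (intro exI[of _ "max 1 C"] exI[of _ "max 1 (1 / r)"]) auto
next
  assume "\<exists>C K. C \<ge> 1 \<and> K \<ge> 1 \<and> (\<forall>i j. norm (\<eta> $ i $ j) \<le> C * K ^ (i + j))"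
  then obtain C K where C: "C \<ge> 1" "K \<ge> 1" "\<And>i j. norm (\<eta> $ i $ j) \<le> C * K ^ (i + j)" by blast
  define r where "r = 1 / (2 * K)"
  have r: "r > 0" using C by (simp add: r_def)
  have le: "norm (\<eta> $ i $ j) * r ^ (i + j) \<le> C * ((1 / 2) ^ i * (1 / 2) ^ j)" for i j
  proof -
    have "norm (\<eta> $ i $ j) * r ^ (i + j) \<le> C * K ^ (i + j) * r ^ (i + j)"
      using C r by (intro mult_right_mono) auto
    also have "\<dots> = C * ((1 / 2) ^ i * (1 / 2) ^ j)"
      using C by (simp add: r_def field_simps power_add power_mult_distrib)
    finally show ?thesis .
  qed
  have geo: "(\<Sum>i\<le>n. (1 / 2 :: real) ^ i) \<le> 2" for n :: nat
    by (simp add: sum_gp0)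
  have "(\<lambda>(i, j). norm (\<eta> $ i $ j) * r ^ (i + j)) summable_on UNIV"
  proof (rule nonneg_bounded_partial_sums_imp_summable_on[where C = "4 * C"])
    show "(case x of (i, j) \<Rightarrow> norm (\<eta> $ i $ j) * r ^ (i + j)) \<ge> 0" for x using r by (auto split: prod.split)
    show "\<forall>\<^sub>F F in finite_subsets_at_top UNIV. (\<Sum>(i, j)\<in>F. norm (\<eta> $ i $ j) * r ^ (i + j)) \<le> 4 * C"
    proof (rule eventually_finite_subsets_at_top_weakI)
      fix F :: "(nat \<times> nat) set" assume F: "finite F"
      define n where "n = Max (fst ` F \<union> snd ` F)"
      have sub: "F \<subseteq> {..n} \<times> {..n}"
        using F by (auto simp: n_def intro!: Max_ge) (force+)
      have "(\<Sum>(i, j)\<in>F. norm (\<eta> $ i $ j) * r ^ (i + j)) \<le> (\<Sum>(i, j)\<in>F. C * ((1 / 2) ^ i * (1 / 2) ^ j))"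
        using le by (intro sum_mono) auto
      also have "\<dots> \<le> (\<Sum>(i, j)\<in>{..n} \<times> {..n}. C * ((1 / 2) ^ i * (1 / 2) ^ j))"
        using C by (intro sum_mono2 sub) auto
      also have "\<dots> = C * (\<Sum>i\<le>n. \<Sum>j\<le>n. (1 / 2) ^ i * (1 / 2) ^ j)"
        by (simp add: sum_distrib_left flip: sum.cartesian_product)
      also have "\<dots> = C * ((\<Sum>i\<le>n. (1 / 2) ^ i) * (\<Sum>j\<le>n. (1 / 2) ^ j))"
        by (simp only: sum_product)
      also have "\<dots> \<le> C * (2 * 2)"
        using C by (intro mult_left_mono mult_mono geo) (auto intro: sum_nonneg)
      finally show "(\<Sum>(i, j)\<in>F. norm (\<eta> $ i $ j) * r ^ (i + j)) \<le> 4 * C" by simp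
    qed
  qed
  with r show "\<eta> \<in> conv2" unfolding conv2_def by blast
qed

lemma conv2I:
  assumes "\<And>i j. norm (\<eta> $ i $ j) \<le> C * K ^ (i + j)"
  shows "\<eta> \<in> conv2"
proof -
  have "norm (\<eta> $ i $ j) \<le> max 1 \<bar>C\<bar> * max 1 \<bar>K\<bar> ^ (i + j)" for i j
  proof -
    have "norm (\<eta> $ i $ j) \<le> C * K ^ (i + j)" by (rule assms)
    also have "\<dots> \<le> \<bar>C\<bar> * \<bar>K\<bar> ^ (i + j)" by (metis abs_ge_self abs_mult power_abs)
    also have "\<dots> \<le> max 1 \<bar>C\<bar> * max 1 \<bar>K\<bar> ^ (i + j)" by (intro mult_mono power_mono) auto
    finally show ?thesis .
  qed
  then show ?thesis unfolding conv2_iff_bound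
    by (intro exI[of _ "max 1 \<bar>C\<bar>"] exI[of _ "max 1 \<bar>K\<bar>"]) auto
qed

lemma conv2_common_bound:
  assumes "\<eta> \<in> conv2" and "\<zeta> \<in> conv2"
  obtains C K where "C \<ge> 1" and "K \<ge> 1" and "\<And>i j. norm (\<eta> $ i $ j) \<le> C * K ^ (i + j)"
    and "\<And>i j. norm (\<zeta> $ i $ j) \<le> C * K ^ (i + j)"
proof -
  obtain C1 K1 where 1: "C1 \<ge> 1" "K1 \<ge> 1" "\<And>i j. norm (\<eta> $ i $ j) \<le> C1 * K1 ^ (i + j)"
    using assms(1) unfolding conv2_iff_bound by blast
  obtain C2 K2 where 2: "C2 \<ge> 1" "K2 \<ge> 1" "\<And>i j. norm (\<zeta> $ i $ j) \<le> C2 * K2 ^ (i + j)"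
    using assms(2) unfolding conv2_iff_bound by blast
  have "C1 * K1 ^ (i + j) \<le> max C1 C2 * max K1 K2 ^ (i + j)"
    "C2 * K2 ^ (i + j) \<le> max C1 C2 * max K1 K2 ^ (i + j)" for i j
    using 1 2 by (intro mult_mono power_mono; simp)+
  then have "norm (\<eta> $ i $ j) \<le> max C1 C2 * max K1 K2 ^ (i + j)"
    "norm (\<zeta> $ i $ j) \<le> max C1 C2 * max K1 K2 ^ (i + j)" for i j
    using 1(3) 2(3) order_trans by blast+
  with 1 2 show ?thesis by (intro that[of "max C1 C2" "max K1 K2"]) auto
qed

lemma Suc_le_two_power: "real (Suc n) \<le> 2 ^ n"
  by (induction n) (auto simp: algebra_simps)

lemma conv2_add [intro]:
  assumes "\<eta> \<in> conv2" and "\<zeta> \<in> conv2"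
  shows "\<eta> + \<zeta> \<in> conv2"
proof -
  obtain C K where C: "C \<ge> 1" "K \<ge> 1" "\<And>i j. norm (\<eta> $ i $ j) \<le> C * K ^ (i + j)"
    "\<And>i j. norm (\<zeta> $ i $ j) \<le> C * K ^ (i + j)" using conv2_common_bound[OF assms] by blast
  show ?thesis
  proof (rule conv2I[where C = "2 * C" and K = K])
    fix i j show "norm ((\<eta> + \<zeta>) $ i $ j) \<le> 2 * C * K ^ (i + j)"
      using norm_triangle_le[OF add_mono[OF C(3)[of i j] C(4)[of i j]]] by simp
  qed
qed

lemma conv2_mult [intro]:
  assumes "\<eta> \<in> conv2" and "\<zeta> \<in> conv2"
  shows "\<eta> * \<zeta> \<in> conv2"
proof -
  obtain C K where C: "C \<ge> 1" "K \<ge> 1" "\<And>i j. norm (\<eta> $ i $ j) \<le> C * K ^ (i + j)"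
    "\<And>i j. norm (\<zeta> $ i $ j) \<le> C * K ^ (i + j)" using conv2_common_bound[OF assms] by blast
  show ?thesis
  proof (rule conv2I[where C = "C * C" and K = "2 * K"])
    fix i j
    have "(\<eta> * \<zeta>) $ i $ j = (\<Sum>a\<le>i. \<Sum>b\<le>j. \<eta> $ a $ b * \<zeta> $ (i - a) $ (j - b))"
      by (simp add: fps_mult_nth fps_sum_nth atLeast0AtMost)
    also have "norm \<dots> \<le> (\<Sum>a\<le>i. \<Sum>b\<le>j. C * C * K ^ (i + j))"
    proof (intro order_trans[OF norm_sum] sum_mono)
      fix a b assume ab: "a \<in> {..i}" "b \<in> {..j}"
      have "norm (\<eta> $ a $ b * \<zeta> $ (i - a) $ (j - b)) \<le>
          (C * K ^ (a + b)) * (C * K ^ ((i - a) + (j - b)))"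
        unfolding norm_mult using C by (intro mult_mono) auto
      also have "\<dots> = C * C * K ^ ((a + b) + ((i - a) + (j - b)))" by (simp add: power_add)
      also have "(a + b) + ((i - a) + (j - b)) = i + j" using ab by simp
      finally show "norm (\<eta> $ a $ b * \<zeta> $ (i - a) $ (j - b)) \<le> C * C * K ^ (i + j)" .
    qed
    also have "\<dots> = real (Suc i) * real (Suc j) * (C * C * K ^ (i + j))" by simp
    also have "\<dots> \<le> 2 ^ i * 2 ^ j * (C * C * K ^ (i + j))"
      using C by (intro mult_mono Suc_le_two_power) auto
    also have "\<dots> = C * C * (2 * K) ^ (i + j)" by (simp add: power_mult_distrib power_add)
    finally show "norm ((\<eta> * \<zeta>) $ i $ j) \<le> C * C * (2 * K) ^ (i + j)" .
  qed
qed

lemma conv2_scalar [intro, simp]: "scalar2 c \<in> conv2"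
  by (rule conv2I[where C = "norm c" and K = 1]) (auto simp: scalar2_def)

lemma conv2_var [intro, simp]: "var_x \<in> conv2" "var_y \<in> conv2"
  by (rule conv2I[where C = 1 and K = 1]; auto simp: var_x_nth var_y_nth)+

lemma conv2_0_1 [intro, simp]: "0 \<in> conv2" "1 \<in> conv2"
  using conv2_scalar[of 0] conv2_scalar[of 1] by (simp_all add: scalar2_def)

lemma conv2_uminus [intro]: "\<eta> \<in> conv2 \<Longrightarrow> - \<eta> \<in> conv2"
  using conv2_mult[OF conv2_scalar[of "- 1"], of \<eta>] by (simp add: scalar2_def flip: fps_const_neg)

lemma conv2_diff [intro]: "\<eta> \<in> conv2 \<Longrightarrow> \<zeta> \<in> conv2 \<Longrightarrow> \<eta> - \<zeta> \<in> conv2"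
  using conv2_add[OF _ conv2_uminus, of \<eta> \<zeta>] by simp

lemma conv2_power [intro]: "\<eta> \<in> conv2 \<Longrightarrow> \<eta> ^ n \<in> conv2"
  by (induction n) auto

lemma conv2_sum [intro]: "(\<And>a. a \<in> A \<Longrightarrow> f a \<in> conv2) \<Longrightarrow> sum f A \<in> conv2"
  by (induction A rule: infinite_finite_induct) auto

lemma conv2_prod [intro]: "(\<And>a. a \<in> A \<Longrightarrow> f a \<in> conv2) \<Longrightarrow> prod f A \<in> conv2"
  by (induction A rule: infinite_finite_induct) auto

lemma conv2_deriv [intro]:
  assumes "\<eta> \<in> conv2"
  shows "deriv_x \<eta> \<in> conv2" and "deriv_y \<eta> \<in> conv2"
proof -
  obtain C K where C: "C \<ge> 1" "K \<ge> 1" "\<And>i j. norm (\<eta> $ i $ j) \<le> C * K ^ (i + j)"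
    using assms unfolding conv2_iff_bound by blast
  have *: "real (Suc k) * norm c \<le> C * K * (2 * K) ^ (i + j)"
    if "norm c \<le> C * K ^ Suc (i + j)" and "k \<le> i + j" for k i j and c :: complex
  proof -
    have "real (Suc k) \<le> real (Suc (i + j))" using that by simp
    then have "real (Suc k) \<le> 2 ^ (i + j)" using Suc_le_two_power order_trans by blast
    then have "real (Suc k) * norm c \<le> 2 ^ (i + j) * (C * K ^ Suc (i + j))"
      using that by (intro mult_mono) auto
    then show ?thesis by (simp add: power_mult_distrib mult_ac)
  qed
  show "deriv_x \<eta> \<in> conv2"
  proof (rule conv2I[where C = "C * K" and K = "2 * K"])
    fix i j show "norm (deriv_x \<eta> $ i $ j) \<le> C * K * (2 * K) ^ (i + j)"
      unfolding deriv_x_nth norm_mult norm_of_nat using C(3)[of "Suc i" j] by (intro *) auto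
  qed
  show "deriv_y \<eta> \<in> conv2"
  proof (rule conv2I[where C = "C * K" and K = "2 * K"])
    fix i j show "norm (deriv_y \<eta> $ i $ j) \<le> C * K * (2 * K) ^ (i + j)"
      unfolding deriv_y_nth norm_mult norm_of_nat using C(3)[of i "Suc j"] by (intro *) auto
  qed
qed

text \<open>The factor \<open>2 ^ (i + n)\<close> absorbs the number of terms of the iterated Cauchy
  product, as the weights \<open>2 ^ (n - a)\<close> sum to at most
  \<open>2 ^ Suc n\<close>.\<close>

lemma conv1_power_bound:
  assumes "C \<ge> 1" and "K \<ge> 1" and f: "\<And>n. norm (f $ n) \<le> C * K ^ n"
  shows "norm ((f ^ i) $ n :: complex) \<le> C ^ i * K ^ n * 2 ^ (i + n)"
proof (induction i arbitrary: n)
  case 0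
  have "norm ((f ^ 0) $ n) \<le> (K * 2) ^ n" using assms(2) by simp
  then show ?case by (simp add: power_mult_distrib)
next
  case (Suc i)
  have geo: "(\<Sum>a\<le>n. (2 :: real) ^ (n - a)) \<le> 2 ^ Suc n"
  proof -
    have "(\<Sum>a\<le>n. (2 :: real) ^ (n - a)) = (\<Sum>a\<le>n. 2 ^ a)"
      by (rule sum.reindex_bij_witness[of _ "\<lambda>a. n - a" "\<lambda>a. n - a"]) auto
    also have "\<dots> \<le> 2 ^ Suc n" by (simp add: sum_gp0)
    finally show ?thesis .
  qed
  have "(f ^ Suc i) $ n = (\<Sum>a\<le>n. f $ a * (f ^ i) $ (n - a))"
    by (simp add: fps_mult_nth atLeast0AtMost)
  also have "norm \<dots> \<le> (\<Sum>a\<le>n. C ^ Suc i * K ^ n * 2 ^ i * 2 ^ (n - a))"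
  proof (intro order_trans[OF norm_sum] sum_mono)
    fix a assume a: "a \<in> {..n}"
    have "norm (f $ a * (f ^ i) $ (n - a)) \<le> (C * K ^ a) * (C ^ i * K ^ (n - a) * 2 ^ (i + (n - a)))"
      unfolding norm_mult using assms by (intro mult_mono f Suc) auto
    also have "\<dots> = C ^ Suc i * K ^ (a + (n - a)) * 2 ^ i * 2 ^ (n - a)" by (simp add: power_add)
    also have "a + (n - a) = n" using a by simp
    finally show "norm (f $ a * (f ^ i) $ (n - a)) \<le> C ^ Suc i * K ^ n * 2 ^ i * 2 ^ (n - a)" .
  qed
  also have "\<dots> = C ^ Suc i * K ^ n * 2 ^ i * (\<Sum>a\<le>n. 2 ^ (n - a))" by (simp only: sum_distrib_left)
  also have "\<dots> \<le> C ^ Suc i * K ^ n * 2 ^ i * 2 ^ Suc n"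
    using assms by (intro mult_left_mono geo) auto
  also have "\<dots> = C ^ Suc i * K ^ n * 2 ^ (Suc i + n)" by (simp add: power_add)
  finally show ?case .
qed

text \<open>Only exponents up to \<open>n\<close> contribute to order \<open>n\<close>, so growth in
  \<open>i + j\<close> is dominated by a power with exponent \<open>n + n\<close>, again geometric
  in \<open>n\<close>; the number of terms costs further factors 2.\<close>

lemma conv1_subst2:
  assumes "\<eta> \<in> conv2" and "fst p \<in> conv1" and "snd p \<in> conv1"
  shows "subst2 \<eta> p \<in> conv1"
proof -
  obtain A L where A: "A \<ge> 1" "L \<ge> 1" "\<And>i j. norm (\<eta> $ i $ j) \<le> A * L ^ (i + j)"
    using assms(1) unfolding conv2_iff_bound by blast
  obtain C1 K1 where 1: "C1 \<ge> 1" "K1 \<ge> 1" "\<And>n. norm (fst p $ n) \<le> C1 * K1 ^ n"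
    using assms(2) unfolding conv1_iff_bound by blast
  obtain C2 K2 where 2: "C2 \<ge> 1" "K2 \<ge> 1" "\<And>n. norm (snd p $ n) \<le> C2 * K2 ^ n"
    using assms(3) unfolding conv1_iff_bound by blast
  define C K where "C = max C1 C2" and "K = max K1 K2"
  have CK: "C \<ge> 1" "K \<ge> 1" using 1 by (auto simp: C_def K_def)
  have "C1 * K1 ^ n \<le> C * K ^ n" "C2 * K2 ^ n \<le> C * K ^ n" for n
    unfolding C_def K_def using 1 2 by (intro mult_mono power_mono; simp)+
  then have p: "norm (fst p $ n) \<le> C * K ^ n" "norm (snd p $ n) \<le> C * K ^ n" for n
    using 1(3) 2(3) order_trans by blast+
  have pw: "norm ((fst p ^ i * snd p ^ j) $ n) \<le> (2 * C) ^ (i + j) * (4 * K) ^ n" for i j n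
  proof -
    have "(fst p ^ i * snd p ^ j) $ n = (\<Sum>a\<le>n. (fst p ^ i) $ a * (snd p ^ j) $ (n - a))"
      by (simp add: fps_mult_nth atLeast0AtMost)
    also have "norm \<dots> \<le> (\<Sum>a\<le>n. (2 * C) ^ (i + j) * (2 * K) ^ n)"
    proof (intro order_trans[OF norm_sum] sum_mono)
      fix a assume a: "a \<in> {..n}"
      have "norm ((fst p ^ i) $ a * (snd p ^ j) $ (n - a)) \<le>
          (C ^ i * K ^ a * 2 ^ (i + a)) * (C ^ j * K ^ (n - a) * 2 ^ (j + (n - a)))"
        unfolding norm_mult using CK p by (intro mult_mono conv1_power_bound) auto
      also have "\<dots> = (2 * C) ^ (i + j) * (2 * K) ^ (a + (n - a))"
        by (simp only: power_add power_mult_distrib mult_ac)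
      also have "a + (n - a) = n" using a by simp
      finally show "norm ((fst p ^ i) $ a * (snd p ^ j) $ (n - a)) \<le> (2 * C) ^ (i + j) * (2 * K) ^ n" .
    qed
    also have "\<dots> = real (Suc n) * ((2 * C) ^ (i + j) * (2 * K) ^ n)" by simp
    also have "\<dots> \<le> 2 ^ n * ((2 * C) ^ (i + j) * (2 * K) ^ n)"
      using CK by (intro mult_right_mono Suc_le_two_power) auto
    also have "\<dots> = (2 * C) ^ (i + j) * (2 * (2 * K)) ^ n" by (simp only: power_mult_distrib mult_ac)
    finally show ?thesis by simp
  qed
  define Q where "Q = 2 * L * C"
  have Q: "Q \<ge> 1" using A CK mult_mono[of 1 "2 * L" 1 C] by (simp add: Q_def)
  have bound: "norm (subst2 \<eta> p $ n) \<le> A * (2 * 2 * (Q * Q) * (4 * K)) ^ n" for n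
  proof -
    have "norm (subst2 \<eta> p $ n) \<le> (\<Sum>i\<le>n. \<Sum>j\<le>n. A * (Q ^ (n + n) * (4 * K) ^ n))"
      unfolding subst2_def fps_nth_Abs_fps
    proof (intro order_trans[OF norm_sum] sum_mono)
      fix i j assume ij: "i \<in> {..n}" "j \<in> {..n}"
      have "norm (\<eta> $ i $ j * (fst p ^ i * snd p ^ j) $ n) \<le> (A * L ^ (i + j)) * ((2 * C) ^ (i + j) * (4 * K) ^ n)"
        unfolding norm_mult using A CK by (intro mult_mono A pw) auto
      also have "\<dots> = A * (Q ^ (i + j) * (4 * K) ^ n)"
        unfolding Q_def by (simp only: power_mult_distrib mult_ac)
      also have "\<dots> \<le> A * (Q ^ (n + n) * (4 * K) ^ n)"
        using A CK Q ij by (intro mult_left_mono mult_right_mono power_increasing) auto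
      finally show "norm (\<eta> $ i $ j * (fst p ^ i * snd p ^ j) $ n) \<le> A * (Q ^ (n + n) * (4 * K) ^ n)" .
    qed
    also have "\<dots> = real (Suc n) * real (Suc n) * (A * (Q ^ (n + n) * (4 * K) ^ n))"
      by simp
    also have "\<dots> \<le> 2 ^ n * 2 ^ n * (A * (Q ^ (n + n) * (4 * K) ^ n))"
      using A CK Q by (intro mult_mono Suc_le_two_power) auto
    also have "\<dots> = A * (2 * 2 * (Q * Q) * (4 * K)) ^ n"
      by (simp only: power_mult_distrib power_add mult_ac)
    finally show ?thesis .
  qed
  have "Q * Q \<ge> 1" using Q by (metis mult_mono' mult_1 zero_le_one)
  then have "2 * 2 * (Q * Q) * (4 * K) \<ge> 1"
    using CK mult_mono[of 1 "2 * 2 * (Q * Q)" 1 "4 * K"] by simp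
  with bound A(1) show ?thesis unfolding conv1_iff_bound by blast
qed

section \<open>The conductor of a bigerm\<close>

definition swap2 :: "series2 \<Rightarrow> series2" where
  "swap2 \<eta> = Abs_fps (\<lambda>i. Abs_fps (\<lambda>j. \<eta> $ j $ i))"

lemma swap2_nth [simp]: "swap2 \<eta> $ i $ j = \<eta> $ j $ i"
  by (simp add: swap2_def)

lemma subst2_swap2: "subst2 (swap2 \<eta>) p = subst2 \<eta> (snd p, fst p)"
  unfolding subst2_def by (rule fps_ext) (simp add: mult.commute, rule sum.swap)

lemma conv2_swap2 [intro]: "\<eta> \<in> conv2 \<Longrightarrow> swap2 \<eta> \<in> conv2"
  unfolding conv2_iff_bound swap2_nth by (metis add.commute)

definition of_x :: "complex fps \<Rightarrow> series2" where
  "of_x f = Abs_fps (\<lambda>i. fps_const (f $ i))"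

lemma of_x_nth: "of_x f $ i $ j = (if j = 0 then f $ i else 0)"
  by (simp add: of_x_def)

lemma conv2_of_x [intro]:
  assumes "f \<in> conv1"
  shows "of_x f \<in> conv2"
proof -
  obtain C K where C: "C \<ge> 1" "K \<ge> 1" "\<And>n. norm (f $ n) \<le> C * K ^ n"
    using assms unfolding conv1_iff_bound by blast
  show ?thesis
  proof (rule conv2I[where C = C and K = K])
    fix i j show "norm (of_x f $ i $ j) \<le> C * K ^ (i + j)"
      using C(1,2) C(3)[of i] by (auto simp: of_x_nth)
  qed
qed

lemma subst2_of_x:
  assumes "centred p"
  shows "subst2 (of_x f) p = f oo fst p"
proof (rule fps_ext)
  fix n
  have "subst2 (of_x f) p $ n = (\<Sum>i\<le>n. \<Sum>j\<in>{0}. f $ i * (fst p ^ i * snd p ^ j) $ n)"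
    unfolding subst2_def fps_nth_Abs_fps
    by (intro sum.cong refl sum.mono_neutral_cong_right) (auto simp: of_x_nth split: if_splits)
  then show "subst2 (of_x f) p $ n = (f oo fst p) $ n"
    by (simp add: fps_compose_nth atLeast0AtMost)
qed

section \<open>Rotations of the parameter and roots of unity\<close>

definition rot :: "complex \<Rightarrow> complex fps \<Rightarrow> complex fps" where
  "rot \<zeta> f = f oo (fps_const \<zeta> * fps_X)"

text \<open>Here the first variable stands for the parameter of a branch rather than for the
  coordinate \<open>x\<close>; these rotations permute the conjugates of the branch.\<close>

definition rot_x :: "complex \<Rightarrow> series2 \<Rightarrow> series2" where
  "rot_x \<zeta> \<eta> = \<eta> oo (fps_const (fps_const \<zeta>) * fps_X)"

lemma rot_nth [simp]: "rot \<zeta> f $ n = \<zeta> ^ n * f $ n"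
  by (simp add: rot_def)

lemma rot_x_nth [simp]: "rot_x \<zeta> \<eta> $ n = fps_const (\<zeta> ^ n) * \<eta> $ n"
  by (simp add: rot_x_def fps_const_power)

lemma rot_rot: "rot a (rot b f) = rot (a * b) f"
  by (rule fps_ext) (simp add: power_mult_distrib)

lemma rot_1 [simp]: "rot 1 f = f"
  by (rule fps_ext) simp

lemma conv1_rot [intro]:
  assumes "f \<in> conv1" and "norm \<zeta> = 1"
  shows "rot \<zeta> f \<in> conv1"
  using assms by (simp add: conv1_iff_bound norm_mult norm_power)

lemma rot_x_of_x: "rot_x \<zeta> (of_x f) = of_x (rot \<zeta> f)"
  by (intro fps_ext) (simp add: of_x_nth)

lemma rot_x_var_y: "rot_x \<zeta> var_y = var_y"
  by (intro fps_ext) (simp add: var_y_nth)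

lemma rot_x_mult: "rot_x \<zeta> (\<eta> * \<theta>) = rot_x \<zeta> \<eta> * rot_x \<zeta> \<theta>"
  by (simp add: rot_x_def fps_compose_mult_distrib)

lemma rot_x_diff: "rot_x \<zeta> (\<eta> - \<theta>) = rot_x \<zeta> \<eta> - rot_x \<zeta> \<theta>"
  by (simp add: rot_x_def fps_compose_sub_distrib)

lemma rot_x_sum: "rot_x \<zeta> (sum f A) = (\<Sum>a\<in>A. rot_x \<zeta> (f a))"
  by (simp add: rot_x_def fps_compose_sum_distrib)

lemma rot_x_prod: "rot_x \<zeta> (prod f A) = (\<Prod>a\<in>A. rot_x \<zeta> (f a))"
  by (simp add: rot_x_def fps_compose_prod_distrib)

definition roots1 :: "nat \<Rightarrow> complex set" where
  "roots1 m = {z. z ^ m = 1}"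

lemma finite_roots1 [simp]: "m \<ge> 1 \<Longrightarrow> finite (roots1 m)"
  unfolding roots1_def by (rule finite_roots_unity)

lemma one_in_roots1 [simp]: "1 \<in> roots1 m"
  by (simp add: roots1_def)

lemma norm_roots1:
  assumes "m \<ge> 1" and "z \<in> roots1 m"
  shows "norm z = 1"
proof (rule power_eq_imp_eq_base)
  show "norm z ^ m = 1 ^ m" using assms by (simp add: roots1_def flip: norm_power)
qed (use assms in auto)

lemma bij_betw_roots1:
  assumes "m \<ge> 1" and "\<zeta> \<in> roots1 m"
  shows "bij_betw ((*) \<zeta>) (roots1 m) (roots1 m)"
proof -
  have \<zeta>: "\<zeta> \<noteq> 0" "\<zeta> ^ m = 1" using assms by (auto simp: roots1_def power_0_left)
  show ?thesis
    by (rule bij_betw_byWitness[where f' = "(*) (inverse \<zeta>)"])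
      (use \<zeta> in \<open>auto simp: roots1_def power_mult_distrib power_inverse\<close>)
qed

lemma primitive_root1:
  assumes "m \<ge> 1"
  obtains \<zeta> where "\<zeta> \<in> roots1 m" and "\<And>i. \<zeta> ^ i = 1 \<Longrightarrow> m dvd i"
proof -
  define \<zeta> where "\<zeta> = exp (2 * of_real pi * \<i> * of_nat 1 / of_nat m)"
  have pw: "\<zeta> ^ i = exp (2 * of_real pi * \<i> * of_nat i / of_nat m)" for i
    unfolding \<zeta>_def exp_of_nat_mult[symmetric] by (simp add: mult_ac)
  show ?thesis
  proof (rule that)
    show "\<zeta> \<in> roots1 m" unfolding roots1_def \<zeta>_def using complex_root_unity[of m 1] assms by simp
    show "m dvd i" if "\<zeta> ^ i = 1" for i
      using that complex_root_unity_eq_1[of m i] assms unfolding pw by simp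
  qed
qed

text \<open>Undoes the substitution of \<open>x ^ m\<close> for \<open>x\<close>.\<close>

definition contract :: "nat \<Rightarrow> series2 \<Rightarrow> series2" where
  "contract m \<eta> = Abs_fps (\<lambda>i. \<eta> $ (m * i))"

lemma conv2_contract [intro]:
  assumes "\<eta> \<in> conv2" and "m \<ge> 1"
  shows "contract m \<eta> \<in> conv2"
proof -
  obtain C K where C: "C \<ge> 1" "K \<ge> 1" "\<And>i j. norm (\<eta> $ i $ j) \<le> C * K ^ (i + j)"
    using assms unfolding conv2_iff_bound by blast
  show ?thesis
  proof (rule conv2I[where C = C and K = "K ^ m"])
    fix i j
    have "norm (contract m \<eta> $ i $ j) \<le> C * K ^ (m * i + j)" using C(3) by (simp add: contract_def)
    also have "\<dots> \<le> C * K ^ (m * (i + j))"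
      using C assms(2) by (intro mult_left_mono power_increasing) (auto simp: algebra_simps)
    finally show "norm (contract m \<eta> $ i $ j) \<le> C * (K ^ m) ^ (i + j)" by (simp add: power_mult)
  qed
qed

text \<open>Invariance under a primitive \<open>m\<close>-th root of unity confines the support to
  exponents of the first variable divisible by \<open>m\<close>, so the series really is one in the
  \<open>m\<close>-th power of that variable.\<close>

lemma subst2_contract:
  assumes m: "m \<ge> 1" and inv: "\<And>\<zeta>. \<zeta> \<in> roots1 m \<Longrightarrow> rot_x \<zeta> \<eta> = \<eta>" and "centred (f, z)"
  shows "subst2 (contract m \<eta>) (f ^ m, z) = subst2 \<eta> (f, z)"
proof (rule fps_ext)
  fix n
  obtain \<zeta> where \<zeta>: "\<zeta> \<in> roots1 m" "\<And>i. \<zeta> ^ i = 1 \<Longrightarrow> m dvd i" using primitive_root1[OF m] by blast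
  have supp: "\<eta> $ i $ j = 0" if "\<not> m dvd i" for i j
  proof -
    have "rot_x \<zeta> \<eta> $ i $ j = \<eta> $ i $ j" using inv[OF \<zeta>(1)] by simp
    then have "(\<zeta> ^ i - 1) * \<eta> $ i $ j = 0" by (simp add: algebra_simps)
    moreover have "\<zeta> ^ i \<noteq> 1" using \<zeta>(2) that by blast
    ultimately show ?thesis by simp
  qed
  have c: "centred (f ^ m, z)" using assms m by (auto simp: centred_def power_0_left)
  have "subst2 \<eta> (f, z) $ n = (\<Sum>i\<le>m * n. \<Sum>j\<le>n. \<eta> $ i $ j * (f ^ i * z ^ j) $ n)"
    using subst2_nth_eq[OF assms(3), of n "m * n" n] m by simp
  also have "\<dots> = (\<Sum>i\<in>(*) m ` {..n}. \<Sum>j\<le>n. \<eta> $ i $ j * (f ^ i * z ^ j) $ n)"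
  proof (rule sum.mono_neutral_right)
    show "\<forall>i\<in>{..m * n} - (*) m ` {..n}. (\<Sum>j\<le>n. \<eta> $ i $ j * (f ^ i * z ^ j) $ n) = 0"
    proof
      fix i assume i: "i \<in> {..m * n} - (*) m ` {..n}"
      have "\<not> m dvd i"
      proof
        assume "m dvd i"
        then obtain k where "i = m * k" by (auto simp: dvd_def)
        then show False using i m by auto
      qed
      then show "(\<Sum>j\<le>n. \<eta> $ i $ j * (f ^ i * z ^ j) $ n) = 0" by (simp add: supp)
    qed
  qed auto
  also have "\<dots> = (\<Sum>i\<le>n. \<Sum>j\<le>n. \<eta> $ (m * i) $ j * (f ^ (m * i) * z ^ j) $ n)"
    using m by (subst sum.reindex) (auto simp: inj_on_def)
  also have "\<dots> = subst2 (contract m \<eta>) (f ^ m, z) $ n"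
    by (simp add: subst2_def contract_def power_mult)
  finally show "subst2 (contract m \<eta>) (f ^ m, z) $ n = subst2 \<eta> (f, z) $ n" ..
qed

section \<open>Product and interpolation over the conjugates of a branch\<close>

definition branch_product :: "nat \<Rightarrow> complex fps \<Rightarrow> series2" where
  "branch_product m y = (\<Prod>z\<in>roots1 m. var_y - of_x (rot z y))"

text \<open>The Lagrange interpolation polynomial in \<open>y\<close> with values \<open>q\<close> times the different at the
  conjugates of the branch.\<close>

definition branch_interpolation :: "nat \<Rightarrow> complex fps \<Rightarrow> complex fps \<Rightarrow> series2" where
  "branch_interpolation m y q =
     (\<Sum>z\<in>roots1 m. of_x (rot z q) * (\<Prod>v\<in>roots1 m - {z}. var_y - of_x (rot v y)))"

text \<open>The derivative of the branch product with respect to \<open>y\<close>, evaluated on the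
  branch itself. The interpolation is written without denominators, so this factor remains in its
  values.\<close>

definition branch_different :: "nat \<Rightarrow> complex fps \<Rightarrow> complex fps" where
  "branch_different m y = (\<Prod>z\<in>roots1 m - {1}. y - rot z y)"

lemma rot_x_branch_product:
  assumes "m \<ge> 1" and "\<zeta> \<in> roots1 m"
  shows "rot_x \<zeta> (branch_product m y) = branch_product m y"
proof -
  have "rot_x \<zeta> (branch_product m y) = (\<Prod>z\<in>roots1 m. var_y - of_x (rot (\<zeta> * z) y))"
    by (simp add: branch_product_def rot_x_prod rot_x_diff rot_x_of_x rot_x_var_y rot_rot)
  also have "\<dots> = branch_product m y"
    unfolding branch_product_def by (rule prod.reindex_bij_betw[OF bij_betw_roots1[OF assms]])
  finally show ?thesis .
qed

lemma rot_x_branch_interpolation: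
  assumes "m \<ge> 1" and "\<zeta> \<in> roots1 m"
  shows "rot_x \<zeta> (branch_interpolation m y q) = branch_interpolation m y q"
proof -
  have bij: "bij_betw ((*) \<zeta>) (roots1 m - {z}) (roots1 m - {\<zeta> * z})" if "z \<in> roots1 m" for z
  proof -
    have inj: "inj_on ((*) \<zeta>) (roots1 m)" and im: "(*) \<zeta> ` roots1 m = roots1 m"
      using bij_betw_roots1[OF assms] by (auto simp: bij_betw_def)
    have "(*) \<zeta> ` (roots1 m - {z}) = roots1 m - {\<zeta> * z}"
      using inj_on_image_set_diff[OF inj, of "roots1 m" "{z}"] that im by simp
    then show ?thesis using inj by (auto simp: bij_betw_def intro: inj_on_subset)
  qed
  have "rot_x \<zeta> (branch_interpolation m y q) =
     (\<Sum>z\<in>roots1 m. of_x (rot (\<zeta> * z) q) * (\<Prod>v\<in>roots1 m - {z}. var_y - of_x (rot (\<zeta> * v) y)))"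
    by (simp add: branch_interpolation_def rot_x_sum rot_x_mult rot_x_prod rot_x_diff rot_x_of_x
        rot_x_var_y rot_rot)
  also have "\<dots> = (\<Sum>z\<in>roots1 m. of_x (rot (\<zeta> * z) q) * (\<Prod>v\<in>roots1 m - {\<zeta> * z}. var_y - of_x (rot v y)))"
    by (intro sum.cong refl arg_cong2[where f = "(*)"] prod.reindex_bij_betw bij)
  also have "\<dots> = branch_interpolation m y q"
    unfolding branch_interpolation_def
    by (rule sum.reindex_bij_betw[OF bij_betw_roots1[OF assms]])
  finally show ?thesis .
qed

lemma conv2_branch_product:
  assumes "m \<ge> 1" and "y \<in> conv1"
  shows "branch_product m y \<in> conv2"
  unfolding branch_product_def using assms norm_roots1[OF assms(1)]
  by (auto intro!: conv2_prod conv2_diff conv2_of_x conv1_rot)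

lemma conv2_branch_interpolation:
  assumes "m \<ge> 1" and "y \<in> conv1" and "q \<in> conv1"
  shows "branch_interpolation m y q \<in> conv2"
  unfolding branch_interpolation_def using assms norm_roots1[OF assms(1)]
  by (auto intro!: conv2_sum conv2_mult conv2_prod conv2_diff conv2_of_x conv1_rot)

text \<open>Every summand other than that of \<open>z = 1\<close> contains the factor
  \<open>y - rot 1 y\<close>, which is 0.\<close>

lemma subst2_branch_interpolation:
  assumes "m \<ge> 1" and "y $ 0 = 0"
  shows "subst2 (branch_interpolation m y q) (fps_X, y) = q * branch_different m y"
proof -
  have c: "centred (fps_X, y)" using assms by (simp add: centred_def)
  have "subst2 (branch_interpolation m y q) (fps_X, y) =
     (\<Sum>z\<in>roots1 m. rot z q * (\<Prod>v\<in>roots1 m - {z}. y - rot v y))"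
    by (simp add: branch_interpolation_def subst2_sum subst2_mult[OF c] subst2_prod[OF c] subst2_diff
        subst2_var_y[OF c] subst2_of_x[OF c])
  also have "\<dots> = (\<Sum>z\<in>{1}. rot z q * (\<Prod>v\<in>roots1 m - {z}. y - rot v y))"
  proof (rule sum.mono_neutral_right)
    show "\<forall>z\<in>roots1 m - {1}. rot z q * (\<Prod>v\<in>roots1 m - {z}. y - rot v y) = 0"
      using assms by (auto intro!: bexI[of _ 1])
  qed (use assms in auto)
  finally show ?thesis by (simp add: branch_different_def)
qed

lemma subst2_branch_product:
  assumes "m \<ge> 1" and "centred (c, v)"
  shows "subst2 (branch_product m y) (c, v) = (\<Prod>z\<in>roots1 m. v - (rot z y oo c))"
  by (simp add: branch_product_def subst2_prod[OF assms(2)] subst2_diff subst2_var_y[OF assms(2)]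
      subst2_of_x[OF assms(2)])

section \<open>Equations of branches in either orientation and the separation of distinct
  branches\<close>

definition orient :: "bool \<Rightarrow> series2 \<Rightarrow> series2" where
  "orient s \<eta> = (if s then swap2 \<eta> else \<eta>)"

definition orient_param :: "bool \<Rightarrow> param \<Rightarrow> param" where
  "orient_param s p = (if s then (snd p, fst p) else p)"

lemma subst2_orient: "subst2 (orient s \<eta>) p = subst2 \<eta> (orient_param s p)"
  by (simp add: orient_def orient_param_def subst2_swap2)

lemma conv2_orient [intro]: "\<eta> \<in> conv2 \<Longrightarrow> orient s \<eta> \<in> conv2"
  by (auto simp: orient_def)

lemma orient_puiseux: "orient_param s (puiseux s m y) = (fps_X ^ m, y)"
  by (simp add: orient_param_def puiseux_def)

definition branch_equation :: "bool \<Rightarrow> nat \<Rightarrow> complex fps \<Rightarrow> series2" where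
  "branch_equation s m y = orient s (contract m (branch_product m y))"

lemma conv2_branch_equation [intro]:
  assumes "m \<ge> 1" and "y \<in> conv1"
  shows "branch_equation s m y \<in> conv2"
  unfolding branch_equation_def using assms conv2_branch_product by blast

lemma subst2_branch_equation:
  assumes "m \<ge> 1" and "y $ 0 = 0"
  shows "subst2 (branch_equation s m y) (puiseux s m y) = 0"
proof -
  have c: "centred (fps_X, y)" using assms by (simp add: centred_def)
  have "subst2 (branch_equation s m y) (puiseux s m y) = subst2 (contract m (branch_product m y)) (fps_X ^ m, y)"
    by (simp only: branch_equation_def subst2_orient orient_puiseux)
  also have "\<dots> = subst2 (branch_product m y) (fps_X, y)"
    by (rule subst2_contract[OF assms(1) rot_x_branch_product[OF assms(1)] c])
  also have "\<dots> = (\<Prod>z\<in>roots1 m. y - (rot z y oo fps_X))" by (rule subst2_branch_product[OF assms(1) c])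
  also have "\<dots> = 0" using assms by (auto intro!: bexI[of _ 1])
  finally show ?thesis .
qed

lemma root_of_composed_power:
  fixes u :: "complex fps"
  assumes "m \<ge> 1" and "u $ 0 = 0"
  shows "\<exists>c. c $ 0 = 0 \<and> c ^ m = u oo fps_X ^ m"
proof (cases "u = 0")
  case True
  then show ?thesis using assms by (intro exI[of _ 0]) (simp add: power_0_left)
next
  case False
  define n where "n = subdegree u"
  define U where "U = fps_shift n u"
  have u: "u = fps_X ^ n * U" unfolding U_def n_def by (metis subdegree_decompose mult.commute)
  have U0: "U $ 0 \<noteq> 0" using False by (simp add: U_def n_def)
  have n: "n \<ge> 1" using False assms(2) unfolding n_def
    by (metis One_nat_def Suc_leI neq0_conv nth_subdegree_nonzero)
  have X0: "(fps_X ^ m :: complex fps) $ 0 = 0" using assms(1) by (simp add: power_0_left)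
  have "m \<noteq> 0" using assms(1) by simp
  then obtain r where "U $ 0 = r ^ m" by (rule exists_complex_root)
  then have r: "r ^ m = U $ 0" by (rule sym)
  obtain R where R: "R ^ m = U" using fps_root_exists[OF U0 assms(1) r] by blast
  have "(R oo fps_X ^ m) ^ m = U oo fps_X ^ m" unfolding R[symmetric] using X0 by (simp add: fps_compose_power)
  moreover have "(fps_X ^ n) ^ m = (fps_X ^ m :: complex fps) ^ n" by (metis power_mult mult.commute)
  ultimately have "(fps_X ^ n * (R oo fps_X ^ m)) ^ m = u oo fps_X ^ m"
    using X0 by (simp only: u fps_compose_mult_distrib fps_X_power_compose power_mult_distrib)
  moreover have "(fps_X ^ n * (R oo fps_X ^ m)) $ 0 = 0" using n by (simp add: power_0_left)
  ultimately show ?thesis by blast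
qed

text \<open>The substitution of \<open>t ^ m\<close> is needed for the main coordinate to acquire an \<open>m\<close>-th root,
  which then serves as parameter of the branch.\<close>

lemma branch_equation_vanishes:
  assumes m: "m \<ge> 1" and "y $ 0 = 0" and p: "centred p"
    and "subst2 (branch_equation s m y) p = 0"
  obtains c where "c $ 0 = 0" and "param_compose p (fps_X ^ m) = param_compose (puiseux s m y) c"
proof -
  obtain u v where uv: "orient_param s p = (u, v)" by (cases "orient_param s p")
  have uv0: "u $ 0 = 0" "v $ 0 = 0" using p uv by (auto simp: orient_param_def centred_def split: if_splits)
  have X0: "(fps_X ^ m :: complex fps) $ 0 = 0" using m by (simp add: power_0_left)
  obtain c where c: "c $ 0 = 0" "c ^ m = u oo fps_X ^ m" using root_of_composed_power[OF m uv0(1)] by blast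
  have cc: "centred (c, v oo fps_X ^ m)" using c uv0 by (simp add: centred_def)
  have cuv: "centred (u, v)" using uv0 by (simp add: centred_def)
  have "0 = subst2 (contract m (branch_product m y)) (u, v) oo fps_X ^ m"
    using assms(4) by (simp add: branch_equation_def subst2_orient uv)
  also have "\<dots> = subst2 (contract m (branch_product m y)) (c ^ m, v oo fps_X ^ m)"
    using subst2_compose[OF cuv X0] c by simp
  also have "\<dots> = (\<Prod>z\<in>roots1 m. (v oo fps_X ^ m) - (rot z y oo c))"
    using subst2_contract[OF m rot_x_branch_product[OF m] cc] subst2_branch_product[OF m cc] by simp
  finally have "(\<Prod>z\<in>roots1 m. (v oo fps_X ^ m) - (rot z y oo c)) = 0" by (rule sym)
  then obtain z where z: "z \<in> roots1 m" "v oo fps_X ^ m = rot z y oo c"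
    unfolding prod_zero_iff[OF finite_roots1[OF m]] by auto
  \<comment> \<open>The conjugating root of unity is absorbed into the parameter; the main
    coordinate does not notice it because \<open>z ^ m = 1\<close>.\<close>
  define d where "d = fps_const z * c"
  have d0: "d $ 0 = 0" using c by (simp add: d_def)
  have zc: "fps_const z * fps_X oo c = d" using c by (simp add: d_def fps_compose_mult_distrib)
  have "v oo fps_X ^ m = y oo d"
    unfolding z(2) rot_def using fps_compose_assoc[of c "fps_const z * fps_X" y] c zc by simp
  moreover have "u oo fps_X ^ m = fps_X ^ m oo d"
    using z(1) c d0 by (simp add: fps_X_power_compose d_def power_mult_distrib fps_const_power roots1_def)
  ultimately have "param_compose p (fps_X ^ m) = param_compose (puiseux s m y) d"
    using uv by (auto simp: param_compose_def puiseux_def orient_param_def split: if_splits)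
  with d0 show ?thesis using that by blast
qed

lemma map_germ_iff: "map_germ p \<longleftrightarrow> fst p \<in> conv1 \<and> snd p \<in> conv1 \<and> centred p"
  by (auto simp: map_germ_def centred_def)

lemma fps_compose_X_power_nth:
  assumes "d \<ge> 1"
  shows "(f oo fps_X ^ d :: complex fps) $ n = (if d dvd n then f $ (n div d) else 0)"
proof -
  have "(f oo fps_X ^ d) $ n = (\<Sum>i=0..n. f $ i * (if n = d * i then 1 else 0))"
    by (simp add: fps_compose_nth flip: power_mult)
  also have "\<dots> = (if d dvd n then f $ (n div d) else 0)"
  proof (cases "d dvd n")
    case True
    then have "(\<Sum>i=0..n. f $ i * (if n = d * i then 1 else 0)) = (\<Sum>i\<in>{n div d}. f $ i)"
      using assms by (intro sum.mono_neutral_cong_right) (auto split: if_splits)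
    with True show ?thesis by simp
  next
    case False
    then have "n \<noteq> d * i" for i by auto
    with False show ?thesis by simp
  qed
  finally show ?thesis .
qed

text \<open>If a nontrivial rotation fixed \<open>y\<close>, both coordinates would be series in
  \<open>t ^ d\<close> with \<open>d\<close> the multiplicative order of \<open>z\<close>, and the
  parametrization would factor through a map of order at least 2.\<close>

lemma conjugates_distinct:
  assumes p: "branch_param (puiseux s m y)" and m: "m \<ge> 1" and y: "fps_X ^ Suc m dvd y"
    and z: "z \<in> roots1 m" "z \<noteq> 1"
  shows "rot z y \<noteq> y"
proof
  assume inv: "rot z y = y"
  define d where "d = (LEAST d. d > 0 \<and> z ^ d = 1)"
  have ex: "\<exists>d. d > 0 \<and> z ^ d = 1" using z m by (intro exI[of _ m]) (auto simp: roots1_def)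
  have d: "d > 0" "z ^ d = 1" using LeastI_ex[OF ex] by (auto simp: d_def)
  have "d \<noteq> 1" using d z by auto
  then have d2: "d \<ge> 2" using d by simp
  have dvd: "d dvd n" if "z ^ n = 1" for n
  proof (rule ccontr)
    assume "\<not> d dvd n"
    then have "n mod d > 0" by (simp add: mod_greater_zero_iff_not_dvd)
    moreover have "z ^ (n mod d) = 1"
    proof -
      have "z ^ n = (z ^ d) ^ (n div d) * z ^ (n mod d)"
        by (simp flip: power_mult power_add)
      then show ?thesis using d that by simp
    qed
    ultimately have "d \<le> n mod d" unfolding d_def by (intro Least_le) auto
    then show False using d by (meson mod_less_divisor not_le)
  qed
  have dm: "d dvd m" using dvd z by (auto simp: roots1_def)
  have supp: "d dvd n" if "y $ n \<noteq> 0" for n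
  proof -
    have "z ^ n * y $ n = y $ n" using inv by (metis rot_nth)
    then show ?thesis using that dvd by simp
  qed
  define y' where "y' = Abs_fps (\<lambda>n. y $ (d * n))"
  have yc: "y = y' oo fps_X ^ d"
    by (rule fps_ext) (use d supp in \<open>auto simp: fps_compose_X_power_nth y'_def\<close>)
  have mc: "fps_X ^ m = (fps_X ^ (m div d) oo fps_X ^ d :: complex fps)"
    using d dm by (simp add: fps_X_power_compose flip: power_mult)
  have "y \<in> conv1" using p by (auto simp: branch_param_def map_germ_def puiseux_def split: if_splits)
  then obtain C K where C: "C \<ge> 1" "K \<ge> 1" "\<And>n. norm (y $ n) \<le> C * K ^ n"
    unfolding conv1_iff_bound by blast
  have "norm (y' $ n) \<le> C * (K ^ d) ^ n" for n using C(3)[of "d * n"] by (simp add: y'_def power_mult)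
  moreover have "K ^ d \<ge> 1" using C by simp
  ultimately have y'c: "y' \<in> conv1" using C unfolding conv1_iff_bound by blast
  have "m div d \<ge> 1" using dm m by (auto simp: dvd_def)
  moreover have "y' $ 0 = 0" using y by (simp add: y'_def fps_X_power_dvd_iff del: power_Suc)
  ultimately have "map_germ (puiseux s (m div d) y')"
    using y'c by (auto simp: map_germ_def puiseux_def power_0_left)
  moreover have "puiseux s m y = (fst (puiseux s (m div d) y') oo fps_X ^ d, snd (puiseux s (m div d) y') oo fps_X ^ d)"
    using yc mc by (simp add: puiseux_def)
  moreover have "fps_ord (fps_X ^ d) \<ge> 2"
    using d2 fps_ord_dvd_iff[of 2 "fps_X ^ d"] by (simp add: le_imp_power_dvd numeral_eq_enat)
  ultimately show False
    using p unfolding branch_param_def by (metis conv1_basic(4) conv1_power)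
qed

lemma branch_different_nonzero:
  assumes "branch_param (puiseux s m y)" and "m \<ge> 1" and "fps_X ^ Suc m dvd y"
  shows "branch_different m y \<noteq> 0"
proof -
  have "\<forall>z\<in>roots1 m - {1}. y - rot z y \<noteq> 0"
    using conjugates_distinct[OF assms] by fastforce
  then show ?thesis
    unfolding branch_different_def using assms(2) by (simp add: prod_zero_iff)
qed

lemma branch_equation_vanishes_puiseux:
  assumes m1: "m1 \<ge> 1" and y1: "fps_X ^ Suc m1 dvd y1" and m2: "m2 \<ge> 1" and y2: "fps_X ^ Suc m2 dvd y2"
    and van: "subst2 (branch_equation s2 m2 y2) (puiseux s1 m1 y1) = 0"
  obtains c where "c \<noteq> 0" and "c $ 0 = 0"
    and "\<And>\<eta>. subst2 \<eta> (puiseux s1 m1 y1) oo fps_X ^ m2 = subst2 \<eta> (puiseux s2 m2 y2) oo c"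
proof -
  have c1: "centred (puiseux s1 m1 y1)" and c2: "centred (puiseux s2 m2 y2)" using assms by simp_all
  have y20: "y2 $ 0 = 0" using y2 by (simp add: fps_X_power_dvd_iff del: power_Suc)
  obtain c where c: "c $ 0 = 0"
    and eq: "param_compose (puiseux s1 m1 y1) (fps_X ^ m2) = param_compose (puiseux s2 m2 y2) c"
    using branch_equation_vanishes[OF m2 y20 c1 van] by blast
  have X0: "(fps_X ^ m2 :: complex fps) $ 0 = 0" using m2 by (simp add: power_0_left)
  have "c \<noteq> 0"
  proof
    assume "c = 0"
    then have "param_compose (puiseux s2 m2 y2) c = (0, 0)"
      using c2 by (simp add: param_compose_def centred_def)
    with eq have "fps_X ^ m1 oo fps_X ^ m2 = (0 :: complex fps)"
      by (auto simp: param_compose_def puiseux_def split: if_splits)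
    then show False using X0 by (simp add: fps_X_power_compose)
  qed
  moreover have "subst2 \<eta> (puiseux s1 m1 y1) oo fps_X ^ m2 = subst2 \<eta> (puiseux s2 m2 y2) oo c" for \<eta>
    using subst2_compose[OF c1 X0, of \<eta>] subst2_compose[OF c2 c, of \<eta>] eq
    by (simp add: param_compose_def)
  ultimately show ?thesis using that c by blast
qed

text \<open>Otherwise the two branches agree after nonzero substitutions in their parameters. Such
  substitutions are injective on series, so the two ideals would coincide.\<close>

lemma branch_equation_nonzero:
  assumes m1: "m1 \<ge> 1" and y1: "fps_X ^ Suc m1 dvd y1" and m2: "m2 \<ge> 1" and y2: "fps_X ^ Suc m2 dvd y2"
    and "branch_ideal (puiseux s1 m1 y1) \<noteq> branch_ideal (puiseux s2 m2 y2)"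
  shows "subst2 (branch_equation s2 m2 y2) (puiseux s1 m1 y1) \<noteq> 0"
proof
  assume "subst2 (branch_equation s2 m2 y2) (puiseux s1 m1 y1) = 0"
  then obtain c where c: "c \<noteq> 0" "c $ 0 = 0"
    and eq: "\<And>\<eta>. subst2 \<eta> (puiseux s1 m1 y1) oo fps_X ^ m2 = subst2 \<eta> (puiseux s2 m2 y2) oo c"
    using branch_equation_vanishes_puiseux[OF m1 y1 m2 y2] by blast
  have "(fps_X ^ m2 :: complex fps) $ 0 = 0" using m2 by (simp add: power_0_left)
  then have "subst2 \<eta> (puiseux s1 m1 y1) = 0 \<longleftrightarrow> subst2 \<eta> (puiseux s2 m2 y2) = 0" for \<eta>
    using fps_compose_eq_0_iff[of "fps_X ^ m2" "subst2 \<eta> (puiseux s1 m1 y1)"]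
      fps_compose_eq_0_iff[of c "subst2 \<eta> (puiseux s2 m2 y2)"] eq[of \<eta>] c by simp
  then show False using assms(5) by (simp add: branch_ideal_def)
qed

section \<open>The square of the maximal ideal and prescribed restrictions to the two
  branches\<close>

lemma max_ideal_sq_add:
  assumes "g \<in> max_ideal_sq" and "h \<in> max_ideal_sq"
  shows "g + h \<in> max_ideal_sq"
proof -
  obtain a b c a' b' c' where "g = a * var_x ^ 2 + b * (var_x * var_y) + c * var_y ^ 2"
    "h = a' * var_x ^ 2 + b' * (var_x * var_y) + c' * var_y ^ 2"
    and "a \<in> conv2" "b \<in> conv2" "c \<in> conv2" "a' \<in> conv2" "b' \<in> conv2" "c' \<in> conv2"
    using assms unfolding max_ideal_sq_def by blast
  then have "g + h = (a + a') * var_x ^ 2 + (b + b') * (var_x * var_y) + (c + c') * var_y ^ 2 \<and>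
      a + a' \<in> conv2 \<and> b + b' \<in> conv2 \<and> c + c' \<in> conv2"
    by (auto simp: algebra_simps)
  then show ?thesis unfolding max_ideal_sq_def by blast
qed

lemma max_ideal_sq_conv2: "g \<in> max_ideal_sq \<Longrightarrow> g \<in> conv2"
  unfolding max_ideal_sq_def by (auto intro!: conv2_add conv2_mult conv2_power)

lemma max_ideal_sq_scalar:
  assumes "g \<in> max_ideal_sq"
  shows "scalar2 r * g \<in> max_ideal_sq"
proof -
  obtain a b c where "g = a * var_x ^ 2 + b * (var_x * var_y) + c * var_y ^ 2"
    and "a \<in> conv2" "b \<in> conv2" "c \<in> conv2"
    using assms unfolding max_ideal_sq_def by blast
  then have "scalar2 r * g = (scalar2 r * a) * var_x ^ 2 + (scalar2 r * b) * (var_x * var_y) + (scalar2 r * c) * var_y ^ 2 \<and>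
      scalar2 r * a \<in> conv2 \<and> scalar2 r * b \<in> conv2 \<and> scalar2 r * c \<in> conv2"
    by (auto simp: algebra_simps)
  then show ?thesis unfolding max_ideal_sq_def by blast
qed

lemma square_in_max_ideal_sq:
  assumes "a \<in> conv2"
  shows "a * (if s then var_y else var_x) ^ 2 \<in> max_ideal_sq"
proof -
  have "a * (if s then var_y else var_x) ^ 2 =
      (if s then 0 else a) * var_x ^ 2 + 0 * (var_x * var_y) + (if s then a else 0) * var_y ^ 2"
    by simp
  moreover have "(if s then 0 else a) \<in> conv2" "(if s then a else 0) \<in> conv2" using assms by auto
  ultimately show ?thesis unfolding max_ideal_sq_def using conv2_0_1(1) by blast
qed

lemma max_ideal_sq_jet:
  assumes "g \<in> max_ideal_sq"
  shows "g $ 0 $ 0 = 0" and "g $ 1 $ 0 = 0" and "g $ 0 $ 1 = 0"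
  using assms unfolding max_ideal_sq_def
  by (auto simp only: power2_eq_square fps_add_nth mult_nth_00 mult_nth_10 mult_nth_01 var_x_nth var_y_nth)
     (simp_all add: var_x_nth var_y_nth)

text \<open>\<open>g\<close> is a product of three factors: the equation \<open>F\<close> of the
  second branch makes it vanish there, the interpolation \<open>I\<close> prescribes it on the first
  branch up to the different, and the square of the main coordinate \<open>v\<close> puts it into
  \<open>max_ideal_sq\<close>. The required order is that of the combined factor
  \<open>E\<close>.\<close>

lemma one_sided_conductor:
  assumes bp: "branch_param (puiseux s1 m1 y1)" and m1: "m1 \<ge> 1" and y1: "fps_X ^ Suc m1 dvd y1"
    and m2: "m2 \<ge> 1" and y2: "fps_X ^ Suc m2 dvd y2" "y2 \<in> conv1"
    and ne: "branch_ideal (puiseux s1 m1 y1) \<noteq> branch_ideal (puiseux s2 m2 y2)"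
  shows "\<exists>C. \<forall>h\<in>conv1. fps_X ^ C dvd h \<longrightarrow>
    (\<exists>g\<in>max_ideal_sq. subst2 g (puiseux s1 m1 y1) = h \<and> subst2 g (puiseux s2 m2 y2) = 0)"
proof -
  define p1 p2 where "p1 = puiseux s1 m1 y1" and "p2 = puiseux s2 m2 y2"
  have c1: "centred p1" and c2: "centred p2" using assms by (simp_all add: p1_def p2_def)
  have y10: "y1 $ 0 = 0" "y2 $ 0 = 0" using y1 y2 by (simp_all add: fps_X_power_dvd_iff del: power_Suc)
  have p1c: "fst p1 \<in> conv1" "snd p1 \<in> conv1" and y1c: "y1 \<in> conv1"
    using bp by (auto simp: p1_def branch_param_def map_germ_def puiseux_def split: if_splits)
  define F where "F = branch_equation s2 m2 y2"
  have Fc: "F \<in> conv2" using m2 y2 by (auto simp: F_def)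
  have F2: "subst2 F p2 = 0" unfolding F_def p2_def using m2 y10 by (intro subst2_branch_equation)
  have F1: "subst2 F p1 \<noteq> 0" unfolding F_def p1_def by (rule branch_equation_nonzero[OF m1 y1 m2 y2(1) ne])
  define v where "v = (if s1 then var_y else var_x)"
  have v: "subst2 v p1 = fps_X ^ m1"
    using c1 by (auto simp: v_def p1_def puiseux_def)
  define E where "E = subst2 F p1 * branch_different m1 y1 * (fps_X ^ m1) ^ 2"
  have Dc: "branch_different m1 y1 \<in> conv1"
    unfolding branch_different_def using y1c norm_roots1[OF m1] by (auto intro!: conv1_prod conv1_diff conv1_rot)
  have Ec: "E \<in> conv1" unfolding E_def using Fc p1c Dc by (auto intro!: conv1_mult conv1_power conv1_subst2)
  have E0: "E \<noteq> 0" unfolding E_def using F1 branch_different_nonzero[OF bp m1 y1] by simp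
  show ?thesis
  proof (intro exI[of _ "subdegree E"] ballI impI)
    fix h assume h: "h \<in> conv1" "fps_X ^ subdegree E dvd h"
    obtain q where q: "q \<in> conv1" "h = q * E" using conv1_quotient[OF Ec E0 h] by blast
    define I where "I = orient s1 (contract m1 (branch_interpolation m1 y1 q))"
    have Ic: "I \<in> conv2" unfolding I_def using m1 y1c q conv2_branch_interpolation by blast
    have cX: "centred (fps_X, y1)" using y10 by (simp add: centred_def)
    have "subst2 I p1 = subst2 (contract m1 (branch_interpolation m1 y1 q)) (fps_X ^ m1, y1)"
      unfolding I_def p1_def subst2_orient orient_puiseux ..
    also have "\<dots> = subst2 (branch_interpolation m1 y1 q) (fps_X, y1)"
      by (rule subst2_contract[OF m1 rot_x_branch_interpolation[OF m1] cX])
    also have "\<dots> = q * branch_different m1 y1" by (rule subst2_branch_interpolation[OF m1 y10(1)])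
    finally have I1: "subst2 I p1 = q * branch_different m1 y1" .
    define g where "g = F * I * v ^ 2"
    have "g \<in> max_ideal_sq" unfolding g_def v_def using Fc Ic by (intro square_in_max_ideal_sq) auto
    moreover have "subst2 g p1 = h"
      unfolding g_def q(2) E_def subst2_mult[OF c1] subst2_power[OF c1] I1 v by (simp only: mult_ac)
    moreover have "subst2 g p2 = 0" unfolding g_def subst2_mult[OF c2] F2 by simp
    ultimately show "\<exists>g\<in>max_ideal_sq. subst2 g (puiseux s1 m1 y1) = h \<and> subst2 g (puiseux s2 m2 y2) = 0"
      unfolding p1_def p2_def by blast
  qed
qed

text \<open>The sum of two one-sided solutions. The restrictions are met exactly, and membership in
  \<open>max_ideal_sq\<close> lets \<open>g\<close> serve both as coefficient of a form in
  \<open>Omega\<close> and as a correction that preserves the linear part of a coordinate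
  change.\<close>

lemma conductor_exists:
  assumes m: "m1 \<ge> 1" "m2 \<ge> 1" and y: "fps_X ^ Suc m1 dvd y1" "fps_X ^ Suc m2 dvd y2"
    and big: "is_bigerm (puiseux s1 m1 y1, puiseux s2 m2 y2)"
  shows "\<exists>C. \<forall>h1\<in>conv1. \<forall>h2\<in>conv1. fps_X ^ C dvd h1 \<longrightarrow> fps_X ^ C dvd h2 \<longrightarrow>
    (\<exists>g\<in>max_ideal_sq. subst2 g (puiseux s1 m1 y1) = h1 \<and> subst2 g (puiseux s2 m2 y2) = h2)"
proof -
  have bp: "branch_param (puiseux s1 m1 y1)" "branch_param (puiseux s2 m2 y2)"
    and ne: "branch_ideal (puiseux s1 m1 y1) \<noteq> branch_ideal (puiseux s2 m2 y2)"
    using big by (auto simp: is_bigerm_def)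
  have yc: "y1 \<in> conv1" "y2 \<in> conv1"
    using bp by (auto simp: branch_param_def map_germ_def puiseux_def split: if_splits)
  obtain C1 where C1: "\<And>h. h \<in> conv1 \<Longrightarrow> fps_X ^ C1 dvd h \<Longrightarrow>
    \<exists>g\<in>max_ideal_sq. subst2 g (puiseux s1 m1 y1) = h \<and> subst2 g (puiseux s2 m2 y2) = 0"
    using one_sided_conductor[OF bp(1) m(1) y(1) m(2) y(2) yc(2) ne] by blast
  obtain C2 where C2: "\<And>h. h \<in> conv1 \<Longrightarrow> fps_X ^ C2 dvd h \<Longrightarrow>
    \<exists>g\<in>max_ideal_sq. subst2 g (puiseux s2 m2 y2) = h \<and> subst2 g (puiseux s1 m1 y1) = 0"
    using one_sided_conductor[OF bp(2) m(2) y(2) m(1) y(1) yc(1) ne[symmetric]] by blast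
  show ?thesis
  proof (intro exI[of _ "max C1 C2"] ballI impI)
    fix h1 h2 assume h: "h1 \<in> conv1" "h2 \<in> conv1" "fps_X ^ max C1 C2 dvd h1" "fps_X ^ max C1 C2 dvd h2"
    have "fps_X ^ C1 dvd h1" "fps_X ^ C2 dvd h2"
      by (rule power_le_dvd[OF h(3)], simp, rule power_le_dvd[OF h(4)], simp)
    then obtain g1 g2 where "g1 \<in> max_ideal_sq" "subst2 g1 (puiseux s1 m1 y1) = h1" "subst2 g1 (puiseux s2 m2 y2) = 0"
      "g2 \<in> max_ideal_sq" "subst2 g2 (puiseux s2 m2 y2) = h2" "subst2 g2 (puiseux s1 m1 y1) = 0"
      using C1[OF h(1)] C2[OF h(2)] by blast
    then show "\<exists>g\<in>max_ideal_sq. subst2 g (puiseux s1 m1 y1) = h1 \<and> subst2 g (puiseux s2 m2 y2) = h2"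
      by (intro bexI[of _ "g1 + g2"]) (auto simp: subst2_add max_ideal_sq_add)
  qed
qed

section \<open>Approximate inversion of coordinate changes\<close>

lemma vanishes_to_add: "vanishes_to k a \<Longrightarrow> vanishes_to k b \<Longrightarrow> vanishes_to k (a + b)"
  by (simp add: vanishes_to_def)

lemma vanishes_to_sum: "(\<And>i. i \<in> A \<Longrightarrow> vanishes_to k (f i)) \<Longrightarrow> vanishes_to k (sum f A)"
  unfolding vanishes_to_def fps_sum_nth by (auto intro: sum.neutral)

lemma vanishes_to_mult:
  assumes "vanishes_to k a" and "vanishes_to l b"
  shows "vanishes_to (k + l) (a * b)"
  unfolding vanishes_to_def
proof (intro allI impI)
  fix i j assume ij: "i + j < k + l"
  have "a $ i' $ j' * b $ (i - i') $ (j - j') = 0" if "i' \<le> i" "j' \<le> j" for i' j'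
  proof (cases "i' + j' < k")
    case True
    then show ?thesis using assms(1) by (simp add: vanishes_to_def)
  next
    case False
    then have "(i - i') + (j - j') < l" using ij that by linarith
    then show ?thesis using assms(2) by (simp add: vanishes_to_def)
  qed
  then show "(a * b) $ i $ j = 0"
    unfolding fps_mult_nth fps_sum_nth by (intro sum.neutral ballI) auto
qed

lemma vanishes_to_power: "vanishes_to k a \<Longrightarrow> vanishes_to (k * n) (a ^ n)"
proof (induction n)
  case (Suc n)
  then show ?case using vanishes_to_mult[of k a "k * n" "a ^ n"] by simp
qed (simp add: vanishes_to_def)

lemma vanishes_to_power_diff:
  assumes "vanishes_to 2 (a - b)" and "vanishes_to 1 a" and "vanishes_to 1 b"
  shows "vanishes_to (Suc i) (a ^ i - b ^ i)"
proof (induction i)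
  case 0
  then show ?case by (simp add: vanishes_to_def)
next
  case (Suc i)
  have eq: "a ^ Suc i - b ^ Suc i = a * (a ^ i - b ^ i) + (a - b) * b ^ i"
    by (simp add: algebra_simps)
  have "vanishes_to (1 + Suc i) (a * (a ^ i - b ^ i))" by (intro vanishes_to_mult assms Suc)
  moreover have "vanishes_to (2 + 1 * i) ((a - b) * b ^ i)"
    by (intro vanishes_to_mult vanishes_to_power assms)
  ultimately show ?case unfolding eq by (intro vanishes_to_add) simp_all
qed

lemma vanishes_to_monomial_diff:
  assumes "vanishes_to 2 (a - b)" and "vanishes_to 1 a" and "vanishes_to 1 b"
    and "vanishes_to 2 (c - d)" and "vanishes_to 1 c" and "vanishes_to 1 d"
  shows "vanishes_to (Suc (i + j)) (a ^ i * c ^ j - b ^ i * d ^ j)"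
proof -
  have eq: "a ^ i * c ^ j - b ^ i * d ^ j = (a ^ i - b ^ i) * c ^ j + b ^ i * (c ^ j - d ^ j)"
    by (simp add: algebra_simps)
  have "vanishes_to (Suc i + 1 * j) ((a ^ i - b ^ i) * c ^ j)"
    by (intro vanishes_to_mult vanishes_to_power vanishes_to_power_diff assms)
  moreover have "vanishes_to (1 * i + Suc j) (b ^ i * (c ^ j - d ^ j))"
    by (intro vanishes_to_mult vanishes_to_power vanishes_to_power_diff assms)
  ultimately show ?thesis unfolding eq by (intro vanishes_to_add) simp_all
qed

lemma monomial_nth: "(var_x ^ i * var_y ^ j) $ a $ b = (if a = i \<and> b = j then 1 else 0)"
  by (auto simp: var_x_def var_y_def fps_X_power_mult_nth fps_const_power)

lemma vanishes_to_1_iff: "vanishes_to 1 \<eta> \<longleftrightarrow> \<eta> $ 0 $ 0 = 0"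
  by (simp add: vanishes_to_def)

lemma vanishes_to_2_iff: "vanishes_to 2 \<eta> \<longleftrightarrow> \<eta> $ 0 $ 0 = 0 \<and> \<eta> $ 1 $ 0 = 0 \<and> \<eta> $ 0 $ 1 = 0"
proof -
  have "i + j < 2 \<longleftrightarrow> i = 0 \<and> j = 0 \<or> i = 1 \<and> j = 0 \<or> i = 0 \<and> j = 1" for i j :: nat by linarith
  then show ?thesis unfolding vanishes_to_def by metis
qed

section \<open>Inversion of a coordinate change up to finite order and transport of values\<close>

definition jacobian :: "series2 \<times> series2 \<Rightarrow> complex" where
  "jacobian \<sigma> = fst \<sigma> $ 1 $ 0 * snd \<sigma> $ 0 $ 1 - fst \<sigma> $ 0 $ 1 * snd \<sigma> $ 1 $ 0"

lemma centred_push: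
  assumes "fst \<sigma> $ 0 $ 0 = 0" and "snd \<sigma> $ 0 $ 0 = 0"
  shows "centred (push \<sigma> p)"
  using assms by (simp add: centred_def push_def)

text \<open>The linear part is inverted by Cramer's rule; then the lowest homogeneous part of the
  remainder is replaced, degree by degree, by the same polynomial in the inverted linear coordinates
  \<open>\<alpha>\<close> and \<open>\<beta>\<close>. A congruence suffices, as only orders along
  curves are compared later.\<close>

lemma approximate_inverse:
  assumes \<sigma>: "fst \<sigma> $ 0 $ 0 = 0" "snd \<sigma> $ 0 $ 0 = 0" and det: "jacobian \<sigma> \<noteq> 0"
  shows "\<exists>\<eta>'. \<forall>p. centred p \<longrightarrow> fps_X ^ K dvd subst2 \<eta> p - subst2 \<eta>' (push \<sigma> p)"
proof -
  define D where "D = jacobian \<sigma>"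
  define a b c d where "a = fst \<sigma> $ 1 $ 0" and "b = fst \<sigma> $ 0 $ 1" and "c = snd \<sigma> $ 1 $ 0" and "d = snd \<sigma> $ 0 $ 1"
  have D: "D = a * d - b * c" "D \<noteq> 0" using det by (auto simp: D_def jacobian_def a_def b_def c_def d_def)
  define \<alpha> \<beta> where "\<alpha> = scalar2 (d / D) * var_x - scalar2 (b / D) * var_y"
    and "\<beta> = scalar2 (a / D) * var_y - scalar2 (c / D) * var_x"
  define u v where "u = scalar2 (d / D) * fst \<sigma> - scalar2 (b / D) * snd \<sigma>"
    and "v = scalar2 (a / D) * snd \<sigma> - scalar2 (c / D) * fst \<sigma>"
  have push: "subst2 \<alpha> (push \<sigma> p) = subst2 u p" "subst2 \<beta> (push \<sigma> p) = subst2 v p" for p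
    using centred_push[OF \<sigma>, of p]
    by (simp_all add: \<alpha>_def \<beta>_def u_def v_def subst2_diff subst2_scalar_mult) (simp_all add: push_def)
  have v1: "vanishes_to 1 u" "vanishes_to 1 v" "vanishes_to 1 var_x" "vanishes_to 1 var_y"
    unfolding vanishes_to_1_iff using \<sigma> by (simp_all add: u_def v_def var_x_nth var_y_nth)
  have one: "d / D * a - b / D * c = 1" "a / D * d - c / D * b = 1"
  proof -
    have "d / D * a - b / D * c = (a * d - b * c) / D" "a / D * d - c / D * b = (a * d - b * c) / D"
      by (simp_all add: diff_divide_distrib mult_ac)
    then show "d / D * a - b / D * c = 1" "a / D * d - c / D * b = 1" using D by simp_all
  qed
  have v2: "vanishes_to 2 (u - var_x)" "vanishes_to 2 (v - var_y)"
    using \<sigma> one unfolding vanishes_to_2_iff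
    by (simp_all add: u_def v_def var_x_nth var_y_nth a_def[symmetric, simplified] b_def[symmetric, simplified]
        c_def[symmetric, simplified] d_def[symmetric, simplified] scalar2_def mult_ac)
  have "\<exists>\<eta>' r. vanishes_to K r \<and> (\<forall>p. centred p \<longrightarrow> subst2 \<eta> p = subst2 \<eta>' (push \<sigma> p) + subst2 r p)"
  proof (induction K)
    case 0
    show ?case by (intro exI[of _ 0] exI[of _ \<eta>]) (simp add: vanishes_to_def)
  next
    case (Suc K)
    then obtain \<eta>' r where r: "vanishes_to K r"
      and eq: "\<And>p. centred p \<Longrightarrow> subst2 \<eta> p = subst2 \<eta>' (push \<sigma> p) + subst2 r p" by blast
    \<comment> \<open>The degree \<open>K\<close> part of \<open>r\<close>, written in the target
      coordinates (\<open>A\<close>), in their images in the source (\<open>B\<close>) and in the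
      plain variables (\<open>H\<close>). \<open>A\<close> and \<open>B\<close> have the same value
      on curves, and \<open>B\<close> differs from \<open>H\<close> in higher degree only.\<close>
    define A where "A = (\<Sum>i\<le>K. scalar2 (r $ i $ (K - i)) * (\<alpha> ^ i * \<beta> ^ (K - i)))"
    define B where "B = (\<Sum>i\<le>K. scalar2 (r $ i $ (K - i)) * (u ^ i * v ^ (K - i)))"
    define H where "H = (\<Sum>i\<le>K. scalar2 (r $ i $ (K - i)) * (var_x ^ i * var_y ^ (K - i)))"
    have "subst2 A (push \<sigma> p) = subst2 B p" if "centred p" for p
      using that centred_push[OF \<sigma>, of p]
      by (simp add: A_def B_def subst2_sum subst2_scalar_mult subst2_mult subst2_power push)
    then have "subst2 \<eta> p = subst2 (\<eta>' + A) (push \<sigma> p) + subst2 (r - B) p" if "centred p" for p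
      using eq that by (simp add: subst2_add subst2_diff)
    moreover have "vanishes_to (Suc K) (r - B)"
    proof -
      have H: "H $ i $ j = (if i + j = K then r $ i $ j else 0)" for i j
      proof -
        have "H $ i $ j = (\<Sum>k\<le>K. r $ k $ (K - k) * (if i = k \<and> j = K - k then 1 else 0))"
          by (simp add: H_def fps_sum_nth monomial_nth)
        also have "\<dots> = (\<Sum>k\<in>(if i + j = K then {i} else {}). r $ k $ (K - k))"
          by (intro sum.mono_neutral_cong_right) (auto split: if_splits)
        finally show ?thesis by auto
      qed
      have "vanishes_to (Suc K) (r - H)"
        using r by (auto simp: vanishes_to_def H less_Suc_eq)
      moreover have "vanishes_to (Suc K) (H - B)"
      proof -
        have "H - B = (\<Sum>i\<le>K. scalar2 (r $ i $ (K - i)) * (var_x ^ i * var_y ^ (K - i) - u ^ i * v ^ (K - i)))"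
          by (simp add: H_def B_def algebra_simps sum_subtractf)
        moreover have "vanishes_to (0 + Suc (i + (K - i))) (scalar2 (r $ i $ (K - i)) *
            (var_x ^ i * var_y ^ (K - i) - u ^ i * v ^ (K - i)))" for i
        proof (intro vanishes_to_mult vanishes_to_monomial_diff v1)
          show "vanishes_to 2 (var_x - u)" "vanishes_to 2 (var_y - v)"
            using v2 by (simp_all add: vanishes_to_def)
        qed (simp add: vanishes_to_def)
        then have "vanishes_to (Suc K) (scalar2 (r $ i $ (K - i)) *
            (var_x ^ i * var_y ^ (K - i) - u ^ i * v ^ (K - i)))" if "i \<in> {..K}" for i
          using that by (metis add_0 atMost_iff le_add_diff_inverse)
        ultimately show ?thesis by (metis (no_types, lifting) vanishes_to_sum)
      qed
      ultimately have "vanishes_to (Suc K) ((r - H) + (H - B))" by (rule vanishes_to_add)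
      then show ?thesis by simp
    qed
    ultimately show ?case by blast
  qed
  then obtain \<eta>' r where r: "vanishes_to K r"
    and eq: "\<And>p. centred p \<Longrightarrow> subst2 \<eta> p = subst2 \<eta>' (push \<sigma> p) + subst2 r p" by blast
  have "fps_X ^ K dvd subst2 \<eta> p - subst2 \<eta>' (push \<sigma> p)" if p: "centred p" for p
  proof -
    have "fps_X ^ (1 * K) dvd subst2 r p"
      using p by (intro subst2_dvd r) (auto simp: centred_def fps_X_dvd_iff)
    then show ?thesis using eq[OF p] by simp
  qed
  then show ?thesis by blast
qed

lemma param_compose_push:
  assumes "centred q" and "\<rho> $ 0 = 0" and "push \<sigma> p = param_compose q \<rho>"
  shows "subst2 \<eta> (push \<sigma> p) = subst2 \<eta> q oo \<rho>"
  using subst2_compose[OF assms(1,2)] assms(3) by (simp add: param_compose_def)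

text \<open>A function equal to \<open>t ^ n\<close> on one branch and to 0 on the other is
  transported with an error of order at least \<open>K > n\<close>. The order \<open>n\<close>
  survives on the first image, and the second image sees only the error.\<close>

lemma values_of_image:
  assumes C: "\<And>h. h \<in> conv1 \<Longrightarrow> fps_X ^ C dvd h \<Longrightarrow> \<exists>g. subst2 g p1 = h \<and> subst2 g p2 = 0"
    and c: "centred p1" "centred p2" "centred q1" "centred q2"
    and \<sigma>: "fst \<sigma> $ 0 $ 0 = 0" "snd \<sigma> $ 0 $ 0 = 0" "jacobian \<sigma> \<noteq> 0"
    and \<rho>1: "\<rho>1 $ 0 = 0" "\<rho>1 $ 1 \<noteq> 0" and \<rho>2: "\<rho>2 $ 0 = 0" "\<rho>2 $ 1 \<noteq> 0"
    and q1: "push \<sigma> p1 = param_compose q1 \<rho>1" and q2: "push \<sigma> p2 = param_compose q2 \<rho>2"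
    and n: "n \<ge> C" "K > n"
  shows "\<exists>\<eta>. subst2 \<eta> q1 \<noteq> 0 \<and> subdegree (subst2 \<eta> q1) = n \<and> fps_X ^ K dvd subst2 \<eta> q2"
proof -
  have "fps_X ^ C dvd (fps_X ^ n :: complex fps)" using n by (simp add: le_imp_power_dvd)
  then obtain g where g: "subst2 g p1 = fps_X ^ n" "subst2 g p2 = 0" using C[of "fps_X ^ n"] by blast
  obtain \<eta> where \<eta>: "\<And>p. centred p \<Longrightarrow> fps_X ^ K dvd subst2 g p - subst2 \<eta> (push \<sigma> p)"
    using approximate_inverse[OF \<sigma>] by blast
  define f1 f2 where "f1 = subst2 \<eta> q1" and "f2 = subst2 \<eta> q2"
  have 1: "fps_X ^ K dvd fps_X ^ n - (f1 oo \<rho>1)"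
    using \<eta>[OF c(1)] g param_compose_push[OF c(3) \<rho>1(1) q1] by (simp add: f1_def)
  have 2: "fps_X ^ K dvd f2 oo \<rho>2"
    using \<eta>[OF c(2)] g param_compose_push[OF c(4) \<rho>2(1) q2] by (simp add: f2_def)
  have co: "(f1 oo \<rho>1) $ i = (if i = n then 1 else 0)" if "i \<le> n" for i
    using 1 n that by (auto simp: fps_X_power_dvd_iff)
  have ne: "f1 oo \<rho>1 \<noteq> 0" using co[of n] by auto
  have "subdegree (f1 oo \<rho>1) = n" by (rule subdegreeI) (use co in auto)
  moreover have "subdegree \<rho>1 = 1" by (rule subdegreeI) (use \<rho>1 in auto)
  ultimately have "subdegree f1 = n" using \<rho>1 by simp
  moreover have "f1 \<noteq> 0" using ne by auto
  moreover have "fps_X ^ K dvd f2"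
    using compose_dvd_compose[OF 2, of "fps_inv \<rho>2"] compose_inv_cancel[OF \<rho>2] by simp
  ultimately show ?thesis unfolding f1_def f2_def by blast
qed

text \<open>On a parametrization factoring through \<open>\<tau>\<close> all orders of functions are
  multiples of the order of \<open>\<tau>\<close>; two consecutive orders force it to be 1.\<close>

lemma branch_param_of_values:
  assumes q: "map_germ q" and v: "\<And>n. n \<ge> C \<Longrightarrow> \<exists>\<eta>. subst2 \<eta> q \<noteq> 0 \<and> subdegree (subst2 \<eta> q) = n"
  shows "branch_param q"
  unfolding branch_param_def
proof (intro conjI q notI)
  assume "\<exists>q' \<tau>. map_germ q' \<and> \<tau> \<in> conv1 \<and> fps_ord \<tau> \<ge> 2 \<and> q = (fst q' oo \<tau>, snd q' oo \<tau>)"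
  then obtain q' \<tau> where q': "map_germ q'" and \<tau>: "fps_ord \<tau> \<ge> 2" and eq: "q = (fst q' oo \<tau>, snd q' oo \<tau>)"
    by blast
  have "fps_X ^ 2 dvd \<tau>" using \<tau> fps_ord_dvd_iff[of 2 \<tau>] by (simp add: numeral_eq_enat)
  then have \<tau>0: "\<tau> $ 0 = 0" "\<tau> $ 1 = 0" by (auto simp: fps_X_power_dvd_iff)
  have dvd: "subdegree \<tau> dvd n" if n: "n \<ge> max C 1" for n
  proof -
    obtain \<eta> where \<eta>: "subdegree (subst2 \<eta> q) = n" using v[of n] n by auto
    have "subst2 \<eta> q = subst2 \<eta> q' oo \<tau>"
      using subst2_compose[of q' \<tau> \<eta>] q' \<tau>0 by (simp add: eq map_germ_iff)
    then show ?thesis using \<eta> \<tau>0 by (metis dvd_triv_right subdegree_fps_compose)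
  qed
  have "subdegree \<tau> dvd Suc (max C 1) - max C 1" using dvd[of "Suc (max C 1)"] dvd[of "max C 1"]
    by (intro dvd_diff_nat) auto
  then have "subdegree \<tau> = 1" by simp
  then have "\<tau> $ 1 \<noteq> 0" by (metis nth_subdegree_nonzero subdegree_0 zero_neq_one)
  with \<tau>0 show False by simp
qed

text \<open>Equivalence requires the image to be a bigerm as well. Primitivity follows from the
  presence of all large orders, distinctness from a function of order \<open>C\<close> on one image
  and of much higher order on the other.\<close>

lemma is_bigerm_image:
  assumes m: "m1 \<ge> 1" "m2 \<ge> 1" and y: "fps_X ^ Suc m1 dvd y1" "fps_X ^ Suc m2 dvd y2"
    and z: "fps_X ^ Suc m1 dvd z1" "fps_X ^ Suc m2 dvd z2" and zc: "z1 \<in> conv1" "z2 \<in> conv1"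
    and big: "is_bigerm (puiseux s1 m1 y1, puiseux s2 m2 y2)"
    and \<sigma>: "fst \<sigma> $ 0 $ 0 = 0" "snd \<sigma> $ 0 $ 0 = 0" "jacobian \<sigma> \<noteq> 0"
    and \<rho>1: "\<rho>1 $ 0 = 0" "\<rho>1 $ 1 \<noteq> 0" and \<rho>2: "\<rho>2 $ 0 = 0" "\<rho>2 $ 1 \<noteq> 0"
    and q1: "push \<sigma> (puiseux s1 m1 y1) = param_compose (puiseux s1 m1 z1) \<rho>1"
    and q2: "push \<sigma> (puiseux s2 m2 y2) = param_compose (puiseux s2 m2 z2) \<rho>2"
  shows "is_bigerm (puiseux s1 m1 z1, puiseux s2 m2 z2)"
proof -
  obtain C where C: "\<And>h1 h2. h1 \<in> conv1 \<Longrightarrow> h2 \<in> conv1 \<Longrightarrow> fps_X ^ C dvd h1 \<Longrightarrow> fps_X ^ C dvd h2 \<Longrightarrow>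
    \<exists>g\<in>max_ideal_sq. subst2 g (puiseux s1 m1 y1) = h1 \<and> subst2 g (puiseux s2 m2 y2) = h2"
    using conductor_exists[OF m y big] by blast
  note c = centred_puiseux[OF m(1) y(1), of s1] centred_puiseux[OF m(2) y(2), of s2]
    centred_puiseux[OF m(1) z(1), of s1] centred_puiseux[OF m(2) z(2), of s2]
  have V1: "\<exists>\<eta>. subst2 \<eta> (puiseux s1 m1 z1) \<noteq> 0 \<and> subdegree (subst2 \<eta> (puiseux s1 m1 z1)) = n \<and>
      fps_X ^ K dvd subst2 \<eta> (puiseux s2 m2 z2)" if "n \<ge> C" "K > n" for n K
    using C[of _ 0] by (intro values_of_image[OF _ c(1,2,3,4) \<sigma> \<rho>1 \<rho>2 q1 q2 that]) auto
  have V2: "\<exists>\<eta>. subst2 \<eta> (puiseux s2 m2 z2) \<noteq> 0 \<and> subdegree (subst2 \<eta> (puiseux s2 m2 z2)) = n \<and>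
      fps_X ^ K dvd subst2 \<eta> (puiseux s1 m1 z1)" if "n \<ge> C" "K > n" for n K
    using C[of 0] by (intro values_of_image[OF _ c(2,1,4,3) \<sigma> \<rho>2 \<rho>1 q2 q1 that]) auto
  have mg: "map_germ (puiseux s1 m1 z1)" "map_germ (puiseux s2 m2 z2)"
    using c(3,4) zc by (auto simp: map_germ_iff puiseux_def)
  have "branch_ideal (puiseux s1 m1 z1) \<noteq> branch_ideal (puiseux s2 m2 z2)"
  proof
    assume eq: "branch_ideal (puiseux s1 m1 z1) = branch_ideal (puiseux s2 m2 z2)"
    have "z2 $ 0 = 0" using z by (simp add: fps_X_power_dvd_iff del: power_Suc)
    then have "branch_equation s2 m2 z2 \<in> branch_ideal (puiseux s2 m2 z2)"
      using m zc subst2_branch_equation by (auto simp: branch_ideal_def)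
    then have "subst2 (branch_equation s2 m2 z2) (puiseux s1 m1 z1) = 0"
      unfolding eq[symmetric] by (simp add: branch_ideal_def)
    then obtain c where c0: "c \<noteq> 0" "c $ 0 = 0"
      and cmp: "\<And>\<eta>. subst2 \<eta> (puiseux s1 m1 z1) oo fps_X ^ m2 = subst2 \<eta> (puiseux s2 m2 z2) oo c"
      using branch_equation_vanishes_puiseux[OF m(1) z(1) m(2) z(2)] by blast
    \<comment> \<open>Larger than \<open>C * m2\<close>, the order of \<open>L\<close>, to reach the
      contradiction, and larger than \<open>C\<close>, as \<open>V1\<close> requires.\<close>
    define K where "K = C * m2 + C + 1"
    obtain \<eta> where \<eta>: "subst2 \<eta> (puiseux s1 m1 z1) \<noteq> 0" "subdegree (subst2 \<eta> (puiseux s1 m1 z1)) = C"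
      "fps_X ^ K dvd subst2 \<eta> (puiseux s2 m2 z2)" using V1[of C K] by (auto simp: K_def)
    have X0: "(fps_X ^ m2 :: complex fps) $ 0 = 0" using m by (simp add: power_0_left)
    define L where "L = subst2 \<eta> (puiseux s1 m1 z1) oo fps_X ^ m2"
    have "subdegree L = C * m2" using X0 \<eta> by (simp add: L_def)
    moreover have "L \<noteq> 0" using X0 \<eta> by (simp add: L_def fps_compose_eq_0_iff)
    ultimately have "L $ (C * m2) \<noteq> 0" by (metis nth_subdegree_nonzero)
    moreover have "fps_X ^ K dvd L" unfolding L_def cmp by (rule compose_dvd_compose[OF \<eta>(3) c0(2)])
    ultimately show False by (simp add: fps_X_power_dvd_iff K_def del: power_Suc)
  qed
  then show ?thesis
    using branch_param_of_values[OF mg(1), of C] branch_param_of_values[OF mg(2), of C] V1 V2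
    by (auto simp: is_bigerm_def) (meson lessI)+
qed

section \<open>Order by order elimination\<close>

lemma unipotent_form_Omega:
  assumes "\<omega> \<in> Omega \<delta>"
  obtains \<kappa> where "unipotent_form \<kappa> \<omega>" and "\<delta> = 1 \<Longrightarrow> \<kappa> = 0"
    and "fst \<omega> \<in> conv2" and "snd \<omega> \<in> conv2"
proof -
  obtain a b \<beta> where \<omega>: "\<omega> = (a, scalar2 (\<beta> * (of_nat \<delta> - 1)) * var_y + b)"
    and ab: "a \<in> max_ideal_sq" "b \<in> max_ideal_sq"
    using assms by (auto simp: Omega_def)
  have "unipotent_form (\<beta> * (of_nat \<delta> - 1)) \<omega>"
    unfolding unipotent_form_def \<omega> fst_conv snd_conv fps_add_nth scalar2_mult_nth var_y_nth
    using max_ideal_sq_jet[OF ab(1)] max_ideal_sq_jet[OF ab(2)] by simp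
  moreover have "fst \<omega> \<in> conv2" "snd \<omega> \<in> conv2"
    using max_ideal_sq_conv2 ab by (auto simp: \<omega>)
  ultimately show ?thesis using that by auto
qed

definition scale_form :: "complex \<Rightarrow> form1 \<Rightarrow> form1" where
  "scale_form r \<omega> = (scalar2 r * fst \<omega>, scalar2 r * snd \<omega>)"

lemma scale_form_Omega:
  assumes "\<omega> \<in> Omega \<delta>"
  shows "scale_form r \<omega> \<in> Omega \<delta>"
proof -
  obtain a b \<beta> where \<omega>: "\<omega> = (a, scalar2 (\<beta> * (of_nat \<delta> - 1)) * var_y + b)"
    and ab: "a \<in> max_ideal_sq" "b \<in> max_ideal_sq"
    using assms by (auto simp: Omega_def)
  have s: "scalar2 r * scalar2 c = scalar2 (r * c)" for c by (simp add: scalar2_def)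
  have "scale_form r \<omega> = (scalar2 r * a, scalar2 ((r * \<beta>) * (of_nat \<delta> - 1)) * var_y + scalar2 r * b)"
    by (simp add: scale_form_def \<omega> distrib_left mult.assoc flip: s)
  then show ?thesis unfolding Omega_def using ab max_ideal_sq_scalar by blast
qed

lemma pullback_scale_form: "pullback (scale_form r \<omega>) p = fps_const r * pullback \<omega> p"
  by (simp add: pullback_def scale_form_def subst2_scalar_mult algebra_simps)

text \<open>The 1 added in \<open>form_value\<close> and the order \<open>m - 1\<close> of the
  derivative of \<open>t ^ m\<close> together account for \<open>m\<close>; so the shifted value of
  a form is the order of its defect, also when this is infinite.\<close>

lemma defect_order:
  assumes "m \<ge> 1" and "pullback \<omega> p = fps_const c * (fps_X ^ (m - 1) * e)" and "c \<noteq> 0"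
  shows "form_value \<omega> p - enat m = fps_ord e"
proof (cases "e = 0")
  case True
  then show ?thesis using assms by (simp add: form_value_def fps_ord_def)
next
  case False
  then have "pullback \<omega> p \<noteq> 0" "subdegree (pullback \<omega> p) = m - 1 + subdegree e"
    using assms by simp_all
  then show ?thesis using False assms(1) by (simp add: form_value_def fps_ord_def one_enat_def)
qed

text \<open>The original bigerm is fixed once, so that \<open>\<Lambda>\<close> keeps its meaning
  while the branches are being changed.\<close>

locale puiseux_bigerm =
  fixes \<delta> m1 m2 :: nat and x1 x2 :: "complex fps"
  assumes \<delta>: "\<delta> \<in> {1, 2}" and m: "m1 \<ge> 1" "m2 \<ge> 1"
    and x: "fps_X ^ Suc m1 dvd x1" "fps_X ^ Suc m2 dvd x2"
    and big: "is_bigerm (puiseux False m1 x1, puiseux (\<delta> = 1) m2 x2)"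
begin

abbreviation "p1 \<equiv> puiseux False m1 x1"
abbreviation "p2 \<equiv> puiseux (\<delta> = 1) m2 x2"
abbreviation "\<Lambda> \<equiv> Lambda_set \<delta> (p1, p2)"

lemma branch_mult_p: "branch_mult p1 = m1" "branch_mult p2 = m2"
proof -
  have "min (fps_ord (fps_X ^ n)) (fps_ord z) = enat n" "min (fps_ord z) (fps_ord (fps_X ^ n)) = enat n"
    if "fps_X ^ Suc n dvd z" for n and z :: "complex fps"
  proof -
    have "fps_ord (fps_X ^ n) = enat n" by (simp add: fps_ord_def)
    moreover have "enat n \<le> fps_ord z" using that power_le_dvd[OF that, of n] by (simp add: fps_ord_dvd_iff)
    ultimately show "min (fps_ord (fps_X ^ n)) (fps_ord z) = enat n"
      "min (fps_ord z) (fps_ord (fps_X ^ n)) = enat n" by simp_all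
  qed
  then show "branch_mult p1 = m1" "branch_mult p2 = m2"
    using x by (simp_all add: branch_mult_def puiseux_def)
qed

text \<open>The state of the elimination: an accumulated change of the original branches together
  with the Puiseux series it has reached. Convergence is demanded of \<open>\<sigma>\<close>,
  whereas series and parameters may be merely formal.\<close>

definition normalized_by :: "series2 \<times> series2 \<Rightarrow> complex fps \<Rightarrow> complex fps \<Rightarrow> bool" where
  "normalized_by \<sigma> y1 y2 \<longleftrightarrow> fst \<sigma> \<in> conv2 \<and> snd \<sigma> \<in> conv2 \<and> unipotent (\<delta> = 1) \<sigma> \<and>
     fps_X ^ Suc m1 dvd y1 \<and> fps_X ^ Suc m2 dvd y2 \<and>
     (\<exists>\<rho>. tangent_id \<rho> \<and> push \<sigma> p1 = param_compose (puiseux False m1 y1) \<rho>) \<and>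
     (\<exists>\<rho>. tangent_id \<rho> \<and> push \<sigma> p2 = param_compose (puiseux (\<delta> = 1) m2 y2) \<rho>)"

lemma normalized_by_id: "normalized_by (var_x, var_y) x1 x2"
proof -
  have "push (var_x, var_y) p = param_compose p fps_X" if "centred p" for p
    using that by (simp add: push_def param_compose_def)
  then show ?thesis
    unfolding normalized_by_def using x m
    by (auto simp: unipotent_def var_x_nth var_y_nth simp del: power_Suc intro!: exI[of _ fps_X])
qed

lemma defects_of_point:
  assumes "(v1, v2) \<in> \<Lambda>"
  obtains \<omega> e1 e2 where "\<omega> \<in> Omega \<delta>" and "fps_ord e1 = v1" and "fps_ord e2 = v2"
    and "pullback \<omega> p1 = fps_const (of_nat m1) * (fps_X ^ (m1 - 1) * e1)"
    and "pullback \<omega> p2 = fps_const (if \<delta> = 1 then - of_nat m2 else of_nat m2) * (fps_X ^ (m2 - 1) * e2)"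
proof -
  obtain \<omega> where \<omega>: "\<omega> \<in> Omega \<delta>" "v1 = form_value \<omega> p1 - enat m1" "v2 = form_value \<omega> p2 - enat m2"
    using assms unfolding Lambda_set_def fst_conv snd_conv branch_mult_p by blast
  obtain \<kappa> where \<kappa>: "unipotent_form \<kappa> \<omega>" "\<delta> = 1 \<longrightarrow> \<kappa> = 0" using unipotent_form_Omega[OF \<omega>(1)] by blast
  obtain e1 where e1: "pullback \<omega> p1 = fps_const (of_nat m1) * (fps_X ^ (m1 - 1) * e1)"
    using pullback_defect[OF m(1) x(1) \<kappa>(1), of False] by auto
  obtain e2 where e2: "pullback \<omega> p2 = fps_const (if \<delta> = 1 then - of_nat m2 else of_nat m2) * (fps_X ^ (m2 - 1) * e2)"
    using pullback_defect[OF m(2) x(2) \<kappa>(1), of "\<delta> = 1"] \<kappa>(2) by metis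
  show ?thesis
    using defect_order[OF m(1) e1] defect_order[OF m(2) e2] m \<omega> by (intro that[OF \<omega>(1) _ _ e1 e2]) auto
qed

lemma conv2_exp_vfield:
  assumes "fst \<omega> \<in> conv2" and "snd \<omega> \<in> conv2" and "\<eta> \<in> conv2"
  shows "exp_vfield K \<omega> \<eta> \<in> conv2"
proof -
  have "(vfield \<omega> ^^ n) \<eta> \<in> conv2" for n
    by (induction n) (use assms in \<open>auto simp: vfield_def intro!: conv2_diff conv2_mult conv2_deriv\<close>)
  then show ?thesis by (auto simp: exp_vfield_def)
qed

lemma move_along_form:
  assumes st: "normalized_by \<sigma> y1 y2" and \<omega>: "\<omega> \<in> Omega \<delta>"
    and e1: "pullback \<omega> p1 = fps_const (of_nat m1) * (fps_X ^ (m1 - 1) * e1)"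
    and e2: "pullback \<omega> p2 = fps_const (if \<delta> = 1 then - of_nat m2 else of_nat m2) * (fps_X ^ (m2 - 1) * e2)"
    and J: "fps_X ^ J1 dvd e1" "fps_X ^ J2 dvd e2"
  shows "\<exists>\<sigma>' z1 z2. normalized_by \<sigma>' z1 z2 \<and>
    fps_X ^ Suc J1 dvd z1 - (y1 + fps_const r * e1) \<and> fps_X ^ Suc J2 dvd z2 - (y2 + fps_const r * e2)"
proof -
  define \<theta> where "\<theta> = scale_form r \<omega>"
  have "\<theta> \<in> Omega \<delta>" unfolding \<theta>_def by (rule scale_form_Omega[OF \<omega>])
  then obtain \<kappa> where \<kappa>: "unipotent_form \<kappa> \<theta>" "\<delta> = 1 \<longrightarrow> \<kappa> = 0" and \<theta>c: "fst \<theta> \<in> conv2" "snd \<theta> \<in> conv2"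
    using unipotent_form_Omega by blast
  \<comment> \<open>At least 2, so that the second iterate of the field, the last one to contribute
    to the defect, is present; at least both orders, so that truncating the exponential is invisible
    up to them.\<close>
  define K where "K = max 2 (max J1 J2)"
  have K: "K \<ge> 2" "K \<ge> 1" "J1 \<le> K" "J2 \<le> K" by (auto simp: K_def)
  have uni: "unipotent (\<delta> = 1) \<sigma>" and y: "fps_X ^ Suc m1 dvd y1" "fps_X ^ Suc m2 dvd y2"
    and \<sigma>c: "fst \<sigma> \<in> conv2" "snd \<sigma> \<in> conv2"
    using st by (auto simp: normalized_by_def)
  \<comment> \<open>The first branch is tangent to the \<open>x\<close>-axis in both cases, so the
    weaker notion is the one that fits it.\<close>
  have uni': "unipotent False \<sigma>" using uni by (auto simp: unipotent_def)
  obtain \<rho>1 \<rho>2 where \<rho>1: "tangent_id \<rho>1" "push \<sigma> p1 = param_compose (puiseux False m1 y1) \<rho>1"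
    and \<rho>2: "tangent_id \<rho>2" "push \<sigma> p2 = param_compose (puiseux (\<delta> = 1) m2 y2) \<rho>2"
    using st unfolding normalized_by_def by blast
  have p1: "pullback \<theta> p1 = fps_const (if False then - of_nat m1 else of_nat m1) * (fps_X ^ (m1 - 1) * (fps_const r * e1))"
    unfolding \<theta>_def pullback_scale_form e1 by (simp add: mult_ac)
  have p2: "pullback \<theta> p2 = fps_const (if \<delta> = 1 then - of_nat m2 else of_nat m2) * (fps_X ^ (m2 - 1) * (fps_const r * e2))"
    unfolding \<theta>_def pullback_scale_form e2 by (simp only: mult_ac)
  have nil: "False \<longrightarrow> \<kappa> = 0" by simp
  obtain z1 \<tau>1 where z1: "tangent_id \<tau>1" "fps_X ^ Suc m1 dvd z1"
    "push (exp_map K \<theta> \<sigma>) p1 = param_compose (puiseux False m1 z1) \<tau>1"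
    "\<And>J. J \<le> K \<Longrightarrow> fps_X ^ J dvd fps_const r * e1 \<Longrightarrow> fps_X ^ Suc J dvd z1 - (y1 + fps_const r * e1)"
    using exp_map_puiseux[OF m(1) x(1) \<kappa>(1) nil uni' K(1) \<rho>1(1) y(1) \<rho>1(2) p1] by blast
  obtain z2 \<tau>2 where z2: "tangent_id \<tau>2" "fps_X ^ Suc m2 dvd z2"
    "push (exp_map K \<theta> \<sigma>) p2 = param_compose (puiseux (\<delta> = 1) m2 z2) \<tau>2"
    "\<And>J. J \<le> K \<Longrightarrow> fps_X ^ J dvd fps_const r * e2 \<Longrightarrow> fps_X ^ Suc J dvd z2 - (y2 + fps_const r * e2)"
    using exp_map_puiseux[OF m(2) x(2) \<kappa> uni K(1) \<rho>2(1) y(2) \<rho>2(2) p2] by blast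
  have "normalized_by (exp_map K \<theta> \<sigma>) z1 z2"
    unfolding normalized_by_def
    using z1 z2 unipotent_exp_map[OF uni \<kappa> K(2)] conv2_exp_vfield[OF \<theta>c] \<sigma>c
    by (auto simp: exp_map_def simp del: power_Suc)
  moreover have "fps_X ^ Suc J1 dvd z1 - (y1 + fps_const r * e1)" using J K by (intro z1) auto
  moreover have "fps_X ^ Suc J2 dvd z2 - (y2 + fps_const r * e2)" using J K by (intro z2) auto
  ultimately show ?thesis by blast
qed

definition agree :: "nat \<Rightarrow> complex fps \<Rightarrow> complex fps \<Rightarrow> bool" where
  "agree j f g \<longleftrightarrow> (\<forall>i<j. f $ i = g $ i)"

text \<open>The defect has order exactly \<open>j\<close> on the first branch, so scaling the form
  brings the coefficient there to any value \<open>t\<close>. If \<open>v2 = enat j\<close>, the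
  coefficient of order \<open>j\<close> on the second branch may be disturbed as well.\<close>

lemma eliminate_first:
  assumes st: "normalized_by \<sigma> y1 y2" and v: "(enat j, v2) \<in> \<Lambda>" "v2 \<ge> enat j"
  shows "\<exists>\<sigma>' z1 z2. normalized_by \<sigma>' z1 z2 \<and> agree j z1 y1 \<and> agree j z2 y2 \<and> z1 $ j = t \<and>
    (v2 > enat j \<longrightarrow> z2 $ j = y2 $ j)"
proof -
  obtain \<omega> e1 e2 where \<omega>: "\<omega> \<in> Omega \<delta>" and e: "fps_ord e1 = enat j" "fps_ord e2 = v2"
    and p: "pullback \<omega> p1 = fps_const (of_nat m1) * (fps_X ^ (m1 - 1) * e1)"
    "pullback \<omega> p2 = fps_const (if \<delta> = 1 then - of_nat m2 else of_nat m2) * (fps_X ^ (m2 - 1) * e2)"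
    using defects_of_point[OF v(1)] by blast
  have d1: "fps_X ^ j dvd e1" "fps_X ^ j dvd e2" using e v by (simp_all add: fps_ord_dvd_iff)
  have e1j: "e1 $ j \<noteq> 0" using e(1) by (auto simp: fps_ord_def split: if_splits)
  define r where "r = (t - y1 $ j) / e1 $ j"
  obtain \<sigma>' z1 z2 where s: "normalized_by \<sigma>' z1 z2"
    "fps_X ^ Suc j dvd z1 - (y1 + fps_const r * e1)" "fps_X ^ Suc j dvd z2 - (y2 + fps_const r * e2)"
    using move_along_form[OF st \<omega> p d1] by blast
  have c: "z1 $ i = y1 $ i + r * e1 $ i" "z2 $ i = y2 $ i + r * e2 $ i" if "i \<le> j" for i
    using s(2,3) that by (auto simp: fps_X_power_dvd_iff simp del: power_Suc)
  have "z2 $ j = y2 $ j" if "v2 > enat j"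
  proof -
    have "enat (Suc j) \<le> v2" using that by (simp add: Suc_ile_eq)
    then have "fps_X ^ Suc j dvd e2" using e(2) by (simp add: fps_ord_dvd_iff del: power_Suc)
    then show ?thesis using c(2)[of j] by (simp add: fps_X_power_dvd_iff del: power_Suc)
  qed
  moreover have "agree j z1 y1" "agree j z2 y2"
    using c d1 by (simp_all add: agree_def fps_X_power_dvd_iff)
  moreover have "z1 $ j = t" using c(1)[of j] e1j by (simp add: r_def)
  ultimately show ?thesis using s(1) by blast
qed

lemma eliminate_second:
  assumes st: "normalized_by \<sigma> y1 y2" and v: "(v1, enat j) \<in> \<Lambda>" "v1 > enat j"
  shows "\<exists>\<sigma>' z1 z2. normalized_by \<sigma>' z1 z2 \<and> agree (Suc j) z1 y1 \<and> agree j z2 y2 \<and> z2 $ j = t"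
proof -
  obtain \<omega> e1 e2 where \<omega>: "\<omega> \<in> Omega \<delta>" and e: "fps_ord e1 = v1" "fps_ord e2 = enat j"
    and p: "pullback \<omega> p1 = fps_const (of_nat m1) * (fps_X ^ (m1 - 1) * e1)"
    "pullback \<omega> p2 = fps_const (if \<delta> = 1 then - of_nat m2 else of_nat m2) * (fps_X ^ (m2 - 1) * e2)"
    using defects_of_point[OF v(1)] by blast
  have "enat (Suc j) \<le> v1" using v(2) by (simp add: Suc_ile_eq)
  then have d1: "fps_X ^ Suc j dvd e1" "fps_X ^ j dvd e2" using e by (simp_all add: fps_ord_dvd_iff del: power_Suc)
  have e2j: "e2 $ j \<noteq> 0" using e(2) by (auto simp: fps_ord_def split: if_splits)
  define r where "r = (t - y2 $ j) / e2 $ j"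
  obtain \<sigma>' z1 z2 where s: "normalized_by \<sigma>' z1 z2"
    "fps_X ^ Suc (Suc j) dvd z1 - (y1 + fps_const r * e1)" "fps_X ^ Suc j dvd z2 - (y2 + fps_const r * e2)"
    using move_along_form[OF st \<omega> p d1] by blast
  have c: "z1 $ i = y1 $ i + r * e1 $ i" "z2 $ i = y2 $ i + r * e2 $ i" if "i \<le> j" for i
    using s(2,3) that by (auto simp: fps_X_power_dvd_iff simp del: power_Suc)
  have "agree (Suc j) z1 y1" "agree j z2 y2"
    using c d1 by (simp_all add: agree_def fps_X_power_dvd_iff del: power_Suc)
  moreover have "z2 $ j = t" using c(2)[of j] e2j by (simp add: r_def)
  ultimately show ?thesis using s(1) by blast
qed

abbreviation "free1 j \<equiv> (j, j) \<notin> maximal_points \<Lambda> \<and> fiber1 \<Lambda> (j, j) = {}"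
abbreviation "free2 j \<equiv> fiber2 \<Lambda> (j, j) = {}"

text \<open>The first branch is treated before the second, since its move may disturb order
  \<open>j\<close> of the second; a point of \<open>fiber2\<close> has first value above
  \<open>j\<close> and leaves the coefficient just prescribed intact. At a maximal point
  \<open>fiber2\<close> is empty, so nothing is demanded of the second branch.\<close>

lemma eliminate:
  assumes st: "normalized_by \<sigma> y1 y2"
  shows "\<exists>\<sigma>' z1 z2. normalized_by \<sigma>' z1 z2 \<and> agree j z1 y1 \<and> agree j z2 y2 \<and>
    (\<not> free1 j \<longrightarrow> z1 $ j = t) \<and> (\<not> free2 j \<longrightarrow> z2 $ j = 0)"
proof -
  have "\<exists>\<sigma>' z1 z2. normalized_by \<sigma>' z1 z2 \<and> agree j z1 y1 \<and> agree j z2 y2 \<and> (\<not> free1 j \<longrightarrow> z1 $ j = t)"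
  proof (cases "free1 j")
    case True
    moreover have "agree j y1 y1" "agree j y2 y2" by (simp_all add: agree_def)
    ultimately show ?thesis using st by blast
  next
    case False
    then have "\<exists>v2. (enat j, v2) \<in> \<Lambda> \<and> v2 \<ge> enat j"
      by (auto simp: fiber1_def maximal_points_def intro: less_imp_le)
    then show ?thesis using eliminate_first[OF st] by blast
  qed
  then obtain \<sigma>' z1 z2 where s: "normalized_by \<sigma>' z1 z2" "agree j z1 y1" "agree j z2 y2" "\<not> free1 j \<longrightarrow> z1 $ j = t"
    by blast
  show ?thesis
  proof (cases "free2 j")
    case True
    then show ?thesis using s by blast
  next
    case False
    then obtain v1 where "(v1, enat j) \<in> \<Lambda>" "v1 > enat j" by (auto simp: fiber2_def)
    then obtain \<sigma>'' w1 w2 where "normalized_by \<sigma>'' w1 w2" "agree (Suc j) w1 z1" "agree j w2 z2" "w2 $ j = 0"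
      using eliminate_second[OF s(1)] by blast
    moreover from this s have "agree j w1 y1" "agree j w2 y2" "w1 $ j = z1 $ j" by (simp_all add: agree_def)
    ultimately show ?thesis using s(4) by metis
  qed
qed

text \<open>When fewer than two terms of the first branch survive below order \<open>N\<close>, terms with
  coefficient 1 are created at orders \<open>N\<close> and \<open>N + 1\<close>, which lie in the conductor.\<close>

lemma eliminate_below:
  "\<exists>\<sigma> y1 y2. normalized_by \<sigma> y1 y2 \<and> (\<forall>j<n.
     (\<not> free1 j \<longrightarrow> y1 $ j = (if N \<le> j \<and> card {i. i < j \<and> y1 $ i \<noteq> 0} < 2 then 1 else 0)) \<and>
     (\<not> free2 j \<longrightarrow> y2 $ j = 0))"
proof (induction n)
  case 0
  then show ?case using normalized_by_id by blast
next
  case (Suc n)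
  then obtain \<sigma> y1 y2 where st: "normalized_by \<sigma> y1 y2" and IH: "\<And>j. j < n \<Longrightarrow>
     (\<not> free1 j \<longrightarrow> y1 $ j = (if N \<le> j \<and> card {i. i < j \<and> y1 $ i \<noteq> 0} < 2 then 1 else 0)) \<and>
     (\<not> free2 j \<longrightarrow> y2 $ j = 0)" by blast
  obtain \<sigma>' z1 z2 where s: "normalized_by \<sigma>' z1 z2" "agree n z1 y1" "agree n z2 y2"
    "\<not> free1 n \<longrightarrow> z1 $ n = (if N \<le> n \<and> card {i. i < n \<and> y1 $ i \<noteq> 0} < 2 then 1 else 0)"
    "\<not> free2 n \<longrightarrow> z2 $ n = 0"
    using eliminate[OF st, of n "if N \<le> n \<and> card {i. i < n \<and> y1 $ i \<noteq> 0} < 2 then 1 else 0"] by blast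
  have eq: "{i. i < j \<and> z1 $ i \<noteq> 0} = {i. i < j \<and> y1 $ i \<noteq> 0}" if "j \<le> n" for j
    using s(2) that by (auto simp: agree_def)
  have "(\<not> free1 j \<longrightarrow> z1 $ j = (if N \<le> j \<and> card {i. i < j \<and> z1 $ i \<noteq> 0} < 2 then 1 else 0)) \<and>
     (\<not> free2 j \<longrightarrow> z2 $ j = 0)" if "j < Suc n" for j
  proof (cases "j = n")
    case True
    then show ?thesis using s(4,5) eq[of n] by simp
  next
    case False
    then have j: "j < n" using that by simp
    then show ?thesis using IH[OF j] eq[of j] s(2,3) by (simp add: agree_def)
  qed
  with s(1) show ?case by blast
qed

end

section \<open>The normal form\<close>

text \<open>Scaling the main coordinate is compensated by scaling the parameter by an
  \<open>m\<close>-th root \<open>r\<close> of the factor; expressed in the new parameter, the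
  series in the other coordinate is rotated by \<open>1 / r\<close>.\<close>

lemma push_homothety:
  assumes \<rho>: "tangent_id \<rho>" and p: "push \<sigma> p = param_compose (puiseux s m y) \<rho>"
    and r: "r \<noteq> 0" "r ^ m = (if s then \<beta> else \<alpha>)"
  shows "push (scalar2 \<alpha> * fst \<sigma>, scalar2 \<beta> * snd \<sigma>) p =
    param_compose (puiseux s m (fps_const (if s then \<alpha> else \<beta>) * rot (1 / r) y)) (fps_const r * \<rho>)"
proof -
  have \<rho>0: "\<rho> $ 0 = 0" using \<rho> by (simp add: tangent_id_def)
  have "fps_const (1 / r) * fps_X oo (fps_const r * \<rho>) = fps_const (1 / r) * (fps_const r * \<rho>)"
    using \<rho>0 by (simp add: fps_compose_mult_distrib)
  also have "\<dots> = \<rho>" using r by (simp flip: mult.assoc)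
  finally have "rot (1 / r) y oo (fps_const r * \<rho>) = y oo \<rho>"
    unfolding rot_def using fps_compose_assoc[of "fps_const r * \<rho>" "fps_const (1 / r) * fps_X" y] \<rho>0 by simp
  then have y: "fps_const c * rot (1 / r) y oo (fps_const r * \<rho>) = fps_const c * (y oo \<rho>)" for c
    using \<rho>0 by (simp add: fps_compose_mult_distrib)
  have X: "fps_X ^ m oo (fps_const r * \<rho>) = fps_const (if s then \<beta> else \<alpha>) * (fps_X ^ m oo \<rho>)"
    using \<rho>0 r(2) by (simp add: fps_X_power_compose power_mult_distrib fps_const_power)
  show ?thesis using p y X
    by (auto simp: push_def param_compose_def puiseux_def subst2_scalar_mult)
qed

section \<open>Truncation to polynomial branches and the choice of leading terms\<close>

lemma fps_cutoff_cong: "fps_X ^ n dvd fps_cutoff n f - (f :: complex fps)"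
  by (simp add: fps_X_power_dvd_iff)

lemma conv1_fps_cutoff: "fps_cutoff n f \<in> conv1"
  by (rule conv1_polynomial[of n]) simp

lemma compose_cutoff_dvd:
  fixes f \<rho> :: "complex fps"
  assumes "\<rho> $ 0 = 0" and "n \<ge> 1"
  shows "fps_X ^ n dvd (fps_cutoff n f oo fps_cutoff n \<rho>) - (f oo \<rho>)"
proof -
  have c0: "fps_cutoff n \<rho> $ 0 = 0" using assms by simp
  have "fps_X ^ n dvd (fps_cutoff n f oo fps_cutoff n \<rho>) - (f oo fps_cutoff n \<rho>)"
    by (rule compose_cong_left[OF fps_cutoff_cong c0])
  moreover have "fps_X ^ n dvd (f oo fps_cutoff n \<rho>) - (f oo \<rho>)"
    by (rule compose_cong_right[OF fps_cutoff_cong c0 assms(1)])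
  ultimately show ?thesis by (rule dvd_diff_trans)
qed

text \<open>\<open>q\<close> is the convergent branch that replaces the formal image and differs
  from it only from order \<open>n\<close> on. The bound \<open>n > m\<close> keeps the main
  coordinate \<open>t ^ m\<close> uncut.\<close>

lemma truncated_correction:
  assumes m: "m \<ge> 1" and \<rho>: "\<rho> $ 0 = 0" and n: "n > m"
    and push: "push \<sigma> p = param_compose (puiseux s m z) \<rho>"
  defines "q \<equiv> param_compose (puiseux s m (fps_cutoff n z)) (fps_cutoff n \<rho>)"
  shows "fps_X ^ n dvd fst q - subst2 (fst \<sigma>) p" and "fps_X ^ n dvd snd q - subst2 (snd \<sigma>) p"
    and "fst q \<in> conv1" and "snd q \<in> conv1"
proof -
  have X: "fps_cutoff n (fps_X ^ m) = (fps_X ^ m :: complex fps)" using n by (intro fps_ext) auto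
  have c0: "fps_cutoff n \<rho> $ 0 = 0" using \<rho> by simp
  have n1: "n \<ge> 1" using n by simp
  have "fps_X ^ n dvd (fps_X ^ m oo fps_cutoff n \<rho>) - (fps_X ^ m oo \<rho>)"
    using compose_cutoff_dvd[OF \<rho> n1, of "fps_X ^ m"] X by simp
  then show "fps_X ^ n dvd fst q - subst2 (fst \<sigma>) p" and "fps_X ^ n dvd snd q - subst2 (snd \<sigma>) p"
    using compose_cutoff_dvd[OF \<rho> n1, of z] push
    by (auto simp: q_def push_def param_compose_def puiseux_def)
  have "fps_cutoff n f oo fps_cutoff n \<rho> \<in> conv1" for f
    by (rule conv1_compose_polynomial[of n]) (use c0 conv1_fps_cutoff in auto)
  then show "fst q \<in> conv1" "snd q \<in> conv1"
    using X by (auto simp: q_def param_compose_def puiseux_def split: if_splits) metis+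
qed

lemma act_param_eq:
  assumes "push \<sigma> p = param_compose q \<rho>" and "\<rho> $ 0 = 0" and "\<rho> $ 1 \<noteq> 0"
  shows "act_param \<rho> \<sigma> p = q"
proof -
  have "subst2 (fst \<sigma>) p = fst q oo \<rho>" "subst2 (snd \<sigma>) p = snd q oo \<rho>"
    using assms(1) by (simp_all add: push_def param_compose_def)
  then show ?thesis
    using compose_inv_cancel(2)[OF assms(2,3)] by (simp add: act_param_def)
qed

lemma two_least_elements:
  fixes S :: "nat set"
  assumes "finite S" and "card S \<ge> 2"
  obtains a b where "a \<in> S" "b \<in> S" "a < b" "\<And>i. i \<in> S \<Longrightarrow> i \<noteq> a \<Longrightarrow> b \<le> i"
proof -
  have ne: "S \<noteq> {}" using assms by auto
  define a where "a = Min S"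
  have a: "a \<in> S" "\<And>i. i \<in> S \<Longrightarrow> a \<le> i" using assms ne by (auto simp: a_def)
  have "card (S - {a}) \<ge> 1" using assms a by simp
  then have ne': "S - {a} \<noteq> {}" by (metis card.empty not_one_le_zero)
  define b where "b = Min (S - {a})"
  have fin: "finite (S - {a})" using assms by simp
  have "b \<in> S - {a}" unfolding b_def by (rule Min_in[OF fin ne'])
  moreover have "b \<le> i" if "i \<in> S" "i \<noteq> a" for i using fin that by (simp add: b_def)
  ultimately show ?thesis using a by (intro that[of a b]) (auto simp: order.strict_iff_order)
qed

context puiseux_bigerm
begin

lemma normal_form:
  "\<exists>j1 k z1 z2. m1 < j1 \<and> j1 < k \<and>
    A_equivalent (p1, p2) (puiseux False m1 z1, puiseux (\<delta> = 1) m2 z2) \<and>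
    z1 $ j1 = 1 \<and> z1 $ k = 1 \<and>
    (\<forall>n. z1 $ n \<noteq> 0 \<longrightarrow> n = j1 \<or> n = k \<or> k < n \<and> free1 n) \<and>
    (\<forall>n. z2 $ n \<noteq> 0 \<longrightarrow> m2 < n \<and> free2 n)"
proof -
  obtain C where C: "\<And>h1 h2. h1 \<in> conv1 \<Longrightarrow> h2 \<in> conv1 \<Longrightarrow> fps_X ^ C dvd h1 \<Longrightarrow> fps_X ^ C dvd h2 \<Longrightarrow>
    \<exists>g\<in>max_ideal_sq. subst2 g p1 = h1 \<and> subst2 g p2 = h2"
    using conductor_exists[OF m x big] by blast
  \<comment> \<open>The form \<open>g dx\<close>, with \<open>g\<close> equal to
    \<open>t ^ n\<close> on the first branch and to 0 on the second, yields the point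
    \<open>(enat n, \<infinity>)\<close> of \<open>\<Lambda>\<close>, so the first fiber at
    \<open>(n, n)\<close> is not empty.\<close>
  have full: "\<not> free1 n" if n: "n \<ge> C" for n
  proof -
    obtain g where g: "g \<in> max_ideal_sq" "subst2 g p1 = fps_X ^ n" "subst2 g p2 = 0"
      using C[of "fps_X ^ n" 0] n by (auto simp: le_imp_power_dvd)
    define \<omega> where "\<omega> = (g, 0 :: series2)"
    have "\<omega> = (g, scalar2 (0 * (of_nat \<delta> - 1)) * var_y + 0)" by (simp add: \<omega>_def scalar2_def)
    moreover have "(0 :: series2) \<in> max_ideal_sq" using max_ideal_sq_scalar[OF g(1), of 0] by (simp add: scalar2_def)
    ultimately have \<omega>: "\<omega> \<in> Omega \<delta>" unfolding Omega_def using g(1) by blast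
    have "pullback \<omega> p1 = fps_const (of_nat m1) * (fps_X ^ (m1 - 1) * fps_X ^ n)"
      using g(2) fps_deriv_power[of "fps_X :: complex fps" m1]
      by (simp add: pullback_def \<omega>_def puiseux_def mult_ac)
    then have "form_value \<omega> p1 - enat m1 = fps_ord (fps_X ^ n)" using m by (intro defect_order) auto
    then have 1: "form_value \<omega> p1 - enat (branch_mult p1) = enat n" by (simp add: fps_ord_def branch_mult_p)
    have "pullback \<omega> p2 = 0" using g(3) by (simp add: pullback_def \<omega>_def)
    then have "form_value \<omega> p2 - enat (branch_mult p2) = \<infinity>" by (simp add: form_value_def fps_ord_def)
    with 1 have "(enat n, \<infinity>) = (form_value \<omega> p1 - enat (branch_mult p1), form_value \<omega> p2 - enat (branch_mult p2))"
      by simp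
    then have "(enat n, \<infinity>) \<in> \<Lambda>" unfolding Lambda_set_def fst_conv snd_conv using \<omega> by blast
    then show ?thesis by (auto simp: fiber1_def)
  qed
  \<comment> \<open>The orders \<open>N\<close> and \<open>Suc N\<close> are at least
    \<open>C\<close>, so coefficients can be prescribed there. The bound \<open>L = N + 2\<close>
    covers both, exceeds the multiplicities and leaves room for the final correction.\<close>
  define N where "N = C + m1 + m2"
  define L where "L = N + 2"
  obtain \<sigma> y1 y2 where st: "normalized_by \<sigma> y1 y2" and el: "\<And>j. j < L \<Longrightarrow>
     (\<not> free1 j \<longrightarrow> y1 $ j = (if N \<le> j \<and> card {i. i < j \<and> y1 $ i \<noteq> 0} < 2 then 1 else 0)) \<and>
     (\<not> free2 j \<longrightarrow> y2 $ j = 0)"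
    using eliminate_below[of L N] by blast
  have uni: "unipotent (\<delta> = 1) \<sigma>" and y: "fps_X ^ Suc m1 dvd y1" "fps_X ^ Suc m2 dvd y2"
    and \<sigma>c: "fst \<sigma> \<in> conv2" "snd \<sigma> \<in> conv2"
    using st by (auto simp: normalized_by_def)
  obtain \<rho>1 \<rho>2 where \<rho>1: "tangent_id \<rho>1" "push \<sigma> p1 = param_compose (puiseux False m1 y1) \<rho>1"
    and \<rho>2: "tangent_id \<rho>2" "push \<sigma> p2 = param_compose (puiseux (\<delta> = 1) m2 y2) \<rho>2"
    using st unfolding normalized_by_def by blast
  define S where "S j = {i. i < j \<and> y1 $ i \<noteq> 0}" for j
  have fin: "finite (S j)" for j by (simp add: S_def)
  have mono: "card (S i) \<le> card (S j)" if "i \<le> j" for i j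
    using that by (intro card_mono fin) (auto simp: S_def)
  have "card (S L) \<ge> 2"
  proof (rule ccontr)
    assume "\<not> card (S L) \<ge> 2"
    then have "card (S N) < 2" "card (S (Suc N)) < 2"
      using mono[of N L] mono[of "Suc N" L] by (auto simp: L_def)
    then have "y1 $ N = 1" "y1 $ Suc N = 1"
      using el[of N] el[of "Suc N"] full[of N] full[of "Suc N"] by (auto simp: L_def N_def S_def)
    then have "{N, Suc N} \<subseteq> S L" by (auto simp: S_def L_def)
    then have "card {N, Suc N} \<le> card (S L)" by (intro card_mono fin)
    with \<open>\<not> card (S L) \<ge> 2\<close> show False by simp
  qed
  then obtain j1 k where jk: "j1 \<in> S L" "k \<in> S L" "j1 < k" and min: "\<And>i. i \<in> S L \<Longrightarrow> i \<noteq> j1 \<Longrightarrow> k \<le> i"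
    using two_least_elements[OF fin] by blast
  have nz: "y1 $ j1 \<noteq> 0" "y1 $ k \<noteq> 0" and lt: "j1 < L" "k < L" using jk by (auto simp: S_def)
  have "m1 < j1"
    using nz(1) y(1) by (metis fps_X_power_dvd_iff less_Suc_eq_le not_le)
  have supp1: "n = j1 \<or> n = k \<or> k < n \<and> free1 n" if "n < L" "y1 $ n \<noteq> 0" for n
  proof (cases "n = j1 \<or> n = k")
    case False
    then have "k < n" using min[of n] that by (auto simp: S_def)
    then have "{j1, k} \<subseteq> S n" using jk nz by (auto simp: S_def)
    then have "card {j1, k} \<le> card (S n)" by (intro card_mono fin)
    then have "\<not> card (S n) < 2" using jk by simp
    then have "free1 n" using el[OF that(1)] that(2) by (auto simp: S_def)
    with \<open>k < n\<close> show ?thesis by blast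
  qed blast
  have supp2: "m2 < n \<and> free2 n" if "n < L" "y2 $ n \<noteq> 0" for n
    using el[OF that(1)] that(2) y(2) by (metis fps_X_power_dvd_iff less_Suc_eq_le not_le)
  have "k - j1 \<noteq> 0" using jk by simp
  \<comment> \<open>The homothety multiplies the coefficient of order \<open>n\<close> by
    \<open>\<beta> / r ^ n\<close>. Requiring the value 1 at \<open>j1\<close> determines
    \<open>\<beta>\<close>, and requiring it at \<open>k\<close> gives this equation for
    \<open>r\<close>.\<close>
  then obtain r where r: "y1 $ k / y1 $ j1 = r ^ (k - j1)" by (rule exists_complex_root)
  have r0: "r \<noteq> 0"
  proof
    assume "r = 0"
    then have "y1 $ k / y1 $ j1 = 0" using r jk by simp
    then show False using nz by simp
  qed
  define \<alpha> \<beta> where "\<alpha> = r ^ m1" and "\<beta> = r ^ j1 / y1 $ j1"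
  have \<alpha>\<beta>: "\<alpha> \<noteq> 0" "\<beta> \<noteq> 0" using r0 nz by (auto simp: \<alpha>_def \<beta>_def)
  have "m2 \<noteq> 0" using m by simp
  \<comment> \<open>The second branch undergoes the same scaling of the plane but needs its own
    scaling of the parameter. Its coefficients are multiplied by nonzero factors, so their support
    is kept.\<close>
  with \<alpha>\<beta> obtain r2 where r2: "r2 \<noteq> 0" "(if \<delta> = 1 then \<beta> else \<alpha>) = r2 ^ m2"
    using exists_complex_root_nonzero[of "if \<delta> = 1 then \<beta> else \<alpha>" m2] by metis
  define \<sigma>' where "\<sigma>' = (scalar2 \<alpha> * fst \<sigma>, scalar2 \<beta> * snd \<sigma>)"
  define w1 w2 where "w1 = fps_const \<beta> * rot (1 / r) y1"
    and "w2 = fps_const (if \<delta> = 1 then \<alpha> else \<beta>) * rot (1 / r2) y2"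
  define \<tau>1 \<tau>2 where "\<tau>1 = fps_const r * \<rho>1" and "\<tau>2 = fps_const r2 * \<rho>2"
  have \<tau>: "\<tau>1 $ 0 = 0" "\<tau>1 $ 1 \<noteq> 0" "\<tau>2 $ 0 = 0" "\<tau>2 $ 1 \<noteq> 0"
    using \<rho>1 \<rho>2 r0 r2 by (auto simp: \<tau>1_def \<tau>2_def tangent_id_def)
  have push1: "push \<sigma>' p1 = param_compose (puiseux False m1 w1) \<tau>1"
    using push_homothety[OF \<rho>1 r0, of \<beta> \<alpha>] by (simp add: \<sigma>'_def w1_def \<tau>1_def \<alpha>_def)
  have push2: "push \<sigma>' p2 = param_compose (puiseux (\<delta> = 1) m2 w2) \<tau>2"
    unfolding \<sigma>'_def w2_def \<tau>2_def by (rule push_homothety[OF \<rho>2 r2(1) r2(2)[symmetric]])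
  define z1 z2 where "z1 = fps_cutoff L w1" and "z2 = fps_cutoff L w2"
  define \<pi>1 \<pi>2 where "\<pi>1 = fps_cutoff L \<tau>1" and "\<pi>2 = fps_cutoff L \<tau>2"
  define q1 q2 where "q1 = param_compose (puiseux False m1 z1) \<pi>1"
    and "q2 = param_compose (puiseux (\<delta> = 1) m2 z2) \<pi>2"
  have "L > m1" "L > m2" by (simp_all add: L_def N_def)
  note T1 = truncated_correction[OF m(1) \<tau>(1) \<open>L > m1\<close> push1, folded z1_def \<pi>1_def, folded q1_def]
  note T2 = truncated_correction[OF m(2) \<tau>(3) \<open>L > m2\<close> push2, folded z2_def \<pi>2_def, folded q2_def]
  have bp: "branch_param p1" "branch_param p2" using big by (auto simp: is_bigerm_def)
  have pc: "fst p1 \<in> conv1" "snd p1 \<in> conv1" "fst p2 \<in> conv1" "snd p2 \<in> conv1"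
    using bp by (auto simp: branch_param_def map_germ_def)
  have \<sigma>'c: "fst \<sigma>' \<in> conv2" "snd \<sigma>' \<in> conv2" using \<sigma>c by (auto simp: \<sigma>'_def)
  have le: "fps_X ^ C dvd f" if "fps_X ^ L dvd f" for f :: "complex fps"
    using that by (rule power_le_dvd) (simp add: L_def N_def)
  \<comment> \<open>On each branch the discrepancy is convergent and of order at least
    \<open>L \<ge> C\<close>, so one \<open>g1\<close> realizes it on both branches at once.\<close>
  obtain g1 where g1: "g1 \<in> max_ideal_sq" "subst2 g1 p1 = fst q1 - subst2 (fst \<sigma>') p1"
    "subst2 g1 p2 = fst q2 - subst2 (fst \<sigma>') p2"
    using C[OF _ _ le[OF T1(1)] le[OF T2(1)]] T1(3) T2(3) conv1_subst2[OF \<sigma>'c(1)] pc by blast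
  obtain g2 where g2: "g2 \<in> max_ideal_sq" "subst2 g2 p1 = snd q1 - subst2 (snd \<sigma>') p1"
    "subst2 g2 p2 = snd q2 - subst2 (snd \<sigma>') p2"
    using C[OF _ _ le[OF T1(2)] le[OF T2(2)]] T1(4) T2(4) conv1_subst2[OF \<sigma>'c(2)] pc by blast
  \<comment> \<open>\<open>g1\<close> and \<open>g2\<close> have no linear part, so the Jacobian
    remains that of \<open>\<sigma>'\<close>, namely \<open>\<alpha> * \<beta>\<close>.\<close>
  define \<theta> where "\<theta> = (fst \<sigma>' + g1, snd \<sigma>' + g2)"
  have \<theta>1: "push \<theta> p1 = param_compose (puiseux False m1 z1) \<pi>1"
    unfolding q1_def[symmetric] using g1 g2 by (simp add: push_def \<theta>_def subst2_add)
  have \<theta>2: "push \<theta> p2 = param_compose (puiseux (\<delta> = 1) m2 z2) \<pi>2"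
    unfolding q2_def[symmetric] using g1 g2 by (simp add: push_def \<theta>_def subst2_add)
  note jets = max_ideal_sq_jet[OF g1(1)] max_ideal_sq_jet[OF g2(1)]
  have \<theta>0: "fst \<theta> $ 0 $ 0 = 0" "snd \<theta> $ 0 $ 0 = 0"
    using uni jets by (simp_all add: \<theta>_def \<sigma>'_def unipotent_def)
  have \<theta>J: "jacobian \<theta> \<noteq> 0"
    using uni jets \<alpha>\<beta> unfolding jacobian_def \<theta>_def \<sigma>'_def unipotent_def fst_conv snd_conv
      fps_add_nth scalar2_mult_nth by simp
  have \<theta>c: "fst \<theta> \<in> conv2" "snd \<theta> \<in> conv2"
    using \<sigma>'c max_ideal_sq_conv2 g1(1) g2(1) by (auto simp: \<theta>_def)
  have "L > 1" by (simp add: L_def)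
  have \<pi>: "\<pi>1 $ 0 = 0" "\<pi>1 $ 1 \<noteq> 0" "\<pi>2 $ 0 = 0" "\<pi>2 $ 1 \<noteq> 0"
    using \<tau> \<open>L > 1\<close> by (simp_all add: \<pi>1_def \<pi>2_def)
  have zd: "fps_X ^ Suc m1 dvd z1" "fps_X ^ Suc m2 dvd z2"
    using y by (simp_all add: fps_X_power_dvd_iff z1_def z2_def w1_def w2_def del: power_Suc)
  have zc: "z1 \<in> conv1" "z2 \<in> conv1" by (simp_all add: z1_def z2_def conv1_fps_cutoff)
  have "is_bigerm (puiseux False m1 z1, puiseux (\<delta> = 1) m2 z2)"
    by (rule is_bigerm_image[OF m x zd zc big \<theta>0 \<theta>J \<pi> \<theta>1 \<theta>2])
  moreover have "(\<pi>1, \<pi>2, \<theta>) \<in> aut1 \<times> aut1 \<times> aut2"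
    using \<pi> \<theta>0 \<theta>J \<theta>c conv1_fps_cutoff
    by (cases \<theta>) (auto simp: aut1_def aut2_def jacobian_def \<pi>1_def \<pi>2_def)
  moreover have "(puiseux False m1 z1, puiseux (\<delta> = 1) m2 z2) = act_bigerm (\<pi>1, \<pi>2, \<theta>) (p1, p2)"
    using act_param_eq[OF \<theta>1 \<pi>(1,2)] act_param_eq[OF \<theta>2 \<pi>(3,4)] by (simp add: act_bigerm_def)
  ultimately have equiv: "A_equivalent (p1, p2) (puiseux False m1 z1, puiseux (\<delta> = 1) m2 z2)"
    unfolding A_equivalent_def using big by blast
  have "z1 $ j1 = 1" using lt r0 nz by (simp add: z1_def w1_def \<beta>_def power_divide)
  moreover have "z1 $ k = 1"
  proof -
    have "r ^ k = r ^ j1 * r ^ (k - j1)" using jk by (simp flip: power_add)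
    also have "\<dots> = r ^ j1 * (y1 $ k / y1 $ j1)" by (simp only: r)
    finally show ?thesis using lt r0 nz by (simp add: z1_def w1_def \<beta>_def power_divide)
  qed
  moreover have "n = j1 \<or> n = k \<or> k < n \<and> free1 n" if "z1 $ n \<noteq> 0" for n
    using that supp1[of n] by (simp add: z1_def w1_def split: if_splits)
  moreover have "m2 < n \<and> free2 n" if "z2 $ n \<noteq> 0" for n
    using that supp2[of n] by (simp add: z2_def w2_def split: if_splits)
  ultimately show ?thesis using \<open>m1 < j1\<close> jk(3) equiv by blast
qed

end

section \<open>The normal form in the notation of the classification\<close>

theorem theorem8:
  fixes \<delta> m1 m2 :: nat
    and \<Gamma> \<Lambda> :: "(enat \<times> enat) set"
    and \<phi> :: bigerm
  assumes "\<delta> \<in> {1, 2}"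
    and "\<phi> \<in> Sigma_set \<delta> \<Gamma> \<Lambda>"
    and "bigerm_mult \<phi> = (m1, m2)"
  shows
    "\<exists>\<psi>. A_equivalent \<phi> \<psi> \<and>
      (\<delta> = 1 \<and>
        ((\<exists>j1 k a1 a2. m1 < j1 \<and> j1 < k \<and>
            \<psi> = ((fps_X ^ m1,
                  fps_X ^ j1 + fps_X ^ k +
                  terms_in {j. k < j \<and> (j, j) \<notin> maximal_points \<Lambda> \<and> fiber1 \<Lambda> (j, j) = {}} a1),
                 (terms_in {j. m2 < j \<and> fiber2 \<Lambda> (j, j) = {}} a2, fps_X ^ m2))) \<or>
         (\<exists>j1 j2. m1 < j1 \<and> m2 < j2 \<and>
            \<psi> = ((fps_X ^ m1, fps_X ^ j1), (fps_X ^ j2, fps_X ^ m2))) \<or>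
         (\<exists>j1. m1 < j1 \<and> \<psi> = ((fps_X ^ m1, fps_X ^ j1), (0, fps_X))) \<or>
         \<psi> = ((fps_X, 0), (0, fps_X))) \<or>
       \<delta> = 2 \<and>
        ((\<exists>j1 k a1 a2. m1 < j1 \<and> j1 < k \<and>
            \<psi> = ((fps_X ^ m1,
                  fps_X ^ j1 + fps_X ^ k +
                  terms_in {j. k < j \<and> (j, j) \<notin> maximal_points \<Lambda> \<and> fiber1 \<Lambda> (j, j) = {}} a1),
                 (fps_X ^ m2, terms_in {j. m2 < j \<and> fiber2 \<Lambda> (j, j) = {}} a2))) \<or>
         (\<exists>j1 j2. m1 < j1 \<and> m2 < j2 \<and> (m1 \<noteq> m2 \<or> j1 \<noteq> j2) \<and>
            \<psi> = ((fps_X ^ m1, fps_X ^ j1), (fps_X ^ m2, fps_X ^ j2))) \<or>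
         (\<exists>j1 a. m1 < j1 \<and> a \<noteq> 0 \<and> a \<noteq> 1 \<and>
            \<psi> = ((fps_X ^ m1, fps_X ^ j1), (fps_X ^ m1, fps_const a * fps_X ^ j1))) \<or>
         (\<exists>j1. m1 < j1 \<and> \<psi> = ((fps_X ^ m1, fps_X ^ j1), (fps_X, 0)))))"
proof -
  have big: "is_bigerm \<phi>" and pf: "puiseux_form \<delta> \<phi>" and \<Lambda>: "Lambda_set \<delta> \<phi> = \<Lambda>"
    using assms(2) by (auto simp: Sigma_set_def)
  obtain a1 a2 where f1: "fst \<phi> = puiseux False m1 (terms_in {m1<..} a1)"
    and f2: "snd \<phi> = puiseux (\<delta> = 1) m2 (terms_in {m2<..} a2)"
    using pf assms(3) by (fastforce simp: puiseux_form_def puiseux_def)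
  define x1 x2 where "x1 = terms_in {m1<..} a1" and "x2 = terms_in {m2<..} a2"
  have \<phi>: "\<phi> = (puiseux False m1 x1, puiseux (\<delta> = 1) m2 x2)"
    using f1 f2 by (simp add: x1_def x2_def prod_eq_iff)
  have x: "fps_X ^ Suc m1 dvd x1" "fps_X ^ Suc m2 dvd x2"
    by (simp_all add: fps_X_power_dvd_iff x1_def x2_def terms_in_def del: power_Suc)
  have "map_germ (puiseux False m1 x1)" "map_germ (puiseux (\<delta> = 1) m2 x2)"
    using big by (auto simp: is_bigerm_def branch_param_def \<phi>)
  \<comment> \<open>Multiplicity 0 is excluded because \<open>fps_X ^ 0\<close> has constant term
    1.\<close>
  then have m: "m1 \<ge> 1" "m2 \<ge> 1"
    by (auto simp: map_germ_def puiseux_def Suc_le_eq split: if_splits intro!: gr0I)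
  interpret puiseux_bigerm \<delta> m1 m2 x1 x2
    by unfold_locales (use assms(1) m x big \<phi> in auto)
  obtain j1 k z1 z2 where jk: "m1 < j1" "j1 < k"
    and eq: "A_equivalent \<phi> (puiseux False m1 z1, puiseux (\<delta> = 1) m2 z2)"
    and z: "z1 $ j1 = 1" "z1 $ k = 1"
    and z1: "\<And>n. z1 $ n \<noteq> 0 \<Longrightarrow> n = j1 \<or> n = k \<or> k < n \<and> (n, n) \<notin> maximal_points \<Lambda> \<and> fiber1 \<Lambda> (n, n) = {}"
    and z2: "\<And>n. z2 $ n \<noteq> 0 \<Longrightarrow> m2 < n \<and> fiber2 \<Lambda> (n, n) = {}"
    using normal_form[unfolded \<phi>[symmetric] \<Lambda>] by blast
  \<comment> \<open>The remaining terms take their coefficients from \<open>z1\<close> itself: the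
    index set lies above \<open>k\<close>, so the two leading terms are not counted twice, and the
    support condition makes the restriction lossless.\<close>
  have e1: "z1 = fps_X ^ j1 + fps_X ^ k +
      terms_in {j. k < j \<and> (j, j) \<notin> maximal_points \<Lambda> \<and> fiber1 \<Lambda> (j, j) = {}} (fps_nth z1)"
    using z z1 jk by (intro fps_ext) (auto simp: terms_in_def)
  have e2: "z2 = terms_in {j. m2 < j \<and> fiber2 \<Lambda> (j, j) = {}} (fps_nth z2)"
    using z2 by (intro fps_ext) (auto simp: terms_in_def)
  show ?thesis
  proof (cases "\<delta> = 1")
    case True
    have equiv: "A_equivalent \<phi> ((fps_X ^ m1, z1), (z2, fps_X ^ m2))"
      using eq True by (simp add: puiseux_def)
    show ?thesis
      by (rule exI, rule conjI, rule equiv, rule disjI1, rule conjI[OF True], rule disjI1,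
        intro exI[of _ j1] exI[of _ k]
        exI[of _ "fps_nth z1"] exI[of _ "fps_nth z2"])
        (simp only: e1[symmetric] e2[symmetric] jk simp_thms)
  next
    case False
    then have "\<delta> = 2" using assms(1) by simp
    have equiv: "A_equivalent \<phi> ((fps_X ^ m1, z1), (fps_X ^ m2, z2))"
      using eq False by (simp add: puiseux_def)
    show ?thesis
      by (rule exI, rule conjI, rule equiv, rule disjI2, rule conjI[OF \<open>\<delta> = 2\<close>], rule disjI1,
        intro exI[of _ j1] exI[of _ k]
        exI[of _ "fps_nth z1"] exI[of _ "fps_nth z2"])
        (simp only: e1[symmetric] e2[symmetric] jk simp_thms)
  qed
qed

end
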